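(* Let $m,n\ge 2$ be integers. Then for any $x\in X_n$ the group $\mathcal{O}_{m,1}$ contains an isomorphic copy of the group $\mathcal{O}_n^{x}$.
   Context: Words. For an integer $k\ge2$, $X_k=\{0,1,\ldots,k-1\}$; $X_k^*$ is the set of finite words over $X_k$ ($\varepsilon$ the empty word); $X_k^\omega$ is the set of infinite sequences with the product topology; $U_\gamma\subseteq X_k^\omega$ is the set of sequences with prefix $\gamma$. The definitions below are made for $n$ and apply equally with $m$ in place of $n$. Transducers. A transducer is $T=(X_n,Q_T,\pi_T,\lambda_T)$ with $Q_T$ a countable set of states, $\pi_T:X_n\times Q_T\to Q_T$ and $\lambda_T:X_n\times Q_T\to X_n^*$. These are extended to finite words by $\pi_T(\varepsilon,q)=q$, $\lambda_T(\varepsilon,q)=\varepsilon$, $\pi_T(wa,q)=\pi_T(a,\pi_T(w,q))$, $\lambda_T(wa,q)=\lambda_T(w,q)\lambda_T(a,\pi_T(w,q))$, and $\lambda_T$ is extended to infinite words by concatenating outputs. It is always assumed that every infinite input, read from any state, gives an infinite output. For $q\in Q_T$ let $h_q:X_n^\omega\to X_n^\omega$, $h_q(w)=\lambda_T(w,q)$, and $\mathrm{im}(q)=h_q(X_n^\omega)$. Two states are $\omega$-equivalent if they induce the same map. A state $q$ is a state of incomplete response if the longest common prefix $\Lambda(\varepsilon,q)$ of $\mathrm{im}(q)$ is non-empty. $T$ is minimal if no two distinct states are $\omega$-equivalent, there are no states of incomplete response, and $T$ is strongly connected as a directed graph. Transducers that agree up to a bijection of states preserving the induced maps are identified. $T$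 is strongly synchronizing if for some $k$, for every word $w$ of length $k$, $\pi_T(w,q)$ does not depend on $q$; the states of the form $\pi_T(w,q)$, $|w|=k$, form the core of $T$ (a subtransducer), and $T$ is core if it equals its core. The group $\mathcal{O}_n$. $\mathcal{SO}_n$ is the set of minimal, strongly synchronizing, core transducers $T$ such that for every $t\in Q_T$ the map $h_t$ is injective with clopen image. The product $T*U$ has state set $Q_T\times Q_U$, $\pi_{T*U}(x,(p,q))=(\pi_T(x,p),\pi_U(\lambda_T(x,p),q))$, $\lambda_{T*U}(x,(p,q))=\lambda_U(\lambda_T(x,p),q)$. For $T,U\in\mathcal{SO}_n$, $TU\in\mathcal{SO}_n$ is obtained from the core of $T*U$ by removing incomplete response (replacing each output $\lambda(a,q)$ by the word obtained from $\lambda(a,q)\Lambda(\varepsilon,\pi(a,q))$ by deleting its prefix $\Lambda(\varepsilon,q)$), identifying $\omega$-equivalent states, and taking the core. This makes $\mathcal{SO}_n$ a monoid whose identity is the single-state identity transducer, and $\mathcal{O}_n$ is its largest inverse-closed subset (its group of units). The subgroup $\mathcal{O}_{n,1}$. For a homeomorphism $h$ of $X_n^\omega$ and $\nu\in X_n^*$, the local action $h_\nu:X_n^\omega\to X_n^\omega$ sends $y$ to the sequence obtained from $h(\nu y)$ by deleting the longest common prefix of $h(U_\nu)$. Call $h$ strongly synchronizing if for some $k$ one has $h_{u\nu}=h_{u'\nu}$ for all $u,u'\in X_n^*$ and all $\nu$ of length $k$. In that case the core of $h$ is the transducer whose states are the maps $h_\nu$ with $|\nu|\ge k$, where reading $a\in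 X_n$ from $h_\nu$ leads to $h_{\nu a}$ with output the longest common prefix of $h_\nu(U_a)$. Then $\mathcal{O}_{n,1}$ is the subgroup of $\mathcal{O}_n$ consisting of the cores of all homeomorphisms $h$ of $X_n^\omega$ such that $h$ and $h^{-1}$ are both strongly synchronizing; $\mathcal{O}_{n,1}\cong\mathrm{Out}(G_{n,1})$, with $G_{n,1}$ the Higman–Thompson group. The group $\mathcal{O}_n^x$. For $x\in X_n$, $\mathcal{O}_n^x$ is the set of all $T\in\mathcal{O}_n$ such that: (1) there is a (necessarily unique) state $q_x\in Q_T$ with $\pi_T(x,q)=q_x$ for all $q\in Q_T$; (2) for every $q\in Q_T$, $\lambda_T(x,q)=wx$ for some $w\in X_n^*$ not containing the letter $x$; (3) for every $u\in X_n^*$ and $q\in Q_T$ such that $\lambda_T(u,q)$ contains $x$, there is a prefix $u_1$ of $u$ such that $u_1x$ is a prefix of $u$, $u_1$ does not contain $x$, $\lambda_T(u_1,q)$ does not contain $x$, and the maximal suffix of $\lambda_T(u_1x,q)$ lying in $\{x\}^*$ is $x$. The set $\mathcal{O}_n^x$ is a group under the operation of $\mathcal{O}_n$. *)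

theory Defs
  imports
    "HOL-Analysis.Analysis"
    "HOL-Algebra.Group"
    "HOL-Library.Omega_Words_Fun"
begin

text \<open>
  The alphabet of size \<open>n\<close> is \<open>{..<n}\<close>. Finite words are lists, infinite words are functions on
  \<open>nat\<close>, with \<open>\<frown>\<close>, \<open>prefix\<close> and \<open>suffix\<close> from \<open>HOL-Library.Omega_Words_Fun\<close>. Maps between spaces of
  sequences are extensional (undefined outside \<open>seqs n\<close>), so that equality of functions is
  equality of maps.
\<close>

abbreviation words :: "nat \<Rightarrow> nat list set"
  where "words n \<equiv> lists {..<n}"

definition cantor :: "nat \<Rightarrow> nat word topology"
  where "cantor n = product_topology (\<lambda>_. discrete_topology {..<n}) UNIV"

definition seqs :: "nat \<Rightarrow> nat word set"
  where "seqs n = {s. \<forall>i. s i < n}"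

lemma topspace_cantor: "topspace (cantor n) = seqs n"
  by (auto simp: cantor_def seqs_def PiE_def)

definition cyl :: "nat \<Rightarrow> nat list \<Rightarrow> nat word set"
  where "cyl n \<gamma> = {\<gamma> \<frown> y | y. y \<in> seqs n}"

definition common_prefix :: "'a list \<Rightarrow> 'a word set \<Rightarrow> bool"
  where "common_prefix w A \<longleftrightarrow> (\<forall>s\<in>A. \<exists>t. s = w \<frown> t)"

text \<open>
  Only meaningful if \<open>A\<close> has at least two elements, i.e. if the common prefixes have bounded
  length; for \<open>n \<ge> 2\<close> this is the case for images of nonempty open sets under injective maps.
\<close>
definition lcp :: "'a word set \<Rightarrow> 'a list"
  where "lcp A = (ARG_MAX length w. common_prefix w A)"


subsection \<open>Transducers\<close>

record 'q transducer =
  states :: "'q set"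
  next_state :: "nat \<Rightarrow> 'q \<Rightarrow> 'q"
  outp :: "nat \<Rightarrow> 'q \<Rightarrow> nat list"

definition trans_word :: "'q transducer \<Rightarrow> nat list \<Rightarrow> 'q \<Rightarrow> 'q"
  where "trans_word T = fold (next_state T)"

fun out_word :: "'q transducer \<Rightarrow> nat list \<Rightarrow> 'q \<Rightarrow> nat list" where
  "out_word T [] q = []"
| "out_word T (a # w) q = outp T a q @ out_word T w (next_state T a q)"

lemma trans_word_snoc:
  "trans_word T [] q = q"
  "trans_word T (w @ [a]) q = next_state T a (trans_word T w q)"
  by (simp_all add: trans_word_def)

lemma out_word_append:
  "out_word T (v @ w) q = out_word T v q @ out_word T w (trans_word T v q)"
  by (induction v arbitrary: q) (simp_all add: trans_word_def)

lemma out_word_snoc: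
  "out_word T (w @ [a]) q = out_word T w q @ outp T a (trans_word T w q)"
  by (simp add: out_word_append)

definition is_transducer :: "nat \<Rightarrow> 'q transducer \<Rightarrow> bool"
  where "is_transducer n T \<longleftrightarrow>
    states T \<noteq> {} \<and> countable (states T) \<and>
    (\<forall>a<n. \<forall>q\<in>states T. next_state T a q \<in> states T \<and> outp T a q \<in> words n) \<and>
    (\<forall>q\<in>states T. \<forall>w\<in>seqs n. \<forall>l. \<exists>k. l \<le> length (out_word T (prefix k w) q))"

text \<open>
  The map \<open>h\<^sub>q\<close>: its value at \<open>w\<close> is the infinite concatenation of the outputs, i.e. the unique
  sequence having the outputs of all finite prefixes of \<open>w\<close> as prefixes.
\<close>
definition induced :: "nat \<Rightarrow> 'q transducer \<Rightarrow> 'q \<Rightarrow> nat word \<Rightarrow> nat word"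
  where "induced n T q =
    (\<lambda>w\<in>seqs n. THE s. \<forall>k. \<exists>t. s = out_word T (prefix k w) q \<frown> t)"

definition image_state :: "nat \<Rightarrow> 'q transducer \<Rightarrow> 'q \<Rightarrow> nat word set"
  where "image_state n T q = induced n T q ` seqs n"

text \<open>
  Equivalent to non-emptiness of the longest common prefix, also when \<open>image_state\<close> is a singleton
  (where that prefix is infinite and \<open>lcp\<close> is not meaningful).
\<close>
definition incomplete_response :: "nat \<Rightarrow> 'q transducer \<Rightarrow> 'q \<Rightarrow> bool"
  where "incomplete_response n T q \<longleftrightarrow> (\<exists>w. w \<noteq> [] \<and> common_prefix w (image_state n T q))"

definition strongly_connected :: "nat \<Rightarrow> 'q transducer \<Rightarrow> bool"
  where "strongly_connected n T \<longleftrightarrow>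
    (\<forall>p\<in>states T. \<forall>q\<in>states T. \<exists>w\<in>words n. trans_word T w p = q)"

definition minimal :: "nat \<Rightarrow> 'q transducer \<Rightarrow> bool"
  where "minimal n T \<longleftrightarrow>
    (\<forall>p\<in>states T. \<forall>q\<in>states T. induced n T p = induced n T q \<longrightarrow> p = q) \<and>
    (\<forall>q\<in>states T. \<not> incomplete_response n T q) \<and>
    strongly_connected n T"

definition synchronizing_at :: "nat \<Rightarrow> 'q transducer \<Rightarrow> nat \<Rightarrow> bool"
  where "synchronizing_at n T k \<longleftrightarrow>
    (\<forall>w\<in>words n. length w = k \<longrightarrow>
      (\<forall>p\<in>states T. \<forall>q\<in>states T. trans_word T w p = trans_word T w q))"

definition strongly_synchronizing :: "nat \<Rightarrow> 'q transducer \<Rightarrow> bool"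
  where "strongly_synchronizing n T \<longleftrightarrow> (\<exists>k. synchronizing_at n T k)"

text \<open>The set of core states is the same for every synchronizing level \<open>k\<close>.\<close>
definition core_states :: "nat \<Rightarrow> 'q transducer \<Rightarrow> 'q set"
  where "core_states n T = {trans_word T w q | w q k.
    synchronizing_at n T k \<and> w \<in> words n \<and> length w = k \<and> q \<in> states T}"

text \<open>Transition and output functions are made undefined off their domain.\<close>
definition restrict_to :: "nat \<Rightarrow> 'q set \<Rightarrow> 'q transducer \<Rightarrow> 'q transducer"
  where "restrict_to n Q T =
    \<lparr>states = Q,
     next_state = (\<lambda>a q. if a < n \<and> q \<in> Q then next_state T a q else undefined),
     outp = (\<lambda>a q. if a < n \<and> q \<in> Q then outp T a q else undefined)\<rparr>"

definition core :: "nat \<Rightarrow> 'q transducer \<Rightarrow> 'q transducer"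
  where "core n T = restrict_to n (core_states n T) T"

definition remove_incomplete_response :: "nat \<Rightarrow> 'q transducer \<Rightarrow> 'q transducer"
  where "remove_incomplete_response n T =
    (let \<Lambda> = (\<lambda>q. lcp (image_state n T q)) in
     T\<lparr>outp := (\<lambda>a q. drop (length (\<Lambda> q)) (outp T a q @ \<Lambda> (next_state T a q)))\<rparr>)"

text \<open>
  Identification of \<open>\<omega>\<close>-equivalent states: the class of a state is represented by the map that the
  state induces. In a transducer without states of incomplete response, transitions and outputs
  do not depend on the chosen representative (lemma \<open>response_unique\<close> below). The result also
  serves as the canonical representative of a minimal transducer up to bijections of states
  preserving the induced maps (lemmas \<open>induced_canonical\<close>, \<open>canonical_eq_iff\<close> below).
\<close>
definition canonical :: "nat \<Rightarrow> 'q transducer \<Rightarrow> (nat word \<Rightarrow> nat word) transducer"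
  where "canonical n T = restrict_to n (induced n T ` states T)
    \<lparr>states = induced n T ` states T,
     next_state = (\<lambda>a f. induced n T (next_state T a (inv_into (states T) (induced n T) f))),
     outp = (\<lambda>a f. outp T a (inv_into (states T) (induced n T) f))\<rparr>"

definition prod_transducer :: "'p transducer \<Rightarrow> 'q transducer \<Rightarrow> ('p \<times> 'q) transducer"
  where "prod_transducer T U =
    \<lparr>states = states T \<times> states U,
     next_state = (\<lambda>a (p, q). (next_state T a p, trans_word U (outp T a p) q)),
     outp = (\<lambda>a (p, q). out_word U (outp T a p) q)\<rparr>"


subsection \<open>The monoid \<open>SO\<^sub>n\<close> and the group \<open>O\<^sub>n\<close>\<close>

type_synonym ctransducer = "(nat word \<Rightarrow> nat word) transducer"

definition is_SO :: "nat \<Rightarrow> 'q transducer \<Rightarrow> bool"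
  where "is_SO n T \<longleftrightarrow>
    is_transducer n T \<and> minimal n T \<and> strongly_synchronizing n T \<and>
    core_states n T = states T \<and>
    (\<forall>t\<in>states T. inj_on (induced n T t) (seqs n) \<and>
      openin (cantor n) (image_state n T t) \<and> closedin (cantor n) (image_state n T t))"

definition SO_mult :: "nat \<Rightarrow> ctransducer \<Rightarrow> ctransducer \<Rightarrow> ctransducer"
  where "SO_mult n T U =
    core n (canonical n (remove_incomplete_response n (core n (prod_transducer T U))))"

definition id_transducer :: "unit transducer"
  where "id_transducer = \<lparr>states = UNIV, next_state = (\<lambda>a q. q), outp = (\<lambda>a q. [a])\<rparr>"

text \<open>
  Transducers agreeing up to a bijection of states preserving the induced maps are identified:
  the elements are the transducers that are their own canonical representative.
\<close>
definition SO :: "nat \<Rightarrow> ctransducer monoid"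
  where "SO n =
    \<lparr>carrier = {T. is_SO n T \<and> canonical n T = T},
     Group.monoid.mult = SO_mult n,
     one = canonical n id_transducer\<rparr>"

definition O_group :: "nat \<Rightarrow> ctransducer monoid"
  where "O_group n = units_of (SO n)"


subsection \<open>The subgroup \<open>O\<^sub>n\<^sub>,\<^sub>1\<close>\<close>

definition local_action :: "nat \<Rightarrow> (nat word \<Rightarrow> nat word) \<Rightarrow> nat list \<Rightarrow> nat word \<Rightarrow> nat word"
  where "local_action n h \<nu> =
    (\<lambda>y\<in>seqs n. suffix (length (lcp (h ` cyl n \<nu>))) (h (\<nu> \<frown> y)))"

definition map_synchronizing_at :: "nat \<Rightarrow> (nat word \<Rightarrow> nat word) \<Rightarrow> nat \<Rightarrow> bool"
  where "map_synchronizing_at n h k \<longleftrightarrow>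
    (\<forall>u\<in>words n. \<forall>u'\<in>words n. \<forall>\<nu>\<in>words n. length \<nu> = k \<longrightarrow>
      local_action n h (u @ \<nu>) = local_action n h (u' @ \<nu>))"

text \<open>
  Used for \<open>k\<close> with \<open>map_synchronizing_at n h k\<close>; the result does not depend on the choice of such
  a \<open>k\<close>, and the successor \<open>h\<^bsub>\<nu>a\<^esub>\<close> depends only on \<open>h\<^sub>\<nu>\<close> and \<open>a\<close>, not on \<open>\<nu>\<close>.
\<close>
definition map_core :: "nat \<Rightarrow> (nat word \<Rightarrow> nat word) \<Rightarrow> nat \<Rightarrow> ctransducer"
  where "map_core n h k =
    \<lparr>states = {local_action n h \<nu> | \<nu>. \<nu> \<in> words n \<and> k \<le> length \<nu>},
     next_state = (\<lambda>a f. SOME g. \<exists>\<nu>\<in>words n. k \<le> length \<nu> \<and>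
       f = local_action n h \<nu> \<and> g = local_action n h (\<nu> @ [a])),
     outp = (\<lambda>a f. lcp (f ` cyl n [a]))\<rparr>"

definition O1_group :: "nat \<Rightarrow> ctransducer monoid"
  where "O1_group n = (O_group n)\<lparr>carrier :=
    {T \<in> carrier (O_group n). \<exists>h g k.
      homeomorphic_maps (cantor n) (cantor n) h g \<and>
      map_synchronizing_at n h k \<and> (\<exists>l. map_synchronizing_at n g l) \<and>
      T = canonical n (map_core n h k)}\<rparr>"


subsection \<open>The group \<open>O\<^sub>n\<^sup>x\<close>\<close>

definition trailing :: "'a \<Rightarrow> 'a list \<Rightarrow> 'a list"
  where "trailing x w = rev (takeWhile (\<lambda>a. a = x) (rev w))"

definition Ox_condition :: "nat \<Rightarrow> nat \<Rightarrow> 'q transducer \<Rightarrow> bool"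
  where "Ox_condition n x T \<longleftrightarrow>
    (\<exists>q\<^sub>x\<in>states T. \<forall>q\<in>states T. next_state T x q = q\<^sub>x) \<and>
    (\<forall>q\<in>states T. \<exists>w\<in>words n. outp T x q = w @ [x] \<and> x \<notin> set w) \<and>
    (\<forall>u\<in>words n. \<forall>q\<in>states T. x \<in> set (out_word T u q) \<longrightarrow>
      (\<exists>u\<^sub>1 u\<^sub>2. u = u\<^sub>1 @ [x] @ u\<^sub>2 \<and> x \<notin> set u\<^sub>1 \<and> x \<notin> set (out_word T u\<^sub>1 q) \<and>
        trailing x (out_word T (u\<^sub>1 @ [x]) q) = [x]))"

definition Ox_group :: "nat \<Rightarrow> nat \<Rightarrow> ctransducer monoid"
  where "Ox_group n x = (O_group n)\<lparr>carrier := {T \<in> carrier (O_group n). Ox_condition n x T}\<rparr>"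


subsection \<open>Canonical representatives\<close>

lemma conc_seqs: "y \<in> seqs n \<Longrightarrow> w \<in> words n \<Longrightarrow> w \<frown> y \<in> seqs n"
  by (force simp: seqs_def conc_def in_lists_conv_set)

lemma prefix_words: "w \<in> seqs n \<Longrightarrow> prefix k w \<in> words n"
  by (auto simp: seqs_def in_lists_conv_set)

lemma trans_word_states:
  "is_transducer n T \<Longrightarrow> q \<in> states T \<Longrightarrow> w \<in> words n \<Longrightarrow> trans_word T w q \<in> states T"
  by (induction w arbitrary: q) (auto simp: trans_word_def is_transducer_def)

lemma out_word_prefix:
  assumes "j \<le> k"
  shows "\<exists>t. out_word T (prefix k w) q = out_word T (prefix j w) q @ t"
proof -
  have "prefix k w = prefix j w @ w [j \<rightarrow> k]"
    using assms subsequence_append[where i = j and j = "k - j" and w = w] by simp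
  then show ?thesis by (simp add: out_word_append)
qed

lemma conc_iff_nth: "(\<exists>t. s = v \<frown> t) \<longleftrightarrow> (\<forall>i<length v. s i = v ! i)"
proof
  assume "\<forall>i<length v. s i = v ! i"
  then have "prefix (length v) s = v"
    by (auto intro!: nth_equalityI)
  then show "\<exists>t. s = v \<frown> t" by (metis prefix_suffix)
qed auto

lemma ex1_induced:
  assumes "is_transducer n T" "q \<in> states T" "w \<in> seqs n"
  shows "\<exists>!s. \<forall>k. \<exists>t. s = out_word T (prefix k w) q \<frown> t"
proof -
  have ex: "\<exists>k. i < length (out_word T (prefix k w) q)" for i
    using assms unfolding is_transducer_def by (meson Suc_le_lessD)
  define K where "K i = (SOME k. i < length (out_word T (prefix k w) q))" for i
  have K: "i < length (out_word T (prefix (K i) w) q)" for i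
    unfolding K_def using someI_ex[OF ex] .
  have eq: "out_word T (prefix j w) q ! i = out_word T (prefix k w) q ! i"
    if "i < length (out_word T (prefix j w) q)" "i < length (out_word T (prefix k w) q)" for i j k
    using that out_word_prefix[of j k T w q] out_word_prefix[of k j T w q]
    by (metis nat_le_linear nth_append)
  show ?thesis
  proof (rule ex1I)
    show "\<forall>k. \<exists>t. (\<lambda>i. out_word T (prefix (K i) w) q ! i) = out_word T (prefix k w) q \<frown> t"
      unfolding conc_iff_nth using eq K by blast
  next
    fix s assume "\<forall>k. \<exists>t. s = out_word T (prefix k w) q \<frown> t"
    then show "s = (\<lambda>i. out_word T (prefix (K i) w) q ! i)"
      unfolding conc_iff_nth using K by blast
  qed
qed

lemma induced_prefix:
  assumes "is_transducer n T" "q \<in> states T" "w \<in> seqs n"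
  shows "\<exists>t. induced n T q w = out_word T (prefix k w) q \<frown> t"
  using theI'[OF ex1_induced[OF assms]] assms(3) unfolding induced_def by simp

lemma induced_eqI:
  assumes "is_transducer n T" "q \<in> states T" "w \<in> seqs n"
    "\<And>k. \<exists>t. s = out_word T (prefix k w) q \<frown> t"
  shows "induced n T q w = s"
  using ex1_induced[OF assms(1-3)] assms(4) induced_prefix[OF assms(1-3)] by blast

lemma induced_conc:
  assumes T: "is_transducer n T" "q \<in> states T" and a: "a < n" and y: "y \<in> seqs n"
  shows "induced n T q ([a] \<frown> y) = outp T a q \<frown> induced n T (next_state T a q) y"
proof (rule induced_eqI[OF T])
  show "[a] \<frown> y \<in> seqs n" using a y by (intro conc_seqs) auto
  have q': "next_state T a q \<in> states T" using T a by (auto simp: is_transducer_def)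
  fix k
  show "\<exists>t. outp T a q \<frown> induced n T (next_state T a q) y = out_word T (prefix k ([a] \<frown> y)) q \<frown> t"
  proof (cases k)
    case (Suc j)
    have "prefix k ([a] \<frown> y) = a # prefix j y"
      using prefix_conc_snd[of "[a]" k y] Suc by simp
    moreover obtain t where "induced n T (next_state T a q) y = out_word T (prefix j y) (next_state T a q) \<frown> t"
      using induced_prefix[OF T(1) q' y] by blast
    ultimately show ?thesis by (auto intro!: exI[of _ t])
  qed auto
qed

lemma conc_cancel_length:
  assumes "u \<frown> s = v \<frown> t" "length u \<le> length v"
  shows "s = drop (length u) v \<frown> t"
proof
  fix i
  have "s i = (u \<frown> s) (length u + i)" by simp
  also have "\<dots> = (v \<frown> t) (length u + i)" using assms(1) by simp
  also have "\<dots> = (drop (length u) v \<frown> t) i"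
    using assms(2) by (auto simp: conc_def intro!: arg_cong[where f = t])
  finally show "s i = (drop (length u) v \<frown> t) i" .
qed

lemma induced_ext: "w \<notin> seqs n \<Longrightarrow> induced n T q w = undefined"
  by (simp add: induced_def)

text \<open>The maps induced by two states determine outputs and the maps induced by their successors.\<close>
lemma response_unique:
  assumes T: "is_transducer n T" "p \<in> states T" and U: "is_transducer n U" "q \<in> states U"
    and inc: "\<forall>q\<in>states T. \<not> incomplete_response n T q" "\<forall>q\<in>states U. \<not> incomplete_response n U q"
    and eq: "induced n T p = induced n U q" and a: "a < n"
  shows "outp T a p = outp U a q"
    and "induced n T (next_state T a p) = induced n U (next_state U a q)"
proof -
  have p': "next_state T a p \<in> states T" and q': "next_state U a q \<in> states U"
    using T U a by (auto simp: is_transducer_def)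
  have *: "outp T a p \<frown> induced n T (next_state T a p) y = outp U a q \<frown> induced n U (next_state U a q) y"
    if "y \<in> seqs n" for y
    using induced_conc[OF T a that] induced_conc[OF U a that] eq by simp
  have len: "length (outp T a p) = length (outp U a q)"
  proof (rule ccontr)
    assume "length (outp T a p) \<noteq> length (outp U a q)"
    then consider "length (outp T a p) < length (outp U a q)"
      | "length (outp U a q) < length (outp T a p)" by linarith
    then show False
    proof cases
      case 1
      then have "common_prefix (drop (length (outp T a p)) (outp U a q))
          (image_state n T (next_state T a p))"
        unfolding common_prefix_def image_state_def using conc_cancel_length[OF *] less_imp_le by blast
      then show False
        using 1 inc(1) p' unfolding incomplete_response_def by (meson drop_eq_Nil not_less)
    next
      case 2
      then have "common_prefix (drop (length (outp U a q)) (outp T a p))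
          (image_state n U (next_state U a q))"
        unfolding common_prefix_def image_state_def
        using conc_cancel_length[OF *[symmetric]] less_imp_le by blast
      then show False
        using 2 inc(2) q' unfolding incomplete_response_def by (meson drop_eq_Nil not_less)
    qed
  qed
  show "induced n T (next_state T a p) = induced n U (next_state U a q)"
  proof
    fix y
    show "induced n T (next_state T a p) y = induced n U (next_state U a q) y"
      using conc_cancel_length[OF *, of y] len by (cases "y \<in> seqs n") (simp_all add: induced_ext)
  qed
  have "(\<lambda>_. a) \<in> seqs n" using a by (simp add: seqs_def)
  from *[OF this] show "outp T a p = outp U a q"
    using len by (metis prefix_conc_length)
qed

context
  fixes n and T :: "'q transducer"
  assumes T: "is_transducer n T" and inc: "\<forall>q\<in>states T. \<not> incomplete_response n T q"
begin

lemma states_canonical: "states (canonical n T) = induced n T ` states T"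
  by (simp add: canonical_def restrict_to_def)

lemma canonical_step:
  assumes q: "q \<in> states T" and a: "a < n"
  shows "next_state (canonical n T) a (induced n T q) = induced n T (next_state T a q)"
    and "outp (canonical n T) a (induced n T q) = outp T a q"
proof -
  let ?p = "inv_into (states T) (induced n T) (induced n T q)"
  have p: "?p \<in> states T" "induced n T ?p = induced n T q"
    using q by (auto intro: inv_into_into f_inv_into_f)
  note * = response_unique[OF T p(1) T q inc inc p(2) a]
  show "next_state (canonical n T) a (induced n T q) = induced n T (next_state T a q)"
       "outp (canonical n T) a (induced n T q) = outp T a q"
    using * q a by (simp_all add: canonical_def restrict_to_def)
qed

lemma canonical_words:
  assumes "q \<in> states T" "w \<in> words n"
  shows "trans_word (canonical n T) w (induced n T q) = induced n T (trans_word T w q)"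
    and "out_word (canonical n T) w (induced n T q) = out_word T w q"
  using assms
proof (induction w arbitrary: q)
  case (Cons a w)
  {
    case 1
    then show ?case using Cons.IH(1)[of "next_state T a q"] T
      by (auto simp: canonical_step trans_word_def is_transducer_def)
  next
    case 2
    then show ?case using Cons.IH(2)[of "next_state T a q"] T
      by (auto simp: canonical_step is_transducer_def)
  }
qed (simp_all add: trans_word_def)

lemma is_transducer_canonical: "is_transducer n (canonical n T)"
  using T canonical_words(2)[OF _ prefix_words]
  by (auto simp: is_transducer_def states_canonical canonical_step)

lemma induced_canonical:
  assumes q: "q \<in> states T"
  shows "induced n (canonical n T) (induced n T q) = induced n T q"
proof
  fix w
  show "induced n (canonical n T) (induced n T q) w = induced n T q w"
  proof (cases "w \<in> seqs n")
    case True
    show ?thesis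
      by (rule induced_eqI[OF is_transducer_canonical _ True])
        (use q induced_prefix[OF T q True] in
          \<open>simp_all add: states_canonical canonical_words(2) prefix_words True\<close>)
  qed (simp add: induced_ext)
qed

lemma canonical_complete:
  "\<forall>q\<in>states (canonical n T). \<not> incomplete_response n (canonical n T) q"
  using inc by (auto simp: incomplete_response_def image_state_def states_canonical induced_canonical)

lemma canonical_canonical: "canonical n (canonical n T) = canonical n T"
proof -
  let ?C = "canonical n T"
  have inj: "inj_on (induced n ?C) (states ?C)" and st: "induced n ?C ` states ?C = states ?C"
    by (auto simp: states_canonical induced_canonical inj_on_def image_image)
  have id: "induced n ?C f = f" if "f \<in> states ?C" for f
    using that by (auto simp: states_canonical induced_canonical)
  have inv: "inv_into (states ?C) (induced n ?C) f = f" if "f \<in> states ?C" for f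
    using inv_into_f_f[OF inj that] id[OF that] by simp
  have cl: "next_state ?C a f \<in> states ?C" if "a < n" "f \<in> states ?C" for a f
    using is_transducer_canonical that by (auto simp: is_transducer_def)
  have "canonical n ?C = restrict_to n (states ?C) ?C"
    using inv cl id unfolding canonical_def[of n ?C] st restrict_to_def
    by (auto intro!: ext)
  also have "\<dots> = ?C"
    by (auto simp: canonical_def restrict_to_def intro!: ext)
  finally show ?thesis .
qed

end

lemma synchronizing_canonical:
  assumes "is_transducer n T" "minimal n T"
  shows "synchronizing_at n (canonical n T) k \<longleftrightarrow> synchronizing_at n T k"
proof -
  have inc: "\<forall>q\<in>states T. \<not> incomplete_response n T q"
    and inj: "\<And>p q. p \<in> states T \<Longrightarrow> q \<in> states T \<Longrightarrow> induced n T p = induced n T q \<Longrightarrow> p = q"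
    using assms(2) by (auto simp: minimal_def)
  show ?thesis
    unfolding synchronizing_at_def states_canonical[OF assms(1) inc]
    using inj trans_word_states[OF assms(1)]
    by (simp add: canonical_words[OF assms(1) inc]) metis
qed

lemma is_SO_canonical:
  assumes "is_SO n T"
  shows "is_SO n (canonical n T)" "canonical n (canonical n T) = canonical n T"
proof -
  have T: "is_transducer n T" and inc: "\<forall>q\<in>states T. \<not> incomplete_response n T q"
    and min: "minimal n T"
    and sc: "strongly_connected n T"
    and ss: "strongly_synchronizing n T" and co: "core_states n T = states T"
    and hom: "\<forall>t\<in>states T. inj_on (induced n T t) (seqs n) \<and>
      openin (cantor n) (image_state n T t) \<and> closedin (cantor n) (image_state n T t)"
    using assms by (auto simp: is_SO_def minimal_def)
  note st = states_canonical[OF T inc] and ind = induced_canonical[OF T inc]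
    and wd = canonical_words[OF T inc]
  show "canonical n (canonical n T) = canonical n T" by (rule canonical_canonical[OF T inc])
  have "strongly_connected n (canonical n T)"
    unfolding strongly_connected_def st
  proof (intro ballI)
    fix f g assume "f \<in> induced n T ` states T" "g \<in> induced n T ` states T"
    then obtain p q where pq: "p \<in> states T" "q \<in> states T" "f = induced n T p" "g = induced n T q"
      by blast
    then obtain w where "w \<in> words n" "trans_word T w p = q"
      using sc unfolding strongly_connected_def by blast
    then show "\<exists>w\<in>words n. trans_word (canonical n T) w f = g"
      using wd(1)[of p w] pq by blast
  qed
  moreover have "core_states n (canonical n T) = induced n T ` core_states n T"
  proof (intro equalityI subsetI)
    fix f assume "f \<in> core_states n (canonical n T)"
    then obtain w q k where w: "f = trans_word (canonical n T) w (induced n T q)"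
      "synchronizing_at n T k" "w \<in> words n" "length w = k" "q \<in> states T"
      unfolding core_states_def synchronizing_canonical[OF T min] st by blast
    then have "f = induced n T (trans_word T w q)" "trans_word T w q \<in> core_states n T"
      using wd(1) unfolding core_states_def by blast+
    then show "f \<in> induced n T ` core_states n T" by blast
  next
    fix f assume "f \<in> induced n T ` core_states n T"
    then obtain w q k where w: "f = induced n T (trans_word T w q)"
      "synchronizing_at n T k" "w \<in> words n" "length w = k" "q \<in> states T"
      unfolding core_states_def by blast
    then have "f = trans_word (canonical n T) w (induced n T q)"
      using wd(1)[of q w] by simp
    then show "f \<in> core_states n (canonical n T)"
      unfolding core_states_def synchronizing_canonical[OF T min] st using w by blast
  qed
  moreover have "minimal n (canonical n T)" if "strongly_connected n (canonical n T)"
    using that canonical_complete[OF T inc] unfolding minimal_def st by (simp add: ind)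
  moreover have "strongly_synchronizing n (canonical n T)"
    using ss unfolding strongly_synchronizing_def synchronizing_canonical[OF T min] .
  moreover have "image_state n (canonical n T) (induced n T q) = image_state n T q"
    if "q \<in> states T" for q
    using that by (simp add: image_state_def ind)
  ultimately show "is_SO n (canonical n T)"
    unfolding is_SO_def st using co hom is_transducer_canonical[OF T inc]
    by (simp add: ind)
qed

lemma canonical_eq_iff:
  assumes T: "is_transducer n T" "minimal n T" and U: "is_transducer n U" "minimal n U"
  shows "canonical n T = canonical n U \<longleftrightarrow>
    (\<exists>f. bij_betw f (states T) (states U) \<and> (\<forall>q\<in>states T. induced n U (f q) = induced n T q))"
proof
  have iT: "\<forall>q\<in>states T. \<not> incomplete_response n T q" and iU: "\<forall>q\<in>states U. \<not> incomplete_response n U q"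
    and bT: "bij_betw (induced n T) (states T) (induced n T ` states T)"
    and bU: "bij_betw (induced n U) (states U) (induced n U ` states U)"
    using T U by (auto simp: minimal_def bij_betw_def inj_on_def)
  {
    assume "canonical n T = canonical n U"
    then have im: "induced n T ` states T = induced n U ` states U"
      by (metis states_canonical[OF T(1) iT] states_canonical[OF U(1) iU])
    let ?f = "inv_into (states U) (induced n U) \<circ> induced n T"
    have "bij_betw ?f (states T) (states U)"
      using bij_betw_trans[OF bT[unfolded im] bij_betw_inv_into[OF bU]] .
    moreover have "\<forall>q\<in>states T. induced n U (?f q) = induced n T q"
      using im by (auto intro!: f_inv_into_f)
    ultimately show "\<exists>f. bij_betw f (states T) (states U) \<and>
        (\<forall>q\<in>states T. induced n U (f q) = induced n T q)" by blast
  next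
    assume "\<exists>f. bij_betw f (states T) (states U) \<and>
        (\<forall>q\<in>states T. induced n U (f q) = induced n T q)"
    then obtain f where f: "bij_betw f (states T) (states U)"
      "\<And>q. q \<in> states T \<Longrightarrow> induced n U (f q) = induced n T q" by blast
    have im: "induced n T ` states T = induced n U ` states U"
      using f unfolding bij_betw_def by (force simp: image_image)
    have "next_state (canonical n T) a g = next_state (canonical n U) a g \<and>
        outp (canonical n T) a g = outp (canonical n U) a g" for a g
    proof (cases "a < n \<and> g \<in> induced n T ` states T")
      case True
      then obtain q where q: "q \<in> states T" "g = induced n T q" by auto
      have fq: "f q \<in> states U" "g = induced n U (f q)"
        using f q by (auto simp: bij_betw_def)
      note * = response_unique[OF T(1) q(1) U(1) fq(1) iT iU _ conjunct1[OF True]]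
      show ?thesis
        using * canonical_step[OF T(1) iT q(1) conjunct1[OF True]]
          canonical_step[OF U(1) iU fq(1) conjunct1[OF True]] q fq by metis
    next
      case False
      then show ?thesis using im by (auto simp: canonical_def restrict_to_def)
    qed
    moreover have "states (canonical n T) = states (canonical n U)"
      using im by (simp add: states_canonical[OF T(1) iT] states_canonical[OF U(1) iU])
    ultimately show "canonical n T = canonical n U"
      by (intro transducer.equality) (auto intro!: ext)
  }
qed

end

theory Submission
  imports Defs
begin

text \<open>
  \<^emph>\<open>From transducers to maps.\<close> A minimal, strongly synchronizing core transducer is determined by the
  map \<open>f\<close> induced by any one of its states: reading a long word \<open>\<nu>\<close> from that state leads to the state
  inducing the local action \<open>f\<^sub>\<nu>\<close>, so the states are the local actions of \<open>f\<close> at deep words, and a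
  letter leads from \<open>f\<close> to its local action at this letter. Write \<open>core_of n f\<close> for this transducer; it
  is an element of \<open>SO\<^sub>n\<close> for every synchronizing injective continuous \<open>f\<close> with clopen image. The
  product of \<open>core_of n f\<close> and \<open>core_of n g\<close> is \<open>core_of n (g \<circ> f)\<close> (lemma \<open>core_product\<close>). So
  \<open>SO\<^sub>n\<close> is a monoid because composition is associative, and \<open>O\<^sub>n\<^sub>,\<^sub>1\<close> consists of the cores of
  homeomorphisms that are synchronizing in both directions (lemma \<open>O1_carrier\<close>).

  \<^emph>\<open>Elements of \<open>O\<^sub>n\<^sup>x\<close>.\<close> Let \<open>f\<close> be the state reached by reading \<open>x\<close>. The defining conditions say
  that \<open>f (w x y) = w' x f y\<close> with \<open>w'\<close> free of \<open>x\<close> whenever \<open>w\<close> is, and that \<open>f\<close> creates no \<open>x\<close> in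
  sequences without \<open>x\<close>: it rewrites the blocks between consecutive markers \<open>x\<close> independently of each
  other. Conversely such a \<open>marker_map\<close> with a synchronizing inverse has its core in \<open>O\<^sub>n\<^sup>x\<close>, and it is
  determined by its core (lemmas \<open>Ox_carrier\<close>, \<open>marker_homeo_core_unique\<close>). Invertibility in
  \<open>O\<^sub>n\<close> gives that the image of \<open>f\<close> contains a cone; beyond a marker inside that cone one sees the
  image of \<open>f\<close> again, so \<open>f\<close> is surjective.

  \<^emph>\<open>The embedding.\<close> Choose \<open>n\<close> words \<open>c\<^sub>0, \<dots>, c\<^sub>n\<^sub>-\<^sub>1\<close> over \<open>X\<^sub>m\<close> of equal length such that two
  occurrences of such words in a sequence never overlap. A sequence over \<open>X\<^sub>m\<close> then falls, in a unique
  way, into letters outside all codewords and maximal runs of adjacent codewords. The homeomorphism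
  \<open>recode x f\<close> of \<open>X\<^sub>m\<^sup>\<omega>\<close> fixes the letters outside the runs and the first codeword of every run, and
  applies \<open>f\<close> to the rest of the run. The letter that breaks a run thereby acts as a further
  marker, which is why no relation between \<open>m\<close> and \<open>n\<close> is needed. The first codeword of a run has to
  act as a marker, too. If \<open>f\<close> were applied to entire runs, it would also have to be
  applied to the empty run between any two adjacent letters outside the codewords. If it were applied
  only after occurrences of \<open>c\<^sub>x\<close>, then a long run without \<open>c\<^sub>x\<close> would be treated differently according
  to what precedes it, and the map would not be synchronizing.

  Rewriting runs is compatible with composition (lemma \<open>recode_comp\<close>). The map \<open>recode x f\<close> is induced
  by a transducer that holds back less than one codeword; since codewords do not overlap, this
  transducer recovers the division into runs from a bounded number of letters, and it is strongly
  synchronizing because the core of \<open>f\<close> is (lemma \<open>strongly_synchronizing_lift\<close>). The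
  local action of \<open>recode x f\<close> after a long power of \<open>c\<^sub>x\<close> applies \<open>f\<close> to the run that follows, so
  \<open>f\<close> is recovered from the core of \<open>recode x f\<close> (lemma \<open>recode_core_inj\<close>).
\<close>

(* Concatenations are kept in the form "word, then sequence", and membership in "words n" is not
   unfolded to a statement about letters. *)
declare build_cons [simp del] build_append [simp del] in_listsD [rule del] in_listsI [rule del]

section \<open>Sequences and longest common prefixes\<close>

lemma conc_in_seqs_iff: "w \<frown> y \<in> seqs n \<longleftrightarrow> w \<in> words n \<and> y \<in> seqs n"
proof
  assume *: "w \<frown> y \<in> seqs n"
  have "w ! i < n" if "i < length w" for i
    using * that unfolding seqs_def by (metis conc_fst mem_Collect_eq)
  moreover have "y i < n" for i
    using * unfolding seqs_def by (metis add_diff_cancel_left' conc_snd mem_Collect_eq not_add_less1)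
  ultimately show "w \<in> words n \<and> y \<in> seqs n"
    by (auto simp: seqs_def in_lists_conv_set in_set_conv_nth)
qed (simp add: conc_seqs)

lemma suffix_seqs: "y \<in> seqs n \<Longrightarrow> suffix k y \<in> seqs n"
  by (simp add: seqs_def)

lemma const_seqs: "a < n \<Longrightarrow> (\<lambda>_. a) \<in> seqs n"
  by (simp add: seqs_def)

lemma cyl_image: "cyl n \<nu> = (\<lambda>y. \<nu> \<frown> y) ` seqs n"
  by (auto simp: cyl_def)

lemma cyl_Nil: "cyl n [] = seqs n"
  by (auto simp: cyl_def)

lemma cyl_append: "cyl n (\<nu> @ \<mu>) = (\<lambda>y. \<nu> \<frown> y) ` cyl n \<mu>"
  by (auto simp: cyl_image image_image)

lemma cyl_subset: "\<nu> \<in> words n \<Longrightarrow> cyl n \<nu> \<subseteq> seqs n"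
  unfolding cyl_def using conc_seqs by blast

lemma prefix_conc_eq: "prefix k s = prefix k t \<Longrightarrow> prefix k (w \<frown> s) = prefix k (w \<frown> t)"
  by (auto simp: list_eq_iff_nth_eq conc_def)

lemma prefix_mono_eq:
  assumes "prefix k s = prefix k t" "j \<le> k"
  shows "prefix j s = prefix j t"
  using arg_cong[OF assms(1), where f = "take j"] assms(2) by (simp add: min_def)

lemma seq_eqI: "(\<And>N. prefix N s = prefix N t) \<Longrightarrow> s = t"
  by (rule ext) (metis lessI subsequence_nth add_0 diff_zero)

lemma common_prefix_alt: "common_prefix w A \<longleftrightarrow> (\<forall>s\<in>A. prefix (length w) s = w)"
  unfolding common_prefix_def by (metis prefix_conc_length prefix_suffix)

text \<open>
  These are the sets whose common prefixes have bounded length, so that \<open>lcp\<close> is the longest of them.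
\<close>
definition nontrivial :: "'a set \<Rightarrow> bool"
  where "nontrivial A \<longleftrightarrow> (\<exists>s\<in>A. \<exists>t\<in>A. s \<noteq> t)"

lemma nontrivial_common_prefix_bounded:
  assumes "nontrivial A"
  shows "\<exists>b. \<forall>w. common_prefix w A \<longrightarrow> length w < b"
proof -
  obtain s t i where st: "s \<in> A" "t \<in> A" "s i \<noteq> t i"
    using assms unfolding nontrivial_def by fastforce
  have "length w < Suc i" if "common_prefix w A" for w
  proof (rule ccontr)
    assume "\<not> length w < Suc i"
    then have "i < length w" by simp
    then show False
      using that st unfolding common_prefix_def by (metis conc_fst)
  qed
  then show ?thesis by blast
qed

lemma lcp_greatest:
  assumes "nontrivial A"
  shows "common_prefix (lcp A) A" and "common_prefix w A \<Longrightarrow> length w \<le> length (lcp A)"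
proof -
  have "common_prefix [] A" by (simp add: common_prefix_def)
  then show "common_prefix (lcp A) A" "common_prefix w A \<Longrightarrow> length w \<le> length (lcp A)"
    using arg_max_nat_lemma[of "\<lambda>w. common_prefix w A" "[]" length]
      nontrivial_common_prefix_bounded[OF assms] unfolding lcp_def by blast+
qed

lemma common_prefix_take:
  assumes "A \<noteq> {}" "common_prefix u A" "common_prefix w A" "length w \<le> length u"
  shows "w = take (length w) u"
proof -
  obtain s where "s \<in> A" using assms(1) by blast
  then show ?thesis
    using assms(2-4) unfolding common_prefix_alt by (metis min.absorb1 min.commute subsequence_take add_0)
qed

lemma nontrivial_nonempty: "nontrivial A \<Longrightarrow> A \<noteq> {}"
  by (auto simp: nontrivial_def)

lemma lcp_eqI:
  assumes "nontrivial A" "common_prefix u A" "\<And>w. common_prefix w A \<Longrightarrow> length w \<le> length u"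
  shows "lcp A = u"
proof -
  have "length (lcp A) = length u"
    using lcp_greatest[OF assms(1)] assms(2,3) by (simp add: eq_iff)
  then show ?thesis
    using common_prefix_take[OF nontrivial_nonempty[OF assms(1)] assms(2) lcp_greatest(1)[OF assms(1)]]
    by simp
qed

lemma nontrivial_inj_image:
  assumes "nontrivial A" "inj_on h A"
  shows "nontrivial (h ` A)"
  using assms unfolding nontrivial_def inj_on_def by blast

lemma lcp_conc:
  assumes "nontrivial A"
  shows "lcp ((\<lambda>s. w \<frown> s) ` A) = w @ lcp A"
proof (rule lcp_eqI)
  show nt: "nontrivial ((\<lambda>s. w \<frown> s) ` A)"
    using assms by (intro nontrivial_inj_image) (auto simp: inj_on_def)
  show "common_prefix (w @ lcp A) ((\<lambda>s. w \<frown> s) ` A)"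
    using lcp_greatest(1)[OF assms] unfolding common_prefix_def by (metis conc_conc imageE)
next
  fix u assume u: "common_prefix u ((\<lambda>s. w \<frown> s) ` A)"
  have "common_prefix (drop (length w) u) A" if "length w \<le> length u"
    unfolding common_prefix_def
  proof
    fix s assume "s \<in> A"
    then obtain t where "w \<frown> s = u \<frown> t" using u unfolding common_prefix_def by blast
    then show "\<exists>t. s = drop (length w) u \<frown> t" using conc_cancel_length that by blast
  qed
  then show "length u \<le> length (w @ lcp A)"
    using lcp_greatest(2)[OF assms, of "drop (length w) u"] by fastforce
qed

lemma nontrivial_cyl:
  assumes "n \<ge> 2" shows "nontrivial (cyl n \<nu>)"
  unfolding nontrivial_def
proof (intro bexI)
  have "(\<lambda>_::nat. 0::nat) \<noteq> (\<lambda>_. 1)" by (simp add: fun_eq_iff)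
  then show "\<nu> \<frown> (\<lambda>_. 0) \<noteq> \<nu> \<frown> (\<lambda>_. 1)" by simp
  show "\<nu> \<frown> (\<lambda>_. 0) \<in> cyl n \<nu>" "\<nu> \<frown> (\<lambda>_. 1) \<in> cyl n \<nu>"
    using assms by (auto simp: cyl_def intro!: exI[of _ "\<lambda>_. 0"] exI[of _ "\<lambda>_. 1"] const_seqs)
qed

lemma nontrivial_seqs: "n \<ge> 2 \<Longrightarrow> nontrivial (seqs n)"
  using nontrivial_cyl[of n "[]"] by (simp add: cyl_Nil)

lemma nontrivial_image_cyl:
  assumes "n \<ge> 2" "inj_on h (seqs n)" "\<nu> \<in> words n"
  shows "nontrivial (h ` cyl n \<nu>)"
  by (rule nontrivial_inj_image[OF nontrivial_cyl[OF assms(1)] inj_on_subset[OF assms(2) cyl_subset[OF assms(3)]]])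

section \<open>Local actions\<close>

lemma local_action_conc:
  assumes "n \<ge> 2" "inj_on h (seqs n)" "\<nu> \<in> words n" "y \<in> seqs n"
  shows "h (\<nu> \<frown> y) = lcp (h ` cyl n \<nu>) \<frown> local_action n h \<nu> y"
proof -
  have "h (\<nu> \<frown> y) \<in> h ` cyl n \<nu>" using assms(4) by (auto simp: cyl_def)
  then obtain t where "h (\<nu> \<frown> y) = lcp (h ` cyl n \<nu>) \<frown> t"
    using lcp_greatest(1)[OF nontrivial_image_cyl[OF assms(1-3)]] unfolding common_prefix_def by blast
  then show ?thesis using assms(4) by (simp add: local_action_def)
qed

lemma local_action_ext: "y \<notin> seqs n \<Longrightarrow> local_action n h \<nu> y = undefined"
  by (simp add: local_action_def)

lemma inj_on_cone:
  assumes "inj_on h (seqs n)" "\<nu> \<in> words n" "\<And>y. y \<in> seqs n \<Longrightarrow> h (\<nu> \<frown> y) = w \<frown> \<theta> y"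
  shows "inj_on \<theta> (seqs n)"
proof (rule inj_onI)
  fix y z assume yz: "y \<in> seqs n" "z \<in> seqs n" "\<theta> y = \<theta> z"
  then have "h (\<nu> \<frown> y) = h (\<nu> \<frown> z)" using assms(3) by simp
  then have "\<nu> \<frown> y = \<nu> \<frown> z"
    using inj_onD[OF assms(1)] conc_seqs[OF yz(1) assms(2)] conc_seqs[OF yz(2) assms(2)] by blast
  then show "y = z" by simp
qed

lemma local_action_inj:
  assumes "n \<ge> 2" "inj_on h (seqs n)" "\<nu> \<in> words n"
  shows "inj_on (local_action n h \<nu>) (seqs n)"
  using inj_on_cone[OF assms(2,3) local_action_conc[OF assms]] by blast

text \<open>
  A local action forgets the output common to its cone. Hence a factorization of \<open>h\<close> on a cone through
  some map \<open>\<theta>\<close> determines all local actions below, even if \<open>w\<close> is not the longest common output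
  of the cone.
\<close>
lemma
  assumes "n \<ge> 2" "inj_on h (seqs n)" "\<nu> \<in> words n" "\<mu> \<in> words n"
    and eq: "\<And>y. y \<in> seqs n \<Longrightarrow> h (\<nu> \<frown> y) = w \<frown> \<theta> y"
  shows lcp_cone: "lcp (h ` cyl n (\<nu> @ \<mu>)) = w @ lcp (\<theta> ` cyl n \<mu>)"
    and local_action_cone: "local_action n h (\<nu> @ \<mu>) = local_action n \<theta> \<mu>"
proof -
  have inj: "inj_on \<theta> (seqs n)" by (rule inj_on_cone[OF assms(2,3) eq])
  have "h ` cyl n (\<nu> @ \<mu>) = (\<lambda>s. w \<frown> s) ` \<theta> ` cyl n \<mu>"
    using eq cyl_subset[OF assms(4)] unfolding cyl_append image_image by (intro image_cong) auto
  then show *: "lcp (h ` cyl n (\<nu> @ \<mu>)) = w @ lcp (\<theta> ` cyl n \<mu>)"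
    using lcp_conc[OF nontrivial_image_cyl[OF assms(1) inj assms(4)]] by simp
  show "local_action n h (\<nu> @ \<mu>) = local_action n \<theta> \<mu>"
  proof
    fix y
    show "local_action n h (\<nu> @ \<mu>) y = local_action n \<theta> \<mu> y"
    proof (cases "y \<in> seqs n")
      case True
      have "h (\<nu> \<frown> (\<mu> \<frown> y)) = w \<frown> \<theta> (\<mu> \<frown> y)"
        by (rule eq) (simp add: True assms(4) conc_seqs)
      then show ?thesis using True by (simp add: local_action_def *)
    qed (simp add: local_action_ext)
  qed
qed

lemma
  assumes "n \<ge> 2" "inj_on h (seqs n)" "\<nu> \<in> words n" "\<mu> \<in> words n"
  shows local_action_append: "local_action n h (\<nu> @ \<mu>) = local_action n (local_action n h \<nu>) \<mu>"
    and lcp_append: "lcp (h ` cyl n (\<nu> @ \<mu>)) = lcp (h ` cyl n \<nu>) @ lcp (local_action n h \<nu> ` cyl n \<mu>)"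
  using local_action_cone[OF assms local_action_conc[OF assms(1-3)]]
    lcp_cone[OF assms local_action_conc[OF assms(1-3)]] by auto

lemma lcp_local_action:
  assumes "n \<ge> 2" "inj_on h (seqs n)" "\<nu> \<in> words n"
  shows "lcp (local_action n h \<nu> ` seqs n) = []"
  using lcp_append[OF assms, of "[]"] by (simp add: cyl_Nil)

lemma local_action_complete:
  assumes "lcp (h ` seqs n) = []"
  shows "local_action n h [] = restrict h (seqs n)"
  using assms by (auto simp: local_action_def cyl_Nil fun_eq_iff restrict_def)

lemma local_action_cong:
  assumes "\<And>y. y \<in> seqs n \<Longrightarrow> h y = g y" "\<nu> \<in> words n"
  shows "local_action n h \<nu> = local_action n g \<nu>" "lcp (h ` cyl n \<nu>) = lcp (g ` cyl n \<nu>)"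
proof -
  have *: "h ` cyl n \<nu> = g ` cyl n \<nu>"
    using assms cyl_subset[OF assms(2)] by (intro image_cong) auto
  then show "lcp (h ` cyl n \<nu>) = lcp (g ` cyl n \<nu>)" by simp
  show "local_action n h \<nu> = local_action n g \<nu>"
    unfolding local_action_def *
    by (rule restrict_ext) (simp add: assms(1)[OF conc_seqs[OF _ assms(2)]])
qed

lemma lcp_words:
  assumes "n \<ge> 2" "inj_on h (seqs n)" "h ` seqs n \<subseteq> seqs n" "\<nu> \<in> words n"
  shows "lcp (h ` cyl n \<nu>) \<in> words n"
proof -
  have y: "(\<lambda>_. 0) \<in> seqs n" using assms(1) by (simp add: const_seqs)
  have "h (\<nu> \<frown> (\<lambda>_. 0)) \<in> seqs n" using assms(3,4) y conc_seqs by blast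
  then show ?thesis
    using local_action_conc[OF assms(1,2,4) y] by (simp add: conc_in_seqs_iff)
qed

section \<open>The topology of the Cantor space\<close>

text \<open>
  From here on, open sets and continuity are used through finite prefixes only.
\<close>
lemma openin_cantor_iff:
  "openin (cantor n) U \<longleftrightarrow>
    U \<subseteq> seqs n \<and> (\<forall>s\<in>U. \<exists>K. \<forall>t\<in>seqs n. prefix K t = prefix K s \<longrightarrow> t \<in> U)"
proof
  assume U: "openin (cantor n) U"
  show "U \<subseteq> seqs n \<and> (\<forall>s\<in>U. \<exists>K. \<forall>t\<in>seqs n. prefix K t = prefix K s \<longrightarrow> t \<in> U)"
  proof (intro conjI ballI)
    show "U \<subseteq> seqs n" using openin_subset[OF U] by (simp add: topspace_cantor)
    fix s assume s: "s \<in> U"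
    obtain V where V: "finite {i. V i \<noteq> {..<n}}" "s \<in> Pi\<^sub>E UNIV V" "Pi\<^sub>E UNIV V \<subseteq> U"
      using U s unfolding cantor_def openin_product_topology_alt by auto
    obtain K where K: "\<And>i. V i \<noteq> {..<n} \<Longrightarrow> i < K"
      using V(1) unfolding finite_nat_set_iff_bounded by auto
    have "t \<in> U" if t: "t \<in> seqs n" "prefix K t = prefix K s" for t
    proof -
      have "t i \<in> V i" for i
      proof (cases "i < K")
        case True
        then have "t i = s i" using arg_cong[OF t(2), where f = "\<lambda>l. l ! i"] by simp
        then show ?thesis using V(2) by (auto simp: PiE_def)
      next
        case False
        then show ?thesis using K t(1) by (auto simp: seqs_def)
      qed
      then show ?thesis using V(3) by (auto simp: PiE_def)
    qed
    then show "\<exists>K. \<forall>t\<in>seqs n. prefix K t = prefix K s \<longrightarrow> t \<in> U" by blast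
  qed
next
  assume U: "U \<subseteq> seqs n \<and> (\<forall>s\<in>U. \<exists>K. \<forall>t\<in>seqs n. prefix K t = prefix K s \<longrightarrow> t \<in> U)"
  show "openin (cantor n) U"
    unfolding cantor_def openin_product_topology_alt
  proof (intro ballI)
    fix s assume s: "s \<in> U"
    then obtain K where K: "\<And>t. t \<in> seqs n \<Longrightarrow> prefix K t = prefix K s \<Longrightarrow> t \<in> U" using U by blast
    let ?V = "\<lambda>i. if i < K then {s i} else {..<n}"
    have sn: "s i < n" for i using s U by (auto simp: seqs_def)
    have "Pi\<^sub>E UNIV ?V \<subseteq> U"
    proof
      fix t assume t: "t \<in> Pi\<^sub>E UNIV ?V"
      have *: "t i \<in> ?V i" for i using t by (auto simp: PiE_def Pi_iff)
      have "t i = s i" if "i < K" for i using *[of i] that by simp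
      moreover have "t i < n" for i using *[of i] sn[of i] by (auto split: if_splits)
      ultimately show "t \<in> U" by (intro K) (auto simp: seqs_def list_eq_iff_nth_eq)
    qed
    moreover have "finite {i \<in> UNIV. ?V i \<noteq> topspace (discrete_topology {..<n})}"
      by (rule finite_subset[of _ "{..<K}"]) auto
    moreover have "s \<in> Pi\<^sub>E UNIV ?V" using sn by (auto simp: PiE_def)
    ultimately show "\<exists>V. finite {i \<in> UNIV. V i \<noteq> topspace (discrete_topology {..<n})} \<and>
        (\<forall>i\<in>UNIV. openin (discrete_topology {..<n}) (V i)) \<and> s \<in> Pi\<^sub>E UNIV V \<and> Pi\<^sub>E UNIV V \<subseteq> U"
      using sn by (intro exI[of _ ?V]) auto
  qed
qed

lemma continuous_cantor_iff:
  "continuous_map (cantor n) (cantor m) g \<longleftrightarrow>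
    g ` seqs n \<subseteq> seqs m \<and>
    (\<forall>s\<in>seqs n. \<forall>N. \<exists>K. \<forall>t\<in>seqs n. prefix K t = prefix K s \<longrightarrow> prefix N (g t) = prefix N (g s))"
    (is "?L \<longleftrightarrow> ?A \<and> ?B")
proof
  assume c: ?L
  then have A: ?A by (simp add: continuous_map_def topspace_cantor Pi_iff image_subset_iff)
  have ?B
  proof (intro ballI allI)
    fix s N assume s: "s \<in> seqs n"
    let ?V = "{t \<in> seqs m. prefix N t = prefix N (g s)}"
    have "openin (cantor m) ?V"
      unfolding openin_cantor_iff by (auto intro!: exI[of _ N])
    then have "openin (cantor n) {t \<in> seqs n. g t \<in> ?V}"
      using c unfolding continuous_map_def topspace_cantor by blast
    moreover have "s \<in> {t \<in> seqs n. g t \<in> ?V}" using s A by auto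
    ultimately show "\<exists>K. \<forall>t\<in>seqs n. prefix K t = prefix K s \<longrightarrow> prefix N (g t) = prefix N (g s)"
      unfolding openin_cantor_iff by blast
  qed
  with A show "?A \<and> ?B" ..
next
  assume *: "?A \<and> ?B"
  show ?L
    unfolding continuous_map_def topspace_cantor
  proof (intro conjI allI impI)
    show "g \<in> seqs n \<rightarrow> seqs m" using * by auto
    fix U assume U: "openin (cantor m) U"
    show "openin (cantor n) {x \<in> seqs n. g x \<in> U}"
      unfolding openin_cantor_iff
    proof (intro conjI ballI)
      fix s assume s: "s \<in> {x \<in> seqs n. g x \<in> U}"
      then obtain N where N: "\<forall>t\<in>seqs m. prefix N t = prefix N (g s) \<longrightarrow> t \<in> U"
        using U unfolding openin_cantor_iff by blast
      obtain K where "\<forall>t\<in>seqs n. prefix K t = prefix K s \<longrightarrow> prefix N (g t) = prefix N (g s)"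
        using * s by blast
      then show "\<exists>K. \<forall>t\<in>seqs n. prefix K t = prefix K s \<longrightarrow> t \<in> {x \<in> seqs n. g x \<in> U}"
        using N * by (intro exI[of _ K]) blast
    qed auto
  qed
qed

lemma compact_cantor: "compact_space (cantor n)"
  unfolding cantor_def
  by (intro compact_space_product_topology[THEN iffD2] disjI2) (simp add: compact_space_discrete_topology)

lemma Hausdorff_cantor: "Hausdorff_space (cantor n)"
  unfolding cantor_def
  by (intro Hausdorff_space_product_topology[THEN iffD2] disjI2) (simp add: Hausdorff_space_discrete_topology)

text \<open>
  Compactness makes the modulus of continuity uniform. This provides the depth below which all cones
  have long common outputs.
\<close>
lemma continuous_cantor_uniform:
  assumes g: "continuous_map (cantor n) (cantor m) g"
  shows "\<exists>K. \<forall>s\<in>seqs n. \<forall>t\<in>seqs n. prefix K s = prefix K t \<longrightarrow> prefix N (g s) = prefix N (g t)"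
proof -
  have "\<forall>s\<in>seqs n. \<exists>K. \<forall>t\<in>seqs n. prefix K t = prefix K s \<longrightarrow> prefix N (g t) = prefix N (g s)"
    using g unfolding continuous_cantor_iff by blast
  then obtain K where K: "\<And>s t. s \<in> seqs n \<Longrightarrow> t \<in> seqs n \<Longrightarrow> prefix (K s) t = prefix (K s) s \<Longrightarrow>
      prefix N (g t) = prefix N (g s)"
    by metis
  define V where "V s = {t \<in> seqs n. prefix (K s) t = prefix (K s) s}" for s
  have op: "openin (cantor n) U" if U: "U \<in> V ` seqs n" for U
  proof -
    obtain s where "U = V s" using U by blast
    then show ?thesis unfolding openin_cantor_iff V_def by (auto intro!: exI[of _ "K s"])
  qed
  have cov: "\<Union> (V ` seqs n) = topspace (cantor n)"
    by (auto simp: V_def topspace_cantor)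
  obtain F where F: "finite F" "F \<subseteq> V ` seqs n" "seqs n \<subseteq> \<Union>F"
    using compact_cantor[of n, unfolded compact_space_alt, rule_format, of "V ` seqs n"] op cov
    unfolding topspace_cantor by auto
  obtain S where S: "finite S" "S \<subseteq> seqs n" "F = V ` S"
    using finite_subset_image[OF F(1,2)] by blast
  have "prefix N (g s) = prefix N (g t)"
    if st: "s \<in> seqs n" "t \<in> seqs n" "prefix (Max (insert 0 (K ` S))) s = prefix (Max (insert 0 (K ` S))) t" for s t
  proof -
    obtain u where u: "u \<in> S" "s \<in> V u" using F(3) S(3) st(1) by blast
    have "K u \<le> Max (insert 0 (K ` S))" using S(1) u(1) by simp
    then have "prefix (K u) t = prefix (K u) s" using prefix_mono_eq[OF st(3)] by simp
    then show ?thesis using K[of u s] K[of u t] u S(2) st unfolding V_def by auto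
  qed
  then show ?thesis by blast
qed

text \<open>
  The maps that occur as states. Openness of the map, rather than of its image, is required because
  it passes to compositions at once; the two are equivalent by lemma \<open>clopen_embeddingI\<close>, and the
  image is closed by compactness.
\<close>
definition clopen_embedding :: "nat \<Rightarrow> (nat word \<Rightarrow> nat word) \<Rightarrow> bool"
  where "clopen_embedding n h \<longleftrightarrow> continuous_map (cantor n) (cantor n) h \<and>
    open_map (cantor n) (cantor n) h \<and> inj_on h (seqs n)"

lemma clopen_embedding_inj: "clopen_embedding n h \<Longrightarrow> inj_on h (seqs n)"
  and clopen_embedding_cont: "clopen_embedding n h \<Longrightarrow> continuous_map (cantor n) (cantor n) h"
  and clopen_embedding_open: "clopen_embedding n h \<Longrightarrow> openin (cantor n) (h ` seqs n)"
  and clopen_embedding_into: "clopen_embedding n h \<Longrightarrow> h ` seqs n \<subseteq> seqs n"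
  unfolding clopen_embedding_def open_map_def continuous_cantor_iff
  using openin_topspace[of "cantor n", unfolded topspace_cantor] by blast+

lemma clopen_embedding_closed: "clopen_embedding n h \<Longrightarrow> closedin (cantor n) (h ` seqs n)"
  using continuous_imp_closed_map[OF clopen_embedding_cont compact_cantor Hausdorff_cantor]
    closedin_topspace[of "cantor n"]
  unfolding closed_map_def topspace_cantor by blast

lemma clopen_embeddingI:
  assumes "continuous_map (cantor n) (cantor n) h" "inj_on h (seqs n)" "openin (cantor n) (h ` seqs n)"
  shows "clopen_embedding n h"
proof -
  have "embedding_map (cantor n) (cantor n) h"
    using continuous_imp_embedding_map[OF assms(1) compact_cantor Hausdorff_cantor] assms(2)
    by (simp add: topspace_cantor)
  then have "open_map (cantor n) (subtopology (cantor n) (h ` seqs n)) h"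
    unfolding embedding_map_def topspace_cantor by (rule homeomorphic_imp_open_map)
  then have "open_map (cantor n) (cantor n) h"
    using assms(3) by (meson open_map_def openin_trans_full)
  then show ?thesis using assms by (simp add: clopen_embedding_def)
qed

lemma clopen_embedding_compose:
  "clopen_embedding n h \<Longrightarrow> clopen_embedding n g \<Longrightarrow> clopen_embedding n (g \<circ> h)"
  unfolding clopen_embedding_def
  by (intro conjI continuous_map_compose open_map_compose comp_inj_on)
     (auto simp: continuous_map_def topspace_cantor intro: inj_on_subset)

lemma clopen_embedding_cong:
  assumes "clopen_embedding n h" "\<And>y. y \<in> seqs n \<Longrightarrow> h y = g y"
  shows "clopen_embedding n g"
proof (rule clopen_embeddingI)
  show "continuous_map (cantor n) (cantor n) g"
    using continuous_map_eq[OF clopen_embedding_cont[OF assms(1)]] assms(2) by (simp add: topspace_cantor)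
  show "inj_on g (seqs n)"
    using inj_on_cong[of "seqs n" h g] assms(2) clopen_embedding_inj[OF assms(1)] by blast
  show "openin (cantor n) (g ` seqs n)"
    using clopen_embedding_open[OF assms(1)] assms(2) by (simp cong: image_cong)
qed

text \<open>
  Cones over open sets are open; with \<open>U = seqs n\<close> this says that cylinders are open.
\<close>
lemma openin_conc_image:
  assumes U: "openin (cantor n) U" and \<nu>: "\<nu> \<in> words n"
  shows "openin (cantor n) ((\<lambda>y. \<nu> \<frown> y) ` U)"
  unfolding openin_cantor_iff
proof (intro conjI ballI)
  show "(\<lambda>y. \<nu> \<frown> y) ` U \<subseteq> seqs n"
    using U \<nu> unfolding openin_cantor_iff by (auto intro: conc_seqs)
  fix s assume "s \<in> (\<lambda>y. \<nu> \<frown> y) ` U"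
  then obtain y where y: "y \<in> U" "s = \<nu> \<frown> y" by blast
  then obtain K where K: "\<And>t. t \<in> seqs n \<Longrightarrow> prefix K t = prefix K y \<Longrightarrow> t \<in> U"
    using U unfolding openin_cantor_iff by blast
  have "t \<in> (\<lambda>y. \<nu> \<frown> y) ` U" if t: "t \<in> seqs n" "prefix (length \<nu> + K) t = prefix (length \<nu> + K) s" for t
  proof -
    have "prefix (length \<nu>) t = \<nu>"
      using prefix_mono_eq[OF t(2), of "length \<nu>"] y(2) by simp
    then have te: "t = \<nu> \<frown> suffix (length \<nu>) t" by (metis prefix_suffix)
    have "\<nu> @ prefix K (suffix (length \<nu>) t) = \<nu> @ prefix K y"
      using t(2) y(2) te by (metis add_diff_cancel_left' le_add1 prefix_conc_snd)
    then have "suffix (length \<nu>) t \<in> U" using K suffix_seqs[OF t(1)] by simp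
    then show ?thesis using te by blast
  qed
  then show "\<exists>K. \<forall>t\<in>seqs n. prefix K t = prefix K s \<longrightarrow> t \<in> (\<lambda>y. \<nu> \<frown> y) ` U" by blast
qed

lemma clopen_embedding_local_action:
  assumes n: "n \<ge> 2" and h: "clopen_embedding n h" and \<nu>: "\<nu> \<in> words n"
  shows "clopen_embedding n (local_action n h \<nu>)"
proof (rule clopen_embeddingI)
  let ?g = "local_action n h \<nu>" and ?w = "lcp (h ` cyl n \<nu>)"
  note inj = clopen_embedding_inj[OF h]
  note eq = local_action_conc[OF n inj \<nu>]
  have into: "?g y \<in> seqs n" if "y \<in> seqs n" for y
    using clopen_embedding_into[OF h] eq[OF that] conc_seqs[OF that \<nu>]
    by (metis conc_in_seqs_iff image_subset_iff)
  show "inj_on ?g (seqs n)" by (rule local_action_inj[OF n inj \<nu>])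
  show "continuous_map (cantor n) (cantor n) ?g"
    unfolding continuous_cantor_iff
  proof (intro conjI ballI allI)
    show "?g ` seqs n \<subseteq> seqs n" using into by blast
    fix s N assume s: "s \<in> seqs n"
    then obtain K where K: "\<And>t. t \<in> seqs n \<Longrightarrow> prefix K t = prefix K (\<nu> \<frown> s) \<Longrightarrow>
        prefix (length ?w + N) (h t) = prefix (length ?w + N) (h (\<nu> \<frown> s))"
      using clopen_embedding_cont[OF h] conc_seqs[OF s \<nu>] unfolding continuous_cantor_iff by metis
    have "prefix N (?g t) = prefix N (?g s)" if t: "t \<in> seqs n" "prefix K t = prefix K s" for t
      using K[OF conc_seqs[OF t(1) \<nu>] prefix_conc_eq[OF t(2)]] eq[OF s] eq[OF t(1)] by simp
    then show "\<exists>K. \<forall>t\<in>seqs n. prefix K t = prefix K s \<longrightarrow> prefix N (?g t) = prefix N (?g s)" by blast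
  qed
  have "openin (cantor n) (h ` (\<lambda>y. \<nu> \<frown> y) ` seqs n)"
    using h openin_conc_image[OF _ \<nu>, of "seqs n"] unfolding clopen_embedding_def open_map_def
    by (metis openin_topspace topspace_cantor)
  then have *: "openin (cantor n) ((\<lambda>s. ?w \<frown> s) ` ?g ` seqs n)"
    using eq by (simp add: image_image cong: image_cong)
  show "openin (cantor n) (?g ` seqs n)"
    unfolding openin_cantor_iff
  proof (intro conjI ballI)
    show "?g ` seqs n \<subseteq> seqs n" using into by blast
    fix s assume s: "s \<in> ?g ` seqs n"
    then have "?w \<frown> s \<in> (\<lambda>s. ?w \<frown> s) ` ?g ` seqs n" by blast
    then obtain K where K: "\<And>t. t \<in> seqs n \<Longrightarrow> prefix K t = prefix K (?w \<frown> s) \<Longrightarrow>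
        t \<in> (\<lambda>s. ?w \<frown> s) ` ?g ` seqs n"
      using * unfolding openin_cantor_iff by blast
    have "t \<in> ?g ` seqs n" if t: "t \<in> seqs n" "prefix K t = prefix K s" for t
      using K[OF conc_seqs[OF t(1) lcp_words[OF n inj clopen_embedding_into[OF h] \<nu>]] prefix_conc_eq[OF t(2)]]
      by (auto simp: image_iff)
    then show "\<exists>K. \<forall>t\<in>seqs n. prefix K t = prefix K s \<longrightarrow> t \<in> ?g ` seqs n" by blast
  qed
qed

lemma lcp_cyl_unbounded:
  assumes n: "n \<ge> 2" and h: "clopen_embedding n h"
  shows "\<exists>K. \<forall>\<nu>\<in>words n. K \<le> length \<nu> \<longrightarrow> N \<le> length (lcp (h ` cyl n \<nu>))"
proof -
  obtain K where K: "\<And>s t. s \<in> seqs n \<Longrightarrow> t \<in> seqs n \<Longrightarrow> prefix K s = prefix K t \<Longrightarrow>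
      prefix N (h s) = prefix N (h t)"
    using continuous_cantor_uniform[OF clopen_embedding_cont[OF h]] by blast
  have "N \<le> length (lcp (h ` cyl n \<nu>))" if \<nu>: "\<nu> \<in> words n" "K \<le> length \<nu>" for \<nu>
  proof -
    let ?s = "\<nu> \<frown> (\<lambda>_. 0)"
    have s: "?s \<in> seqs n" using n \<nu> by (simp add: conc_seqs const_seqs)
    have "common_prefix (prefix N (h ?s)) (h ` cyl n \<nu>)"
      unfolding common_prefix_alt cyl_def using K[OF _ s] \<nu> by (auto simp: conc_seqs)
    then show ?thesis
      using lcp_greatest(2)[OF nontrivial_image_cyl[OF n clopen_embedding_inj[OF h] \<nu>(1)]] by fastforce
  qed
  then show ?thesis by blast
qed

section \<open>Maps induced by transducers\<close>

lemma trans_word_simps [simp]: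
  "trans_word T [] q = q"
  "trans_word T (a # w) q = trans_word T w (next_state T a q)"
  "trans_word T (v @ w) q = trans_word T w (trans_word T v q)"
  by (simp_all add: trans_word_def)

lemma out_word_words:
  assumes "is_transducer n T" "q \<in> states T" "w \<in> words n"
  shows "out_word T w q \<in> words n"
  using assms(2,3)
proof (induction w arbitrary: q)
  case (Cons a w)
  then show ?case using assms(1) by (simp add: is_transducer_def)
qed simp

lemma out_word_unbounded:
  assumes "is_transducer n T" "q \<in> states T" "s \<in> seqs n"
  shows "\<exists>k. l \<le> length (out_word T (prefix k s) q)"
  using assms by (simp add: is_transducer_def)

lemma induced_conc_word:
  assumes T: "is_transducer n T" and "q \<in> states T" "w \<in> words n" and y: "y \<in> seqs n"
  shows "induced n T q (w \<frown> y) = out_word T w q \<frown> induced n T (trans_word T w q) y"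
  using assms(2,3)
proof (induction w arbitrary: q)
  case (Cons a w)
  have q': "next_state T a q \<in> states T" using T Cons.prems by (simp add: is_transducer_def)
  have "induced n T q ([a] \<frown> (w \<frown> y)) = outp T a q \<frown> induced n T (next_state T a q) (w \<frown> y)"
    by (rule induced_conc[OF T]) (use Cons.prems conc_seqs[OF y] in auto)
  then show ?case using Cons.IH[OF q'] Cons.prems by simp
qed simp

lemma induced_seqs:
  assumes T: "is_transducer n T" "q \<in> states T" and s: "s \<in> seqs n"
  shows "induced n T q s \<in> seqs n"
  unfolding seqs_def
proof (intro CollectI allI)
  fix i
  obtain k where k: "Suc i \<le> length (out_word T (prefix k s) q)"
    using out_word_unbounded[OF assms] by blast
  obtain t where "induced n T q s = out_word T (prefix k s) q \<frown> t"
    using induced_prefix[OF assms] by blast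
  then have "induced n T q s i \<in> set (out_word T (prefix k s) q)" using k by simp
  then show "induced n T q s i < n"
    using out_word_words[OF T prefix_words[OF s], of k] by (auto simp: in_lists_conv_set)
qed

lemma continuous_induced:
  assumes T: "is_transducer n T" "q \<in> states T"
  shows "continuous_map (cantor n) (cantor n) (induced n T q)"
  unfolding continuous_cantor_iff
proof (intro conjI ballI allI)
  show "induced n T q ` seqs n \<subseteq> seqs n" using induced_seqs[OF T] by blast
  fix s N assume s: "s \<in> seqs n"
  obtain k where k: "N \<le> length (out_word T (prefix k s) q)"
    using out_word_unbounded[OF T s] by blast
  have "prefix N (induced n T q t) = take N (out_word T (prefix k s) q)"
    if t: "t \<in> seqs n" "prefix k t = prefix k s" for t
    using induced_prefix[OF T t(1), of k] k t(2) by (auto simp: prefix_conc_fst)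
  then show "\<exists>K. \<forall>t\<in>seqs n. prefix K t = prefix K s \<longrightarrow>
      prefix N (induced n T q t) = prefix N (induced n T q s)"
    using s by metis
qed

lemma subtransducer:
  assumes T: "is_transducer n T" and sub: "states U \<subseteq> states T" "states U \<noteq> {}"
    and eqs: "\<forall>a<n. \<forall>q\<in>states U. next_state U a q = next_state T a q \<and>
      outp U a q = outp T a q \<and> next_state T a q \<in> states U"
  shows "is_transducer n U"
    and "q \<in> states U \<Longrightarrow> w \<in> words n \<Longrightarrow> trans_word U w q = trans_word T w q"
    and "q \<in> states U \<Longrightarrow> w \<in> words n \<Longrightarrow> out_word U w q = out_word T w q"
    and "q \<in> states U \<Longrightarrow> induced n U q = induced n T q"
proof -
  have eq: "next_state U a q = next_state T a q" "outp U a q = outp T a q" "next_state T a q \<in> states U"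
    if "a < n" "q \<in> states U" for a q
    using eqs that by auto
  have tr: "trans_word U w q = trans_word T w q \<and> out_word U w q = out_word T w q"
    if "q \<in> states U" "w \<in> words n" for q w
    using that by (induction w arbitrary: q) (auto simp: eq)
  show U: "is_transducer n U"
    unfolding is_transducer_def
  proof (intro conjI allI impI ballI)
    show "countable (states U)" using T sub(1) countable_subset by (auto simp: is_transducer_def)
    fix q s l assume "q \<in> states U" "s \<in> seqs n"
    then show "\<exists>k. l \<le> length (out_word U (prefix k s) q)"
      using out_word_unbounded[OF T, of q s l] sub(1) tr prefix_words by auto
  qed (use T sub eq in \<open>auto simp: is_transducer_def\<close>)
  show "q \<in> states U \<Longrightarrow> w \<in> words n \<Longrightarrow> trans_word U w q = trans_word T w q"
    "q \<in> states U \<Longrightarrow> w \<in> words n \<Longrightarrow> out_word U w q = out_word T w q"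
    using tr by auto
  assume q: "q \<in> states U"
  show "induced n U q = induced n T q"
  proof
    fix s show "induced n U q s = induced n T q s"
    proof (cases "s \<in> seqs n")
      case True
      show ?thesis
        by (rule induced_eqI[OF U q True])
          (use q sub(1) induced_prefix[OF T _ True, of q] tr prefix_words[OF True] in auto)
    qed (simp add: induced_ext)
  qed
qed

text \<open>
  Passing to the canonical representative forgets transitions and outputs off the domain. This is needed
  for \<open>map_core\<close>, whose transitions and outputs are not set to \<open>undefined\<close> there.
\<close>
lemma canonical_agree:
  assumes T: "is_transducer n T" and st: "states U = states T"
    and eq: "\<And>a q. a < n \<Longrightarrow> q \<in> states T \<Longrightarrow> next_state U a q = next_state T a q"
      "\<And>a q. a < n \<Longrightarrow> q \<in> states T \<Longrightarrow> outp U a q = outp T a q"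
  shows "canonical n U = canonical n T"
proof -
  have ne: "states T \<noteq> {}" and cl: "\<And>a q. a < n \<Longrightarrow> q \<in> states T \<Longrightarrow> next_state T a q \<in> states T"
    using T by (auto simp: is_transducer_def)
  have ind: "induced n U q = induced n T q" if "q \<in> states T" for q
    using subtransducer(4)[OF T, of U q] st ne cl eq that by simp
  have im: "induced n U ` states T = induced n T ` states T" using ind by (intro image_cong) auto
  have inv: "inv_into (states T) (induced n U) f = inv_into (states T) (induced n T) f" for f
    unfolding inv_into_def using ind by metis
  have "inv_into (states T) (induced n T) f \<in> states T" if "f \<in> induced n T ` states T" for f
    using that by (rule inv_into_into)
  then show ?thesis
    unfolding canonical_def st restrict_to_def im inv using eq ind cl by (auto intro!: ext)
qed

section \<open>Transducers whose states are maps\<close>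

text \<open>
  The only possible transducer without incomplete response in which every state is the map that it
  induces, see lemmas \<open>canonical_eq_map_transducer\<close> and \<open>induced_map_transducer\<close>.
\<close>
definition map_transducer :: "nat \<Rightarrow> (nat word \<Rightarrow> nat word) set \<Rightarrow> ctransducer"
  where "map_transducer n S = restrict_to n S
    \<lparr>states = S, next_state = (\<lambda>a f. local_action n f [a]), outp = (\<lambda>a f. lcp (f ` cyl n [a]))\<rparr>"

lemma map_transducer_step:
  assumes "f \<in> S" "a < n"
  shows "next_state (map_transducer n S) a f = local_action n f [a]"
    "outp (map_transducer n S) a f = lcp (f ` cyl n [a])"
  using assms by (simp_all add: map_transducer_def restrict_to_def)

lemma states_map_transducer [simp]: "states (map_transducer n S) = S"
  by (simp add: map_transducer_def restrict_to_def)

text \<open>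
  The clopen embeddings that are their own local action at the empty word.
\<close>
definition complete_map :: "nat \<Rightarrow> (nat word \<Rightarrow> nat word) \<Rightarrow> bool"
  where "complete_map n f \<longleftrightarrow> clopen_embedding n f \<and> f \<in> extensional (seqs n) \<and> lcp (f ` seqs n) = []"

definition complete_family :: "nat \<Rightarrow> (nat word \<Rightarrow> nat word) set \<Rightarrow> bool"
  where "complete_family n S \<longleftrightarrow> S \<noteq> {} \<and> countable S \<and>
    (\<forall>f\<in>S. complete_map n f \<and> (\<forall>a<n. local_action n f [a] \<in> S))"

lemma complete_map_Nil: "complete_map n f \<Longrightarrow> local_action n f [] = f"
  by (simp add: complete_map_def local_action_complete extensional_restrict)

lemma local_action_extensional: "local_action n h \<nu> \<in> extensional (seqs n)"
  by (simp add: extensional_def local_action_ext)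

context
  fixes n :: nat assumes n: "n \<ge> 2"
begin

lemma complete_map_local_action:
  assumes "clopen_embedding n h" "\<nu> \<in> words n"
  shows "complete_map n (local_action n h \<nu>)"
  unfolding complete_map_def
  using clopen_embedding_local_action[OF n assms] local_action_extensional
    lcp_local_action[OF n clopen_embedding_inj[OF assms(1)] assms(2)] by blast

lemma incomplete_response_iff:
  assumes T: "is_transducer n T" "q \<in> states T" and inj: "inj_on (induced n T q) (seqs n)"
  shows "incomplete_response n T q \<longleftrightarrow> lcp (image_state n T q) \<noteq> []"
proof -
  have nt: "nontrivial (image_state n T q)"
    unfolding image_state_def by (rule nontrivial_inj_image[OF nontrivial_seqs[OF n] inj])
  show ?thesis
    using lcp_greatest[OF nt] unfolding incomplete_response_def by (metis le_zero_eq length_0_conv)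
qed

lemma
  assumes T: "is_transducer n T" "q \<in> states T" and inj: "inj_on (induced n T q) (seqs n)"
    and w: "w \<in> words n"
  shows lcp_induced: "lcp (induced n T q ` cyl n w) = out_word T w q @ lcp (image_state n T (trans_word T w q))"
    and local_action_induced: "local_action n (induced n T q) w = local_action n (induced n T (trans_word T w q)) []"
  using lcp_cone[OF n inj w, of "[]", OF _ induced_conc_word[OF T w]]
    local_action_cone[OF n inj w, of "[]", OF _ induced_conc_word[OF T w]]
  by (simp_all add: cyl_Nil image_state_def)

lemma
  assumes T: "is_transducer n T" "q \<in> states T" and inj: "inj_on (induced n T q) (seqs n)"
    and w: "w \<in> words n" and inc: "\<not> incomplete_response n T (trans_word T w q)"
  shows lcp_induced_complete: "lcp (induced n T q ` cyl n w) = out_word T w q"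
    and local_action_induced_complete: "local_action n (induced n T q) w = induced n T (trans_word T w q)"
proof -
  have q': "trans_word T w q \<in> states T" by (rule trans_word_states[OF T w])
  have inj': "inj_on (induced n T (trans_word T w q)) (seqs n)"
    by (rule inj_on_cone[OF inj w induced_conc_word[OF T w]])
  have *: "lcp (image_state n T (trans_word T w q)) = []"
    using incomplete_response_iff[OF T(1) q' inj'] inc by blast
  then show "lcp (induced n T q ` cyl n w) = out_word T w q"
    using lcp_induced[OF T inj w] by simp
  have "local_action n (induced n T (trans_word T w q)) [] = induced n T (trans_word T w q)"
    using * by (simp add: local_action_complete image_state_def induced_def)
  then show "local_action n (induced n T q) w = induced n T (trans_word T w q)"
    using local_action_induced[OF T inj w] by simp
qed

text \<open>
  Without incomplete response, the output at a letter is the longest common prefix of the image of its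
  cylinder, and the successor induces the local action, so both can be read off from the induced map.
\<close>
lemma canonical_eq_map_transducer:
  assumes T: "is_transducer n T" and inc: "\<forall>q\<in>states T. \<not> incomplete_response n T q"
    and inj: "\<And>q. q \<in> states T \<Longrightarrow> inj_on (induced n T q) (seqs n)"
  shows "canonical n T = map_transducer n (induced n T ` states T)"
proof -
  let ?S = "induced n T ` states T"
  have step: "next_state (canonical n T) a f = local_action n f [a] \<and> outp (canonical n T) a f = lcp (f ` cyl n [a])"
    if f: "f \<in> ?S" and a: "a < n" for a f
  proof -
    obtain q where q: "q \<in> states T" "f = induced n T q" using f by blast
    have q': "next_state T a q \<in> states T" using T q a by (simp add: is_transducer_def)
    show ?thesis
      using canonical_step[OF T inc q(1) a] lcp_induced_complete[OF T q(1) inj[OF q(1)], of "[a]"]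
        local_action_induced_complete[OF T q(1) inj[OF q(1)], of "[a]"] q(2) a q' inc by simp
  qed
  have undef: "next_state (canonical n T) a f = undefined \<and> outp (canonical n T) a f = undefined"
    if "\<not> (a < n \<and> f \<in> ?S)" for a f
    using that unfolding canonical_def restrict_to_def by (simp only: transducer.simps if_False)
  have "next_state (canonical n T) a f = next_state (map_transducer n ?S) a f \<and>
      outp (canonical n T) a f = outp (map_transducer n ?S) a f" for a f
  proof (cases "a < n \<and> f \<in> ?S")
    case True
    then show ?thesis using step[of f a] by (simp add: map_transducer_def restrict_to_def)
  next
    case False
    then show ?thesis using undef[OF False]
      unfolding map_transducer_def restrict_to_def by (simp only: transducer.simps if_False)
  qed
  then have "next_state (canonical n T) = next_state (map_transducer n ?S)"
    "outp (canonical n T) = outp (map_transducer n ?S)"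
    by (auto simp: fun_eq_iff)
  moreover have "states (canonical n T) = states (map_transducer n ?S)"
    by (simp add: canonical_def map_transducer_def restrict_to_def)
  ultimately show ?thesis by (intro transducer.equality) simp_all
qed

context
  fixes S :: "(nat word \<Rightarrow> nat word) set"
  assumes fam: "complete_family n S"
begin

lemma family: "\<And>f. f \<in> S \<Longrightarrow> complete_map n f" "S \<noteq> {}" "countable S"
  and family_step: "\<And>f a. f \<in> S \<Longrightarrow> a < n \<Longrightarrow> local_action n f [a] \<in> S"
  using fam by (auto simp: complete_family_def)

lemma
  assumes "f \<in> S" "w \<in> words n"
  shows map_transducer_trans: "trans_word (map_transducer n S) w f = local_action n f w"
    and map_transducer_out: "out_word (map_transducer n S) w f = lcp (f ` cyl n w)"
  using assms
proof (induction w arbitrary: f)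
  case Nil
  {
    case 1 then show ?case using complete_map_Nil family by simp
  next
    case 2 then show ?case using family by (simp add: complete_map_def cyl_Nil)
  }
next
  case (Cons a w)
  have f: "f \<in> S \<Longrightarrow> inj_on f (seqs n)" for f
    using family(1) clopen_embedding_inj by (auto simp: complete_map_def)
  {
    case 1
    then show ?case
      using Cons.IH(1)[OF family_step[of f a]] local_action_append[OF n f, of f "[a]" w]
      by (simp add: map_transducer_step)
  next
    case 2
    then show ?case
      using Cons.IH(2)[OF family_step[of f a]] lcp_append[OF n f, of f "[a]" w]
      by (simp add: map_transducer_step)
  }
qed

lemma is_transducer_map_transducer: "is_transducer n (map_transducer n S)"
  unfolding is_transducer_def states_map_transducer
proof (intro conjI allI impI ballI)
  fix a f assume af: "a < n" "f \<in> S"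
  have e: "clopen_embedding n f" using family(1)[OF af(2)] by (simp add: complete_map_def)
  show "next_state (map_transducer n S) a f \<in> S" using af family_step by (simp add: map_transducer_step)
  show "outp (map_transducer n S) a f \<in> words n"
    using af lcp_words[OF n clopen_embedding_inj[OF e] clopen_embedding_into[OF e], of "[a]"]
    by (simp add: map_transducer_step)
next
  fix f s l assume f: "f \<in> S" and s: "s \<in> seqs n"
  have e: "clopen_embedding n f" using family(1)[OF f] by (simp add: complete_map_def)
  obtain K where "\<forall>\<nu>\<in>words n. K \<le> length \<nu> \<longrightarrow> l \<le> length (lcp (f ` cyl n \<nu>))"
    using lcp_cyl_unbounded[OF n e] by blast
  then show "\<exists>k. l \<le> length (out_word (map_transducer n S) (prefix k s) f)"
    using prefix_words[OF s] by (auto simp: map_transducer_out[OF f prefix_words[OF s]] intro!: exI[of _ K])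
qed (use family in auto)

lemma induced_map_transducer:
  assumes f: "f \<in> S" shows "induced n (map_transducer n S) f = f"
proof
  have e: "clopen_embedding n f" using family(1)[OF f] by (simp add: complete_map_def)
  fix s show "induced n (map_transducer n S) f s = f s"
  proof (cases "s \<in> seqs n")
    case True
    show ?thesis
    proof (rule induced_eqI[OF is_transducer_map_transducer _ True])
      fix k
      have "f (prefix k s \<frown> suffix k s) = lcp (f ` cyl n (prefix k s)) \<frown> local_action n f (prefix k s) (suffix k s)"
        by (rule local_action_conc[OF n clopen_embedding_inj[OF e] prefix_words[OF True] suffix_seqs[OF True]])
      then show "\<exists>t. f s = out_word (map_transducer n S) (prefix k s) f \<frown> t"
        using map_transducer_out[OF f prefix_words[OF True]] by auto
    qed (use f in simp)
  next
    case False
    then show ?thesis using family(1)[OF f] by (simp add: induced_ext complete_map_def extensional_def)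
  qed
qed

lemma map_transducer_complete:
  assumes "f \<in> S" shows "\<not> incomplete_response n (map_transducer n S) f"
proof -
  have f: "complete_map n f" by (rule family(1)[OF assms])
  then have "inj_on f (seqs n)" by (simp add: complete_map_def clopen_embedding_inj)
  then show ?thesis
    using incomplete_response_iff[OF is_transducer_map_transducer, of f] f assms
    by (simp add: image_state_def induced_map_transducer complete_map_def)
qed

lemma canonical_map_transducer: "canonical n (map_transducer n S) = map_transducer n S"
proof -
  have "inj_on f (seqs n)" if "f \<in> S" for f
    using family(1)[OF that] by (simp add: complete_map_def clopen_embedding_inj)
  then have "canonical n (map_transducer n S) = map_transducer n (induced n (map_transducer n S) ` S)"
    using canonical_eq_map_transducer[OF is_transducer_map_transducer] map_transducer_complete
    by (simp add: induced_map_transducer)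
  then show ?thesis by (simp add: induced_map_transducer)
qed

end

end

section \<open>Synchronizing maps and their cores\<close>

definition sync_map :: "nat \<Rightarrow> (nat word \<Rightarrow> nat word) \<Rightarrow> bool"
  where "sync_map n h \<longleftrightarrow> clopen_embedding n h \<and> (\<exists>k. map_synchronizing_at n h k)"

text \<open>
  The local actions that occur at arbitrary depth. No synchronizing level enters this definition; for a
  synchronizing map these are all local actions below any such level (lemma \<open>core_maps_at\<close>).
\<close>
definition core_maps :: "nat \<Rightarrow> (nat word \<Rightarrow> nat word) \<Rightarrow> (nat word \<Rightarrow> nat word) set"
  where "core_maps n h = {g. \<forall>k. \<exists>\<nu>\<in>words n. k \<le> length \<nu> \<and> g = local_action n h \<nu>}"

context
  fixes n :: nat assumes n: "n \<ge> 2"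
begin

lemma map_synchronizing_local_action:
  assumes "map_synchronizing_at n h k" "u \<in> words n" "\<nu> \<in> words n" "k \<le> length \<nu>"
  shows "local_action n h (u @ \<nu>) = local_action n h \<nu>"
proof -
  have "take (length \<nu> - k) \<nu> \<in> words n" "drop (length \<nu> - k) \<nu> \<in> words n"
    using assms(3) by (metis append_in_lists_conv append_take_drop_id)+
  moreover have "length (drop (length \<nu> - k) \<nu>) = k" using assms(4) by simp
  ultimately have "local_action n h ((u @ take (length \<nu> - k) \<nu>) @ drop (length \<nu> - k) \<nu>) =
      local_action n h (take (length \<nu> - k) \<nu> @ drop (length \<nu> - k) \<nu>)"
    using assms(1,2) unfolding map_synchronizing_at_def by (metis append_in_lists_conv)
  then show ?thesis by simp
qed

lemma core_maps_at:
  assumes "map_synchronizing_at n h k"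
  shows "core_maps n h = {local_action n h \<nu> | \<nu>. \<nu> \<in> words n \<and> k \<le> length \<nu>}"
proof (intro equalityI subsetI)
  fix g assume "g \<in> {local_action n h \<nu> | \<nu>. \<nu> \<in> words n \<and> k \<le> length \<nu>}"
  then obtain \<nu> where \<nu>: "g = local_action n h \<nu>" "\<nu> \<in> words n" "k \<le> length \<nu>" by blast
  show "g \<in> core_maps n h"
    unfolding core_maps_def
  proof (intro CollectI allI)
    fix l
    have "replicate l 0 \<in> words n" using n by (simp add: replicate_in_lists)
    then show "\<exists>\<nu>\<in>words n. l \<le> length \<nu> \<and> g = local_action n h \<nu>"
      using map_synchronizing_local_action[OF assms _ \<nu>(2,3)] \<nu>
      by (intro bexI[of _ "replicate l 0 @ \<nu>"]) auto
  qed
qed (auto simp: core_maps_def)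

context
  fixes h k assumes h: "clopen_embedding n h" and k: "map_synchronizing_at n h k"
begin

lemma core_maps_complete: "f \<in> core_maps n h \<Longrightarrow> complete_map n f"
  using complete_map_local_action[OF n h] unfolding core_maps_def by blast

lemma core_maps_local_action:
  assumes "f \<in> core_maps n h" "w \<in> words n"
  shows "local_action n f w \<in> core_maps n h"
proof -
  obtain \<nu> where \<nu>: "f = local_action n h \<nu>" "\<nu> \<in> words n" "k \<le> length \<nu>"
    using assms(1) unfolding core_maps_at[OF k] by blast
  then have "local_action n f w = local_action n h (\<nu> @ w)" "\<nu> @ w \<in> words n" "k \<le> length (\<nu> @ w)"
    using local_action_append[OF n clopen_embedding_inj[OF h]] assms(2) by auto
  then show ?thesis unfolding core_maps_at[OF k] by blast
qed

lemma core_maps_sync: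
  assumes "f \<in> core_maps n h" "\<nu> \<in> words n" "k \<le> length \<nu>"
  shows "local_action n f \<nu> = local_action n h \<nu>"
proof -
  obtain \<mu> where "f = local_action n h \<mu>" "\<mu> \<in> words n"
    using assms(1) unfolding core_maps_at[OF k] by blast
  then show ?thesis
    using local_action_append[OF n clopen_embedding_inj[OF h]] map_synchronizing_local_action[OF k] assms(2,3)
    by metis
qed

lemma core_maps_nonempty: "core_maps n h \<noteq> {}"
proof -
  have "replicate k 0 \<in> words n" using n by (simp add: replicate_in_lists)
  then show ?thesis unfolding core_maps_at[OF k] by auto
qed

text \<open>
  Finiteness is what makes bounds on output lengths uniform over the states in lemma \<open>core_product\<close>.
\<close>
lemma core_maps_finite: "finite (core_maps n h)"
proof (rule finite_subset)
  show "core_maps n h \<subseteq> local_action n h ` {\<nu>. set \<nu> \<subseteq> {..<n} \<and> length \<nu> = k}"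
  proof
    fix f assume "f \<in> core_maps n h"
    then obtain \<nu> where \<nu>: "f = local_action n h \<nu>" "\<nu> \<in> words n" "k \<le> length \<nu>"
      unfolding core_maps_at[OF k] by blast
    have w: "take (length \<nu> - k) \<nu> \<in> words n" "drop (length \<nu> - k) \<nu> \<in> words n"
      using \<nu>(2) by (metis append_in_lists_conv append_take_drop_id)+
    have "f = local_action n h (drop (length \<nu> - k) \<nu>)"
      using map_synchronizing_local_action[OF k w] \<nu> by simp
    then show "f \<in> local_action n h ` {\<nu>. set \<nu> \<subseteq> {..<n} \<and> length \<nu> = k}"
      using w(2) \<nu>(3) by (auto simp: in_lists_conv_set)
  qed
  show "finite (local_action n h ` {\<nu>. set \<nu> \<subseteq> {..<n} \<and> length \<nu> = k})"
    by (intro finite_imageI finite_lists_length_eq) simp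
qed

lemma core_maps_countable: "countable (core_maps n h)"
  by (rule countable_finite[OF core_maps_finite])

lemma core_maps_step: "f \<in> core_maps n h \<Longrightarrow> a < n \<Longrightarrow> local_action n f [a] \<in> core_maps n h"
  by (rule core_maps_local_action) auto

lemma complete_family_core: "complete_family n (core_maps n h)"
  using core_maps_complete core_maps_nonempty core_maps_countable core_maps_step
  by (simp add: complete_family_def)

lemmas core_maps_family = n complete_family_core

lemma is_SO_core: "is_SO n (map_transducer n (core_maps n h))"
proof -
  let ?T = "map_transducer n (core_maps n h)"
  note tr = map_transducer_trans[OF core_maps_family]
  note ind = induced_map_transducer[OF core_maps_family]
  have T: "is_transducer n ?T" by (rule is_transducer_map_transducer[OF core_maps_family])
  have sync: "synchronizing_at n ?T l" if "k \<le> l" for l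
    unfolding synchronizing_at_def using that by (auto simp: tr core_maps_sync)
  have "strongly_connected n ?T"
    unfolding strongly_connected_def states_map_transducer
  proof (intro ballI)
    fix p q assume p: "p \<in> core_maps n h" and "q \<in> core_maps n h"
    then obtain \<nu> where \<nu>: "q = local_action n h \<nu>" "\<nu> \<in> words n" "k \<le> length \<nu>"
      unfolding core_maps_at[OF k] by blast
    then show "\<exists>w\<in>words n. trans_word ?T w p = q"
      using tr[OF p \<nu>(2)] core_maps_sync[OF p \<nu>(2,3)] by (intro bexI[OF _ \<nu>(2)]) simp
  qed
  moreover have "core_states n ?T = states ?T"
  proof (intro equalityI subsetI)
    fix q assume "q \<in> core_states n ?T"
    then show "q \<in> states ?T"
      unfolding core_states_def using trans_word_states[OF T] by blast
  next
    fix q assume q: "q \<in> states ?T"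
    then obtain \<nu> where \<nu>: "q = local_action n h \<nu>" "\<nu> \<in> words n" "k \<le> length \<nu>"
      unfolding states_map_transducer core_maps_at[OF k] by blast
    then have "q = trans_word ?T \<nu> q" using q tr core_maps_sync by simp
    then show "q \<in> core_states n ?T"
      unfolding core_states_def using sync[OF \<nu>(3)] \<nu>(2) q by blast
  qed
  moreover have "minimal n ?T" if "strongly_connected n ?T"
    using that map_transducer_complete[OF core_maps_family] by (simp add: minimal_def ind)
  moreover have "strongly_synchronizing n ?T"
    unfolding strongly_synchronizing_def using sync by blast
  moreover have "inj_on (induced n ?T f) (seqs n) \<and> openin (cantor n) (image_state n ?T f) \<and>
      closedin (cantor n) (image_state n ?T f)" if "f \<in> core_maps n h" for f
  proof -
    have "clopen_embedding n f" using core_maps_complete[OF that] by (simp add: complete_map_def)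
    then show ?thesis
      using clopen_embedding_inj clopen_embedding_open clopen_embedding_closed
      by (simp add: image_state_def ind[OF that])
  qed
  ultimately show ?thesis
    unfolding is_SO_def states_map_transducer using T by blast
qed

lemma canonical_core: "canonical n (map_transducer n (core_maps n h)) = map_transducer n (core_maps n h)"
  by (rule canonical_map_transducer[OF core_maps_family])

lemma canonical_map_core: "canonical n (map_core n h k) = map_transducer n (core_maps n h)"
proof -
  have "next_state (map_core n h k) a f = local_action n f [a]" if f: "f \<in> core_maps n h" "a < n" for a f
  proof -
    have *: "local_action n h (\<nu> @ [a]) = local_action n (local_action n h \<nu>) [a]" if "\<nu> \<in> words n" for \<nu>
      using local_action_append[OF n clopen_embedding_inj[OF h] that] f(2) by simp
    obtain \<nu> where \<nu>: "f = local_action n h \<nu>" "\<nu> \<in> words n" "k \<le> length \<nu>"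
      using f(1) unfolding core_maps_at[OF k] by blast
    show ?thesis
      unfolding map_core_def transducer.simps
    proof (rule some_equality)
      show "\<exists>\<nu>\<in>words n. k \<le> length \<nu> \<and> f = local_action n h \<nu> \<and>
          local_action n f [a] = local_action n h (\<nu> @ [a])"
        using \<nu> *[OF \<nu>(2)] by (intro bexI[of _ \<nu>]) simp_all
    next
      fix g assume "\<exists>\<nu>\<in>words n. k \<le> length \<nu> \<and> f = local_action n h \<nu> \<and> g = local_action n h (\<nu> @ [a])"
      then obtain \<mu> where "\<mu> \<in> words n" "f = local_action n h \<mu>" "g = local_action n h (\<mu> @ [a])" by blast
      then show "g = local_action n f [a]" using * by simp
    qed
  qed
  then have "canonical n (map_core n h k) = canonical n (map_transducer n (core_maps n h))"
    by (intro canonical_agree[OF is_transducer_map_transducer[OF core_maps_family]])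
       (auto simp: map_transducer_step core_maps_at[OF k] map_core_def)
  then show ?thesis using canonical_core by simp
qed

end

end

section \<open>Minimising transducers\<close>

lemma trans_word_remove_incomplete_response [simp]:
  "trans_word (remove_incomplete_response n T) = trans_word T"
  by (simp add: trans_word_def remove_incomplete_response_def Let_def fun_eq_iff)

text \<open>
  A letter can be moved from the end to the front: the last \<open>k\<close> letters read determine the state.
\<close>
lemma core_states_closed:
  assumes T: "is_transducer n T" and q: "q \<in> core_states n T" and a: "a < n"
  shows "next_state T a q \<in> core_states n T"
proof -
  obtain w p k where w: "q = trans_word T w p" "synchronizing_at n T k" "w \<in> words n" "length w = k" "p \<in> states T"
    using q unfolding core_states_def by blast
  obtain b w' where bw: "w @ [a] = b # w'" by (cases "w @ [a]") auto
  have "b # w' \<in> words n" using w(3) a unfolding bw[symmetric] by simp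
  moreover have "length w' = k" using arg_cong[OF bw, of length] w(4) by simp
  moreover have "next_state T a q = trans_word T (w @ [a]) p" using w(1) by simp
  moreover have "trans_word T (w @ [a]) p = trans_word T w' (next_state T b p)" unfolding bw by simp
  moreover have "next_state T b p \<in> states T"
    using T w(5) calculation(1) by (simp add: is_transducer_def)
  ultimately show ?thesis unfolding core_states_def using w(2) by auto
qed

text \<open>
  Removing incomplete response moves the common prefix \<open>\<Lambda> q\<close> from the output of \<open>q\<close> to the outputs of its
  predecessors: \<open>\<Lambda> q\<close> followed by the new output at \<open>w\<close> is the longest common prefix of the image of the
  cylinder of \<open>w\<close> under the map of \<open>q\<close>. Therefore the new map of \<open>q\<close> is the old one without \<open>\<Lambda> q\<close>, which is its local
  action at the empty word. The second passage to the core changes nothing, since all states that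
  remain are already in the core.
\<close>
lemma minimisation:
  assumes n: "n \<ge> 2" and P: "is_transducer n P"
    and emb: "\<And>q. q \<in> states P \<Longrightarrow> clopen_embedding n (induced n P q)"
    and sync: "strongly_synchronizing n P"
  shows "core n (canonical n (remove_incomplete_response n (core n P))) =
    map_transducer n ((\<lambda>q. local_action n (induced n P q) []) ` core_states n P)"
proof -
  let ?C = "core n P" and ?R = "remove_incomplete_response n (core n P)"
  let ?\<Lambda> = "\<lambda>q. lcp (induced n P q ` seqs n)"
  have stC: "states ?C = core_states n P" by (simp add: core_def restrict_to_def)
  have sub: "core_states n P \<subseteq> states P"
    unfolding core_states_def using trans_word_states[OF P] by blast
  have ne: "core_states n P \<noteq> {}"
  proof -
    obtain k where k: "synchronizing_at n P k" using sync by (auto simp: strongly_synchronizing_def)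
    obtain q where "q \<in> states P" using P by (auto simp: is_transducer_def)
    moreover have "replicate k 0 \<in> words n" using n by (simp add: replicate_in_lists)
    ultimately have "trans_word P (replicate k 0) q \<in> core_states n P"
      unfolding core_states_def using k by (auto intro!: exI[of _ "replicate k 0"])
    then show ?thesis by blast
  qed
  have stepC: "next_state ?C a q = next_state P a q" "outp ?C a q = outp P a q"
    if "a < n" "q \<in> core_states n P" for a q
    using that by (simp_all add: core_def restrict_to_def)
  have eqC: "\<forall>a<n. \<forall>q\<in>core_states n P. next_state ?C a q = next_state P a q \<and>
      outp ?C a q = outp P a q \<and> next_state P a q \<in> core_states n P"
    using stepC core_states_closed[OF P] by blast
  note subC = subtransducer[of n P ?C, OF P, unfolded stC, OF sub ne eqC]
  have C: "is_transducer n ?C" by (rule subC(1))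
  have ind: "induced n ?C q = induced n P q" if "q \<in> core_states n P" for q by (rule subC(4)[OF that])
  have embC: "clopen_embedding n (induced n ?C q)" if "q \<in> core_states n P" for q
    using emb sub ind that by auto
  have imC: "image_state n ?C q = induced n P q ` seqs n" if "q \<in> core_states n P" for q
    by (simp add: image_state_def ind[OF that])
  have trC: "trans_word ?C w q \<in> core_states n P" if "q \<in> core_states n P" "w \<in> words n" for w q
    using trans_word_states[OF C _ that(2), of q] that(1) stC by simp
  have lcpC: "lcp (induced n P q ` cyl n w) = out_word ?C w q @ ?\<Lambda> (trans_word ?C w q)"
    if q: "q \<in> core_states n P" and w: "w \<in> words n" for q w
  proof -
    have "lcp (induced n ?C q ` cyl n w) = out_word ?C w q @ lcp (image_state n ?C (trans_word ?C w q))"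
      by (rule lcp_induced[OF n C _ clopen_embedding_inj[OF embC[OF q]] w]) (simp add: stC q)
    then show ?thesis using ind[OF q] imC[OF trC[OF q w]] by simp
  qed
  have \<Lambda>_prefix: "take (length (?\<Lambda> q)) (lcp (induced n P q ` cyl n w)) = ?\<Lambda> q"
    if q: "q \<in> core_states n P" and w: "w \<in> words n" for q w
    using lcp_append[OF n clopen_embedding_inj[OF emb], of q "[]" w] q w sub by (auto simp: cyl_Nil)
  have stepR: "next_state ?R a q = next_state ?C a q" for a q
    by (simp add: remove_incomplete_response_def Let_def)
  have stR: "states ?R = core_states n P"
    by (simp add: remove_incomplete_response_def Let_def stC)
  have outR: "?\<Lambda> q @ outp ?R a q = outp ?C a q @ ?\<Lambda> (next_state ?C a q)"
    if q: "q \<in> core_states n P" and a: "a < n" for q a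
  proof -
    have a': "[a] \<in> words n" using a by simp
    have "outp ?R a q = drop (length (?\<Lambda> q)) (lcp (induced n P q ` cyl n [a]))"
      using lcpC[OF q a'] imC[OF q] imC[OF trC[OF q a']]
      by (simp add: remove_incomplete_response_def Let_def)
    then show ?thesis
      using \<Lambda>_prefix[OF q a'] lcpC[OF q a'] by (metis append_take_drop_id out_word.simps trans_word_simps(1,2) append_Nil2)
  qed
  have outRw: "?\<Lambda> q @ out_word ?R w q = lcp (induced n P q ` cyl n w)"
    if "q \<in> core_states n P" "w \<in> words n" for q w
  proof -
    have "?\<Lambda> q @ out_word ?R w q = out_word ?C w q @ ?\<Lambda> (trans_word ?C w q)"
      using that
    proof (induction w arbitrary: q)
      case (Cons a w)
      have q': "next_state ?C a q \<in> core_states n P" using trC[of q "[a]"] Cons.prems by simp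
      have "?\<Lambda> q @ out_word ?R (a # w) q = (?\<Lambda> q @ outp ?R a q) @ out_word ?R w (next_state ?C a q)"
        by (simp add: stepR)
      also have "\<dots> = outp ?C a q @ ?\<Lambda> (next_state ?C a q) @ out_word ?R w (next_state ?C a q)"
        using outR[of q a] Cons.prems by simp
      also have "\<dots> = out_word ?C (a # w) q @ ?\<Lambda> (trans_word ?C (a # w) q)"
        using Cons.IH[OF q'] Cons.prems by simp
      finally show ?case .
    qed simp
    then show ?thesis using lcpC[OF that] by simp
  qed
  have R: "is_transducer n ?R"
    unfolding is_transducer_def stR
  proof (intro conjI allI impI ballI)
    show "countable (core_states n P)" using C stC by (simp add: is_transducer_def)
    fix q s l assume q: "q \<in> core_states n P" and s: "s \<in> seqs n"
    obtain k where "length (?\<Lambda> q) + l \<le> length (out_word ?C (prefix k s) q)"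
      using out_word_unbounded[OF C _ s] q stC by blast
    moreover have "length (?\<Lambda> q) + length (out_word ?R (prefix k s) q) \<ge> length (out_word ?C (prefix k s) q)" for k
      using arg_cong[OF outRw[OF q prefix_words[OF s]], of length] lcpC[OF q prefix_words[OF s]]
      by (metis le_add1 length_append)
    ultimately show "\<exists>k. l \<le> length (out_word ?R (prefix k s) q)"
      by (meson add_le_cancel_left le_trans)
  next
    fix a q assume a: "a < n" and q: "q \<in> core_states n P"
    show "next_state ?R a q \<in> core_states n P"
      using trC[of q "[a]"] q a by (simp add: stepR)
    have e: "clopen_embedding n (induced n P q)" using emb q sub by blast
    have "lcp (induced n P q ` cyl n [a]) \<in> words n"
      using lcp_words[OF n clopen_embedding_inj[OF e] clopen_embedding_into[OF e], of "[a]"] a by auto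
    then show "outp ?R a q \<in> words n"
      using outRw[OF q, of "[a]"] a by (metis append_in_lists_conv Cons_in_lists_iff lists.Nil lessThan_iff out_word.simps append_Nil2)
  qed (use ne in auto)
  have indR: "induced n ?R q = local_action n (induced n P q) []" if q: "q \<in> core_states n P" for q
  proof
    fix s show "induced n ?R q s = local_action n (induced n P q) [] s"
    proof (cases "s \<in> seqs n")
      case True
      note la = local_action_conc[OF n clopen_embedding_inj[OF emb[OF subsetD[OF sub q]]]]
      show ?thesis
      proof (rule induced_eqI[OF R _ True])
        fix k
        have "induced n P q (prefix k s \<frown> suffix k s) = lcp (induced n P q ` cyl n (prefix k s)) \<frown>
            local_action n (induced n P q) (prefix k s) (suffix k s)"
          by (rule la[OF prefix_words[OF True] suffix_seqs[OF True]])
        moreover have "induced n P q ([] \<frown> s) = ?\<Lambda> q \<frown> local_action n (induced n P q) [] s"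
          using la[OF _ True, of "[]"] by (simp add: cyl_Nil)
        ultimately have "?\<Lambda> q \<frown> local_action n (induced n P q) [] s =
            ?\<Lambda> q \<frown> (out_word ?R (prefix k s) q \<frown> local_action n (induced n P q) (prefix k s) (suffix k s))"
          using outRw[OF q prefix_words[OF True], of k] by simp
        then show "\<exists>t. local_action n (induced n P q) [] s = out_word ?R (prefix k s) q \<frown> t"
          by (metis same_concat_eq)
      qed (simp add: stR q)
    qed (simp add: induced_ext local_action_ext)
  qed
  have compl: "complete_map n (induced n ?R q)" if q: "q \<in> core_states n P" for q
    using complete_map_local_action[OF n emb[OF subsetD[OF sub q]], of "[]"] indR[OF q] by simp
  then have injR: "inj_on (induced n ?R q) (seqs n)" if "q \<in> states ?R" for q
    using that stR clopen_embedding_inj by (auto simp: complete_map_def)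
  have incR: "\<forall>q\<in>states ?R. \<not> incomplete_response n ?R q"
  proof
    fix q assume q: "q \<in> states ?R"
    then show "\<not> incomplete_response n ?R q"
      using incomplete_response_iff[OF n R q injR[OF q]] compl[of q] stR
      by (simp add: image_state_def complete_map_def)
  qed
  let ?D = "canonical n ?R"
  have stD: "states ?D = induced n ?R ` core_states n P"
    using states_canonical[OF R incR] stR by simp
  have trP: "trans_word ?D w (induced n ?R q) = induced n ?R (trans_word P w q)"
    if "q \<in> core_states n P" "w \<in> words n" for w q
    using canonical_words(1)[OF R incR _ that(2), of q] that subC(2) stR by simp
  have "core_states n ?D = states ?D"
  proof (intro equalityI subsetI)
    fix f assume "f \<in> core_states n ?D"
    then show "f \<in> states ?D"
      unfolding core_states_def using trans_word_states[OF is_transducer_canonical[OF R incR]] by blast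
  next
    fix f assume "f \<in> states ?D"
    then obtain q where q: "f = induced n ?R q" "q \<in> core_states n P" using stD by blast
    then obtain w p k where w: "q = trans_word P w p" "synchronizing_at n P k" "w \<in> words n" "length w = k" "p \<in> states P"
      unfolding core_states_def by blast
    have "synchronizing_at n ?D k"
      unfolding synchronizing_at_def
    proof (intro ballI impI)
      fix v f g assume v: "v \<in> words n" "length v = k" and fg: "f \<in> states ?D" "g \<in> states ?D"
      obtain q q' where "f = induced n ?R q" "q \<in> core_states n P" "g = induced n ?R q'" "q' \<in> core_states n P"
        using fg unfolding stD by blast
      then show "trans_word ?D v f = trans_word ?D v g"
        using w(2) v sub unfolding synchronizing_at_def by (metis trP subsetD)
    qed
    moreover have "q = trans_word P w q"
      using w q(2) sub unfolding synchronizing_at_def by blast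
    then have "f = trans_word ?D w f" using trP[OF q(2) w(3)] q(1) by simp
    ultimately show "f \<in> core_states n ?D"
      unfolding core_states_def using w(3,4) \<open>f \<in> states ?D\<close> by blast
  qed
  moreover have D: "?D = map_transducer n (induced n ?R ` core_states n P)"
    using canonical_eq_map_transducer[OF n R incR injR] stR by simp
  moreover have "restrict_to n S (map_transducer n S) = map_transducer n S" for S
    by (simp add: map_transducer_def restrict_to_def cong: if_cong)
  moreover have "induced n ?R ` core_states n P = (\<lambda>q. local_action n (induced n P q) []) ` core_states n P"
    using indR by (intro image_cong) auto
  ultimately show ?thesis unfolding core_def[of n ?D] by simp
qed

section \<open>Products of cores\<close>

lemma trans_word_prod:
  "trans_word (prod_transducer T U) w (p, q) = (trans_word T w p, trans_word U (out_word T w p) q)"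
  by (induction w arbitrary: p q) (simp_all add: prod_transducer_def)

lemma out_word_prod: "out_word (prod_transducer T U) w (p, q) = out_word U (out_word T w p) q"
proof (induction w arbitrary: p q)
  case (Cons a w)
  then show ?case by (simp add: out_word_append prod_transducer_def)
qed simp

lemma
  assumes T: "is_transducer n T" and U: "is_transducer n U"
  shows is_transducer_prod: "is_transducer n (prod_transducer T U)"
    and induced_prod: "p \<in> states T \<Longrightarrow> q \<in> states U \<Longrightarrow> s \<in> seqs n \<Longrightarrow>
      induced n (prod_transducer T U) (p, q) s = induced n U q (induced n T p s)"
proof -
  let ?P = "prod_transducer T U"
  have st: "states ?P = states T \<times> states U" by (simp add: prod_transducer_def)
  have ex: "\<exists>k. \<exists>v. out_word T (prefix k s) p = prefix j (induced n T p s) @ v"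
    if p: "p \<in> states T" and s: "s \<in> seqs n" for p s j
  proof -
    obtain k where k: "j \<le> length (out_word T (prefix k s) p)"
      using out_word_unbounded[OF T p s] by blast
    obtain t where "induced n T p s = out_word T (prefix k s) p \<frown> t"
      using induced_prefix[OF T p s] by blast
    then have "prefix j (induced n T p s) = take j (out_word T (prefix k s) p)" using k by simp
    then show ?thesis by (metis append_take_drop_id)
  qed
  show P: "is_transducer n ?P"
    unfolding is_transducer_def st
  proof (intro conjI allI impI ballI)
    show "states T \<times> states U \<noteq> {}" "countable (states T \<times> states U)"
      using T U by (auto simp: is_transducer_def)
    fix r s l assume "r \<in> states T \<times> states U" and s: "s \<in> seqs n"
    then obtain p q where r: "r = (p, q)" "p \<in> states T" "q \<in> states U" by blast
    obtain j where j: "l \<le> length (out_word U (prefix j (induced n T p s)) q)"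
      using out_word_unbounded[OF U r(3) induced_seqs[OF T r(2) s]] by blast
    obtain k v where "out_word T (prefix k s) p = prefix j (induced n T p s) @ v"
      using ex[OF r(2) s] by blast
    then show "\<exists>k. l \<le> length (out_word ?P (prefix k s) r)"
      using j by (intro exI[of _ k]) (simp add: r(1) out_word_prod out_word_append)
  next
    fix a r assume a: "a < n" and "r \<in> states T \<times> states U"
    then obtain p q where r: "r = (p, q)" "p \<in> states T" "q \<in> states U" by blast
    have "outp T a p \<in> words n" "next_state T a p \<in> states T" using T a r(2) by (auto simp: is_transducer_def)
    then show "next_state ?P a r \<in> states T \<times> states U" "outp ?P a r \<in> words n"
      using trans_word_states[OF U r(3)] out_word_words[OF U r(3)]
      by (simp_all add: r(1) prod_transducer_def)
  qed
  assume p: "p \<in> states T" and q: "q \<in> states U" and s: "s \<in> seqs n"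
  show "induced n ?P (p, q) s = induced n U q (induced n T p s)"
  proof (rule induced_eqI[OF P _ s])
    fix k
    obtain t where t: "induced n T p s = out_word T (prefix k s) p \<frown> t"
      using induced_prefix[OF T p s] by blast
    have "prefix (length (out_word T (prefix k s) p)) (induced n T p s) = out_word T (prefix k s) p"
      using t by simp
    then show "\<exists>t. induced n U q (induced n T p s) = out_word ?P (prefix k s) (p, q) \<frown> t"
      unfolding out_word_prod using induced_prefix[OF U q induced_seqs[OF T p s]] by metis
  qed (simp add: st p q)
qed

abbreviation core_of :: "nat \<Rightarrow> (nat word \<Rightarrow> nat word) \<Rightarrow> ctransducer"
  where "core_of n h \<equiv> map_transducer n (core_maps n h)"

text \<open>
  In the product transducer the pair of states \<open>(p, q)\<close> induces \<open>q \<circ> p\<close>. A long word brings the first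
  component into a state that depends on this word only, and from then on the output of the first
  component depends on the word only; once it is long, so is the second component. This makes the
  product strongly synchronizing. The map \<open>g \<circ> h\<close> restricted to a deep cone is \<open>q \<circ> p\<close> for states \<open>p\<close> of
  the core of \<open>h\<close> and \<open>q\<close> of the core of \<open>g\<close>, up to a common output, so deep local actions of \<open>g \<circ> h\<close> are
  those of \<open>q \<circ> p\<close>, and these are the states of the minimised product.
\<close>
lemma core_product:
  assumes n: "n \<ge> 2" and h: "sync_map n h" and g: "sync_map n g"
  shows "sync_map n (g \<circ> h)" and "SO_mult n (core_of n h) (core_of n g) = core_of n (g \<circ> h)"
proof -
  obtain k l where h': "clopen_embedding n h" "map_synchronizing_at n h k"
    and g': "clopen_embedding n g" "map_synchronizing_at n g l"
    using h g unfolding sync_map_def by blast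
  let ?T = "core_of n h" and ?U = "core_of n g"
  let ?P = "prod_transducer ?T ?U"
  note ch = core_maps_family[OF n h'] and cg = core_maps_family[OF n g']
  note trT = map_transducer_trans[OF ch] map_transducer_out[OF ch]
    and trU = map_transducer_trans[OF cg] map_transducer_out[OF cg]
  have T: "is_transducer n ?T" and U: "is_transducer n ?U"
    by (rule is_transducer_map_transducer[OF ch] is_transducer_map_transducer[OF cg])+
  have P: "is_transducer n ?P" by (rule is_transducer_prod[OF T U])
  have st: "states ?P = core_maps n h \<times> core_maps n g" by (simp add: prod_transducer_def)
  have Sh: "clopen_embedding n p" if "p \<in> core_maps n h" for p
    using core_maps_complete[OF n h' that] by (simp add: complete_map_def)
  have Sg: "clopen_embedding n q" if "q \<in> core_maps n g" for q
    using core_maps_complete[OF n g' that] by (simp add: complete_map_def)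
  have lw: "lcp (p ` cyl n w) \<in> words n" if "p \<in> core_maps n h" "w \<in> words n" for p w
    using lcp_words[OF n clopen_embedding_inj clopen_embedding_into] Sh that by blast
  have trP: "trans_word ?P w (p, q) = (local_action n p w, local_action n q (lcp (p ` cyl n w)))"
    if "p \<in> core_maps n h" "q \<in> core_maps n g" "w \<in> words n" for p q w
    using that lw by (simp add: trans_word_prod trT trU)
  have indP: "induced n ?P (p, q) s = (q \<circ> p) s"
    if "p \<in> core_maps n h" "q \<in> core_maps n g" "s \<in> seqs n" for p q s
    using that induced_prod[OF T U] induced_map_transducer[OF ch] induced_map_transducer[OF cg] by simp
  have embqp: "clopen_embedding n (q \<circ> p)" if "p \<in> core_maps n h" "q \<in> core_maps n g" for p q
    by (rule clopen_embedding_compose[OF Sh[OF that(1)] Sg[OF that(2)]])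
  have embP: "clopen_embedding n (induced n ?P r)" if r: "r \<in> states ?P" for r
  proof -
    obtain p q where pq: "r = (p, q)" "p \<in> core_maps n h" "q \<in> core_maps n g" using r st by auto
    show ?thesis
      unfolding pq(1) by (rule clopen_embedding_cong[OF embqp[OF pq(2,3)]]) (simp only: indP[OF pq(2,3)])
  qed
  have norm: "local_action n (induced n ?P (trans_word ?P w (p, q))) [] = local_action n (q \<circ> p) w"
    if pq: "p \<in> core_maps n h" "q \<in> core_maps n g" "w \<in> words n" for p q w
  proof -
    have "(p, q) \<in> states ?P" using pq st by simp
    then show ?thesis
      using local_action_induced[OF n P _ clopen_embedding_inj[OF embP] pq(3), of "(p, q)"]
        local_action_cong(1)[of n "induced n ?P (p, q)" "q \<circ> p", OF indP[OF pq(1,2)] pq(3)] by simp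
  qed
  \<comment> \<open>The first core is finite, so a single length makes all its states produce \<open>l\<close> letters.\<close>
  obtain K where K: "\<And>p w. p \<in> core_maps n h \<Longrightarrow> w \<in> words n \<Longrightarrow> K \<le> length w \<Longrightarrow> l \<le> length (lcp (p ` cyl n w))"
  proof -
    have "\<forall>p\<in>core_maps n h. \<exists>K. \<forall>w\<in>words n. K \<le> length w \<longrightarrow> l \<le> length (lcp (p ` cyl n w))"
      using lcp_cyl_unbounded[OF n Sh] by blast
    then obtain \<kappa> where \<kappa>: "\<And>p w. p \<in> core_maps n h \<Longrightarrow> w \<in> words n \<Longrightarrow> \<kappa> p \<le> length w \<Longrightarrow> l \<le> length (lcp (p ` cyl n w))"
      by metis
    have "\<kappa> p \<le> Max (\<kappa> ` core_maps n h)" if "p \<in> core_maps n h" for p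
      using that core_maps_finite[OF n h'] by simp
    then show ?thesis using \<kappa> that[of "Max (\<kappa> ` core_maps n h)"] le_trans by blast
  qed
  \<comment> \<open>The output after the first \<open>k\<close> letters does not depend on the starting state any more.\<close>
  let ?v = "\<lambda>w. lcp (local_action n h (take k w) ` cyl n (drop k w))"
  have sync: "trans_word ?P w (p, q) = (local_action n h w, local_action n g (?v w))"
    if p: "p \<in> core_maps n h" and q: "q \<in> core_maps n g" and w: "w \<in> words n" "k + K \<le> length w" for p q w
  proof -
    have w': "take k w \<in> words n" "drop k w \<in> words n"
      using w(1) by (metis append_in_lists_conv append_take_drop_id)+
    have pk: "local_action n p (take k w) = local_action n h (take k w)"
      by (rule core_maps_sync[OF n h' p w'(1)]) (use w(2) in simp)
    then have hk: "local_action n h (take k w) \<in> core_maps n h"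
      using core_maps_local_action[OF n h' p w'(1)] by simp
    have "lcp (p ` cyl n w) = lcp (p ` cyl n (take k w)) @ ?v w"
      using lcp_append[OF n clopen_embedding_inj[OF Sh[OF p]] w'] pk by simp
    moreover have "l \<le> length (?v w)" by (rule K[OF hk w'(2)]) (use w(2) in simp)
    ultimately have "local_action n q (lcp (p ` cyl n w)) = local_action n g (?v w)"
      using core_maps_sync[OF n g' q lw[OF p w(1)]]
        map_synchronizing_local_action[OF n g'(2) lw[OF p w'(1)] lw[OF hk w'(2)]] by simp
    then show ?thesis
      using trP[OF p q w(1)] core_maps_sync[OF n h' p w(1)] w(2) by simp
  qed
  have syncP: "synchronizing_at n ?P j" if "k + K \<le> j" for j
    unfolding synchronizing_at_def st using that sync by auto
  \<comment> \<open>Any pair of states serves as a reference point for the local actions of \<open>g \<circ> h\<close>.\<close>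
  obtain p0 q0 where pq0: "p0 \<in> core_maps n h" "q0 \<in> core_maps n g"
    using core_maps_nonempty[OF n h'] core_maps_nonempty[OF n g'] by blast
  obtain M where M: "\<And>w. w \<in> words n \<Longrightarrow> M \<le> length w \<Longrightarrow> l \<le> length (lcp (h ` cyl n w))"
    using lcp_cyl_unbounded[OF n h'(1)] by blast
  have comp: "local_action n (g \<circ> h) (v @ w) = local_action n (q0 \<circ> p0) w"
    if v: "v \<in> words n" "k + M \<le> length v" and w: "w \<in> words n" "k + K \<le> length w" for v w
  proof -
    let ?p = "local_action n h v" and ?u = "lcp (h ` cyl n v)"
    let ?q = "local_action n g ?u"
    have u: "?u \<in> words n" by (rule lcp_words[OF n clopen_embedding_inj[OF h'(1)] clopen_embedding_into[OF h'(1)] v(1)])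
    have p: "?p \<in> core_maps n h" unfolding core_maps_at[OF n h'(2)] using v by auto
    have q: "?q \<in> core_maps n g" unfolding core_maps_at[OF n g'(2)] using u M v by auto
    have "(g \<circ> h) (v \<frown> y) = lcp (g ` cyl n ?u) \<frown> (?q \<circ> ?p) y" if y: "y \<in> seqs n" for y
      using local_action_conc[OF n clopen_embedding_inj[OF h'(1)] v(1) y]
        local_action_conc[OF n clopen_embedding_inj[OF g'(1)] u] clopen_embedding_into[OF Sh[OF p]] y
      by auto
    then have "local_action n (g \<circ> h) (v @ w) = local_action n (?q \<circ> ?p) w"
      by (intro local_action_cone[OF n clopen_embedding_inj[OF clopen_embedding_compose[OF h'(1) g'(1)]] v(1) w(1)])
    also have "\<dots> = local_action n (induced n ?P (trans_word ?P w (?p, ?q))) []" using norm[OF p q w(1)] by simp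
    also have "\<dots> = local_action n (q0 \<circ> p0) w"
      using norm[OF pq0 w(1)] sync[OF p q w] sync[OF pq0 w] by simp
    finally show ?thesis .
  qed
  have e: "clopen_embedding n (g \<circ> h)" by (rule clopen_embedding_compose[OF h'(1) g'(1)])
  let ?N = "(k + M) + (k + K)"
  have split: "take (k + M) w \<in> words n" "drop (k + M) w \<in> words n" if "w \<in> words n" for w
    using that by (metis append_in_lists_conv append_take_drop_id)+
  have s: "map_synchronizing_at n (g \<circ> h) ?N"
    unfolding map_synchronizing_at_def
  proof (intro ballI impI)
    fix u u' w assume uw: "u \<in> words n" "u' \<in> words n" "w \<in> words n" "length w = ?N"
    have "local_action n (g \<circ> h) (x @ w) = local_action n (q0 \<circ> p0) (drop (k + M) w)" if "x \<in> words n" for x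
      using comp[of "x @ take (k + M) w" "drop (k + M) w"] split[OF uw(3)] that uw(4) by simp
    then show "local_action n (g \<circ> h) (u @ w) = local_action n (g \<circ> h) (u' @ w)" using uw by simp
  qed
  show "sync_map n (g \<circ> h)" using e s by (auto simp: sync_map_def)
  let ?Q = "{local_action n (q0 \<circ> p0) w | w. w \<in> words n \<and> k + K \<le> length w}"
  have "core_maps n (g \<circ> h) = ?Q"
    unfolding core_maps_at[OF n s]
  proof (intro equalityI subsetI)
    fix f assume "f \<in> {local_action n (g \<circ> h) w | w. w \<in> words n \<and> ?N \<le> length w}"
    then obtain w where w: "f = local_action n (g \<circ> h) w" "w \<in> words n" "?N \<le> length w" by blast
    then have "f = local_action n (q0 \<circ> p0) (drop (k + M) w)"
      using comp[of "take (k + M) w" "drop (k + M) w"] split[OF w(2)] by simp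
    then show "f \<in> ?Q" using split[OF w(2)] w(3) by auto
  next
    fix f assume "f \<in> ?Q"
    then obtain w where w: "f = local_action n (q0 \<circ> p0) w" "w \<in> words n" "k + K \<le> length w" by blast
    have z: "replicate (k + M) 0 \<in> words n" using n by (simp add: replicate_in_lists)
    then have "f = local_action n (g \<circ> h) (replicate (k + M) 0 @ w)"
      using comp[OF z _ w(2,3)] w(1) by simp
    then show "f \<in> {local_action n (g \<circ> h) w | w. w \<in> words n \<and> ?N \<le> length w}"
      using z w by (intro CollectI exI[of _ "replicate (k + M) 0 @ w"]) simp
  qed
  moreover have "(\<lambda>r. local_action n (induced n ?P r) []) ` core_states n ?P = ?Q"
  proof (intro equalityI subsetI)
    fix f assume "f \<in> (\<lambda>r. local_action n (induced n ?P r) []) ` core_states n ?P"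
    then obtain r where r: "f = local_action n (induced n ?P r) []" "r \<in> core_states n ?P" by blast
    then obtain w r0 where w: "r = trans_word ?P w r0" "synchronizing_at n ?P (length w)" "w \<in> words n" "r0 \<in> states ?P"
      unfolding core_states_def by blast
    let ?z = "replicate (k + K) 0"
    have z: "?z \<in> words n" using n by (simp add: replicate_in_lists)
    have z0: "trans_word ?P ?z (p0, q0) \<in> states ?P"
      by (rule trans_word_states[OF P _ z]) (use pq0 st in simp)
    have "trans_word ?P w r0 = trans_word ?P w (trans_word ?P ?z (p0, q0))"
      using w(2-4) z0 unfolding synchronizing_at_def by blast
    then have "r = trans_word ?P (?z @ w) (p0, q0)" unfolding w(1) by simp
    then have "f = local_action n (q0 \<circ> p0) (?z @ w)"
      using norm[OF pq0, of "?z @ w"] z w(3) r(1) by simp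
    then show "f \<in> ?Q" using z w(3) by (intro CollectI exI[of _ "?z @ w"]) simp
  next
    fix f assume "f \<in> ?Q"
    then obtain w where w: "f = local_action n (q0 \<circ> p0) w" "w \<in> words n" "k + K \<le> length w" by blast
    have "trans_word ?P w (p0, q0) \<in> core_states n ?P"
      unfolding core_states_def using syncP[OF w(3)] w(2) pq0 st by blast
    then show "f \<in> (\<lambda>r. local_action n (induced n ?P r) []) ` core_states n ?P"
      using norm[OF pq0 w(2)] w(1) by (intro image_eqI[of _ _ "trans_word ?P w (p0, q0)"]) simp
  qed
  moreover have "strongly_synchronizing n ?P" using syncP unfolding strongly_synchronizing_def by blast
  ultimately show "SO_mult n ?T ?U = core_of n (g \<circ> h)"
    unfolding SO_mult_def using minimisation[OF n P embP] by simp
qed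

section \<open>The monoid of cores\<close>

text \<open>
  An element of \<open>SO\<^sub>n\<close> is the core of each of its own states: reading \<open>w\<close> from \<open>f\<close> leads to the local action of
  \<open>f\<close> at \<open>w\<close>, and by synchronization every state is reached from \<open>f\<close> by arbitrarily long words.
\<close>
lemma SO_carrier_state:
  assumes n: "n \<ge> 2" and T: "T \<in> carrier (SO n)" and f: "f \<in> states T"
  shows "sync_map n f" "f \<in> extensional (seqs n)" "induced n T f = f" "T = core_of n f"
proof -
  have SO: "is_SO n T" and can: "canonical n T = T" using T by (auto simp: SO_def)
  have tr: "is_transducer n T" and inc: "\<forall>q\<in>states T. \<not> incomplete_response n T q"
    using SO by (auto simp: is_SO_def minimal_def)
  have emb: "clopen_embedding n (induced n T q)" if "q \<in> states T" for q
    by (rule clopen_embeddingI[OF continuous_induced[OF tr that]])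
       (use SO that in \<open>auto simp: is_SO_def image_state_def\<close>)
  have st: "states T = induced n T ` states T"
    using states_canonical[OF tr inc] unfolding can .
  have ind: "induced n T q = q" if q: "q \<in> states T" for q
  proof -
    obtain p where p: "p \<in> states T" "q = induced n T p" using q equalityD1[OF st] by blast
    then show ?thesis using induced_canonical[OF tr inc p(1)] unfolding can p(2) by blast
  qed
  show "induced n T f = f" by (rule ind[OF f])
  have "f y = undefined" if "y \<notin> seqs n" for y
    using induced_ext[OF that, of T f] unfolding ind[OF f] .
  then show "f \<in> extensional (seqs n)" by (simp add: extensional_def)
  have ef: "clopen_embedding n f" using emb[OF f] ind[OF f] by simp
  have la: "local_action n q w = trans_word T w q" if q: "q \<in> states T" and w: "w \<in> words n" for q w
    using local_action_induced_complete[OF n tr q clopen_embedding_inj[OF emb[OF q]] w]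
      inc trans_word_states[OF tr q w] ind q by simp
  obtain k where k: "synchronizing_at n T k"
    using SO by (auto simp: is_SO_def strongly_synchronizing_def)
  have "map_synchronizing_at n f k"
    unfolding map_synchronizing_at_def
  proof (intro ballI impI)
    fix u u' w assume uw: "u \<in> words n" "u' \<in> words n" "w \<in> words n" "length w = k"
    then have "trans_word T w (trans_word T u f) = trans_word T w (trans_word T u' f)"
      using k trans_word_states[OF tr f] unfolding synchronizing_at_def by blast
    then show "local_action n f (u @ w) = local_action n f (u' @ w)" using uw la[OF f] by simp
  qed
  then show "sync_map n f" using ef by (auto simp: sync_map_def)
  have "core_maps n f = states T"
  proof (intro equalityI subsetI)
    fix q assume "q \<in> core_maps n f"
    then obtain w where "w \<in> words n" "q = local_action n f w" unfolding core_maps_def by blast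
    then show "q \<in> states T" using la[OF f] trans_word_states[OF tr f] by simp
  next
    fix q assume "q \<in> states T"
    then have "q \<in> core_states n T" using SO by (simp add: is_SO_def)
    then obtain w p where w: "q = trans_word T w p" "synchronizing_at n T (length w)" "w \<in> words n" "p \<in> states T"
      unfolding core_states_def by blast
    show "q \<in> core_maps n f"
      unfolding core_maps_def
    proof (intro CollectI allI)
      fix l
      let ?z = "replicate l 0"
      have z: "?z \<in> words n" using n by (simp add: replicate_in_lists)
      have "trans_word T w p = trans_word T w (trans_word T ?z f)"
        using w(2-4) trans_word_states[OF tr f z] unfolding synchronizing_at_def by blast
      then have "q = trans_word T w (trans_word T ?z f)" unfolding w(1) .
      then have "q = local_action n f (?z @ w)" using la[OF f, of "?z @ w"] z w(3) by simp
      then show "\<exists>\<nu>\<in>words n. l \<le> length \<nu> \<and> q = local_action n f \<nu>"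
        using z w(3) by (intro bexI[of _ "?z @ w"]) simp_all
    qed
  qed
  then show "T = core_of n f"
    using canonical_eq_map_transducer[OF n tr inc clopen_embedding_inj[OF emb]]
    unfolding can st[symmetric] by simp
qed

lemma SO_carrier:
  assumes n: "n \<ge> 2" shows "carrier (SO n) = {core_of n h | h. sync_map n h}"
proof (intro equalityI subsetI)
  fix T assume T: "T \<in> carrier (SO n)"
  then obtain f where "f \<in> states T" by (auto simp: SO_def is_SO_def is_transducer_def)
  then show "T \<in> {core_of n h | h. sync_map n h}" using SO_carrier_state[OF n T] by blast
next
  fix T assume "T \<in> {core_of n h | h. sync_map n h}"
  then obtain h k where h: "T = core_of n h" "clopen_embedding n h" "map_synchronizing_at n h k"
    unfolding sync_map_def by blast
  show "T \<in> carrier (SO n)"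
    unfolding h(1) SO_def using is_SO_core[OF n h(2,3)] canonical_core[OF n h(2,3)] by simp
qed

lemma lcp_seqs: assumes n: "n \<ge> 2" shows "lcp (seqs n) = []"
proof (rule lcp_eqI[OF nontrivial_seqs[OF n]])
  fix w assume w: "common_prefix w (seqs n)"
  show "length w \<le> length []"
  proof (rule ccontr)
    assume "\<not> length w \<le> length []"
    then have l: "0 < length w" by simp
    have "w ! 0 = a" if a: "a < n" for a
    proof -
      have "prefix (length w) (\<lambda>_. a) = w" using w const_seqs[OF a] unfolding common_prefix_alt by blast
      then show ?thesis using l by (metis add_0 diff_zero subsequence_nth)
    qed
    from this[of 0] this[of 1] show False using n by simp
  qed
qed (simp add: common_prefix_def)

lemma clopen_embedding_id: "clopen_embedding n id"
  by (rule clopen_embeddingI)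
     (auto simp: openin_topspace[of "cantor n", unfolded topspace_cantor])

lemma local_action_id:
  assumes n: "n \<ge> 2" and w: "w \<in> words n" shows "local_action n id w = restrict id (seqs n)"
proof -
  have "local_action n id (w @ []) = local_action n id []"
    by (rule local_action_cone[OF n _ w]) (auto simp: inj_on_def)
  then show ?thesis using local_action_complete[of id n] lcp_seqs[OF n] by simp
qed

lemma sync_map_id: "n \<ge> 2 \<Longrightarrow> sync_map n id"
  unfolding sync_map_def map_synchronizing_at_def using clopen_embedding_id local_action_id by simp

lemma core_maps_id:
  assumes n: "n \<ge> 2" shows "core_maps n id = {restrict id (seqs n)}"
proof -
  have "map_synchronizing_at n id 0"
    unfolding map_synchronizing_at_def using local_action_id[OF n] by simp
  then have "core_maps n id = {local_action n id \<nu> | \<nu>. \<nu> \<in> words n \<and> 0 \<le> length \<nu>}"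
    by (rule core_maps_at[OF n])
  also have "\<dots> = {restrict id (seqs n)}"
    using local_action_id[OF n] lists.Nil by (auto intro!: exI[of _ "[]"])
  finally show ?thesis .
qed

lemma one_SO: assumes n: "n \<ge> 2" shows "\<one>\<^bsub>SO n\<^esub> = core_of n id"
proof -
  have ow: "out_word id_transducer w q = w" for w q
    by (induction w arbitrary: q) (simp_all add: id_transducer_def)
  have tr: "is_transducer n id_transducer"
    unfolding is_transducer_def ow by (auto simp: id_transducer_def)
  have ind: "induced n id_transducer q = restrict id (seqs n)" for q
  proof
    fix s show "induced n id_transducer q s = restrict id (seqs n) s"
    proof (cases "s \<in> seqs n")
      case True
      then show ?thesis
        using induced_eqI[OF tr _ True, of q s] unfolding ow
        by (metis (no_types) UNIV_I id_apply id_transducer_def prefix_suffix restrict_apply' transducer.select_convs(1))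
    qed (simp add: induced_ext)
  qed
  have inj: "inj_on (induced n id_transducer q) (seqs n)" for q by (auto simp: ind inj_on_def)
  have "image_state n id_transducer q = seqs n" for q by (auto simp: image_state_def ind)
  then have "\<forall>q\<in>states id_transducer. \<not> incomplete_response n id_transducer q"
    using incomplete_response_iff[OF n tr _ inj] lcp_seqs[OF n] by simp
  then have "canonical n id_transducer = map_transducer n (induced n id_transducer ` states id_transducer)"
    by (rule canonical_eq_map_transducer[OF n tr _ inj])
  moreover have "induced n id_transducer ` states id_transducer = {restrict id (seqs n)}"
    unfolding ind by (auto simp: id_transducer_def)
  ultimately show ?thesis by (simp add: SO_def core_maps_id[OF n])
qed

lemma mult_SO:
  assumes "n \<ge> 2" "sync_map n h" "sync_map n g"
  shows "core_of n h \<otimes>\<^bsub>SO n\<^esub> core_of n g = core_of n (g \<circ> h)"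
  using core_product(2)[OF assms] by (simp add: SO_def)

lemma core_maps_cong:
  assumes "\<And>y. y \<in> seqs n \<Longrightarrow> h y = g y" shows "core_maps n h = core_maps n g"
proof -
  have "local_action n h \<nu> = local_action n g \<nu>" if "\<nu> \<in> words n" for \<nu>
    by (rule local_action_cong(1)[OF assms that])
  then show ?thesis unfolding core_maps_def by metis
qed

text \<open>
  All axioms are inherited from composition of maps through \<open>mult_SO\<close>.
\<close>
lemma monoid_SO: assumes n: "n \<ge> 2" shows "monoid (SO n)"
proof (rule monoidI)
  note cm = core_product(1)[OF n]
  show "x \<otimes>\<^bsub>SO n\<^esub> y \<in> carrier (SO n)" if "x \<in> carrier (SO n)" "y \<in> carrier (SO n)" for x y
    using that mult_SO[OF n] cm unfolding SO_carrier[OF n] by auto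
  show "\<one>\<^bsub>SO n\<^esub> \<in> carrier (SO n)"
    using sync_map_id[OF n] one_SO[OF n] unfolding SO_carrier[OF n] by auto
  show "x \<otimes>\<^bsub>SO n\<^esub> y \<otimes>\<^bsub>SO n\<^esub> z = x \<otimes>\<^bsub>SO n\<^esub> (y \<otimes>\<^bsub>SO n\<^esub> z)"
    if xyz: "x \<in> carrier (SO n)" "y \<in> carrier (SO n)" "z \<in> carrier (SO n)" for x y z
  proof -
    obtain f g h where "x = core_of n f" "y = core_of n g" "z = core_of n h" "sync_map n f" "sync_map n g" "sync_map n h"
      using xyz unfolding SO_carrier[OF n] by blast
    then show ?thesis using mult_SO[OF n] cm by (simp add: o_assoc)
  qed
  fix x assume "x \<in> carrier (SO n)"
  then obtain h where h: "x = core_of n h" "sync_map n h" unfolding SO_carrier[OF n] by blast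
  show "\<one>\<^bsub>SO n\<^esub> \<otimes>\<^bsub>SO n\<^esub> x = x"
    unfolding h(1) one_SO[OF n] mult_SO[OF n sync_map_id[OF n] h(2)] by simp
  show "x \<otimes>\<^bsub>SO n\<^esub> \<one>\<^bsub>SO n\<^esub> = x"
    unfolding h(1) one_SO[OF n] mult_SO[OF n h(2) sync_map_id[OF n]] by simp
qed

section \<open>The groups of cores\<close>

lemma group_O: "n \<ge> 2 \<Longrightarrow> group (O_group n)"
  unfolding O_group_def by (rule monoid.units_group[OF monoid_SO])

lemma mult_O:
  "n \<ge> 2 \<Longrightarrow> sync_map n h \<Longrightarrow> sync_map n g \<Longrightarrow> core_of n h \<otimes>\<^bsub>O_group n\<^esub> core_of n g = core_of n (g \<circ> h)"
  using mult_SO by (simp add: O_group_def units_of_def)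

text \<open>
  Homeomorphisms that are synchronizing in both directions, together with their inverses. Nothing is
  said about values outside \<open>seqs n\<close>, on which cores do not depend.
\<close>
definition sync_homeo :: "nat \<Rightarrow> (nat word \<Rightarrow> nat word) \<Rightarrow> (nat word \<Rightarrow> nat word) \<Rightarrow> bool"
  where "sync_homeo n h g \<longleftrightarrow> sync_map n h \<and> sync_map n g \<and>
    (\<forall>s\<in>seqs n. g (h s) = s) \<and> (\<forall>s\<in>seqs n. h (g s) = s)"

lemma sync_homeo_sym: "sync_homeo n h g \<Longrightarrow> sync_homeo n g h"
  by (simp add: sync_homeo_def)

lemma sync_homeo_seqs:
  assumes "sync_homeo n h g" "s \<in> seqs n" shows "h s \<in> seqs n" "g s \<in> seqs n"
  using assms clopen_embedding_into unfolding sync_homeo_def sync_map_def by blast+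

lemma sync_homeo_comp:
  assumes "n \<ge> 2" "sync_homeo n h g" "sync_homeo n h' g'"
  shows "sync_homeo n (h' \<circ> h) (g \<circ> g')"
  using assms core_product(1)[OF assms(1)] sync_homeo_seqs[OF assms(2)] sync_homeo_seqs[OF assms(3)]
  by (simp add: sync_homeo_def)

lemma sync_homeo_id: "n \<ge> 2 \<Longrightarrow> sync_homeo n id id"
  by (simp add: sync_homeo_def sync_map_id)

lemma sync_homeo_inverse:
  assumes n: "n \<ge> 2" and h: "sync_homeo n h g"
  shows "core_of n h \<otimes>\<^bsub>SO n\<^esub> core_of n g = \<one>\<^bsub>SO n\<^esub>"
  using h mult_SO[OF n] core_maps_cong[of n "g \<circ> h" id] one_SO[OF n]
  by (simp add: sync_homeo_def)

lemma core_in_O: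
  assumes n: "n \<ge> 2" and h: "sync_homeo n h g"
  shows "core_of n h \<in> carrier (O_group n)"
proof -
  have "core_of n h \<in> carrier (SO n)" "core_of n g \<in> carrier (SO n)"
    using h unfolding SO_carrier[OF n] sync_homeo_def by blast+
  then show ?thesis
    using sync_homeo_inverse[OF n h] sync_homeo_inverse[OF n sync_homeo_sym[OF h]]
    by (auto simp: O_group_def units_of_def Units_def)
qed

lemma inv_O:
  assumes n: "n \<ge> 2" and h: "sync_homeo n h g"
  shows "inv\<^bsub>O_group n\<^esub> (core_of n h) = core_of n g"
proof (rule group.inv_equality[OF group_O[OF n]])
  show "core_of n g \<otimes>\<^bsub>O_group n\<^esub> core_of n h = \<one>\<^bsub>O_group n\<^esub>"
    using sync_homeo_inverse[OF n sync_homeo_sym[OF h]] by (simp add: O_group_def units_of_def)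
qed (use core_in_O[OF n h] core_in_O[OF n sync_homeo_sym[OF h]] in auto)

lemma homeomorphic_clopen_embedding:
  assumes "homeomorphic_maps (cantor n) (cantor n) h g" shows "clopen_embedding n h"
  using homeomorphic_maps_imp_map[OF assms] unfolding homeomorphic_eq_everything_map clopen_embedding_def
  by (simp add: topspace_cantor)

lemma O1_carrier:
  assumes n: "n \<ge> 2"
  shows "carrier (O1_group n) = {core_of n h | h g. sync_homeo n h g}"
proof (intro equalityI subsetI)
  fix T assume "T \<in> carrier (O1_group n)"
  then obtain h g k l where h: "homeomorphic_maps (cantor n) (cantor n) h g" "map_synchronizing_at n h k"
    "map_synchronizing_at n g l" "T = canonical n (map_core n h k)"
    unfolding O1_group_def by auto
  have e: "clopen_embedding n h" "clopen_embedding n g"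
    using h(1) homeomorphic_maps_sym homeomorphic_clopen_embedding by blast+
  have "sync_homeo n h g"
    using h e unfolding sync_homeo_def sync_map_def homeomorphic_maps_def topspace_cantor by blast
  then show "T \<in> {core_of n h | h g. sync_homeo n h g}"
    using canonical_map_core[OF n e(1) h(2)] h(4) by blast
next
  fix T assume "T \<in> {core_of n h | h g. sync_homeo n h g}"
  then obtain h g where T: "T = core_of n h" "sync_homeo n h g" by blast
  then obtain k l where k: "clopen_embedding n h" "clopen_embedding n g"
      "map_synchronizing_at n h k" "map_synchronizing_at n g l"
    unfolding sync_homeo_def sync_map_def by blast
  have "homeomorphic_maps (cantor n) (cantor n) h g"
    using T(2) k clopen_embedding_cont unfolding homeomorphic_maps_def sync_homeo_def topspace_cantor by blast
  then show "T \<in> carrier (O1_group n)"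
    using k(3,4) canonical_map_core[OF n k(1,3), symmetric] core_in_O[OF n T(2)]
    unfolding O1_group_def T(1) by simp blast
qed

lemma subgroup_O1: assumes n: "n \<ge> 2" shows "subgroup (carrier (O1_group n)) (O_group n)"
proof (rule group.subgroupI[OF group_O[OF n]])
  note car = O1_carrier[OF n]
  show "carrier (O1_group n) \<subseteq> carrier (O_group n)" unfolding car using core_in_O[OF n] by blast
  show "carrier (O1_group n) \<noteq> {}" unfolding car using sync_homeo_id[OF n] by blast
  fix a assume "a \<in> carrier (O1_group n)"
  then obtain h g where a: "a = core_of n h" "sync_homeo n h g" unfolding car by blast
  show "inv\<^bsub>O_group n\<^esub> a \<in> carrier (O1_group n)"
    unfolding a(1) inv_O[OF n a(2)] car using sync_homeo_sym[OF a(2)] by blast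
  fix b assume "b \<in> carrier (O1_group n)"
  then obtain h' g' where b: "b = core_of n h'" "sync_homeo n h' g'" unfolding car by blast
  have "a \<otimes>\<^bsub>O_group n\<^esub> b = core_of n (h' \<circ> h)"
    using mult_O[OF n] a(2) b(2) unfolding a(1) b(1) sync_homeo_def by blast
  then show "a \<otimes>\<^bsub>O_group n\<^esub> b \<in> carrier (O1_group n)"
    unfolding car using sync_homeo_comp[OF n a(2) b(2)] by blast
qed

lemma O1_eq: "O1_group n = (O_group n)\<lparr>carrier := carrier (O1_group n)\<rparr>"
  by (simp add: O1_group_def)

section \<open>Marker maps\<close>

text \<open>
  The letter \<open>x\<close> acts as a marker: the map rewrites the block before it without creating a marker, keeps
  the marker, and starts afresh behind it. The second clause covers the infinite last block.
\<close>
definition marker_map :: "nat \<Rightarrow> nat \<Rightarrow> (nat word \<Rightarrow> nat word) \<Rightarrow> bool"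
  where "marker_map n x f \<longleftrightarrow>
    (\<forall>w\<in>words n. x \<notin> set w \<longrightarrow> (\<exists>w'\<in>words n. x \<notin> set w' \<and>
      (\<forall>y\<in>seqs n. f ((w @ [x]) \<frown> y) = (w' @ [x]) \<frown> f y))) \<and>
    (\<forall>z\<in>seqs n. x \<notin> range z \<longrightarrow> x \<notin> range (f z))"

text \<open>
  Extensionality makes the map unique in lemma \<open>marker_homeo_core_unique\<close>.
\<close>
definition marker_homeo :: "nat \<Rightarrow> nat \<Rightarrow> (nat word \<Rightarrow> nat word) \<Rightarrow> (nat word \<Rightarrow> nat word) \<Rightarrow> bool"
  where "marker_homeo n x f g \<longleftrightarrow> sync_homeo n f g \<and> f \<in> extensional (seqs n) \<and> g \<in> extensional (seqs n) \<and>
    marker_map n x f \<and> marker_map n x g"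

lemma split_at_first_marker:
  assumes z: "z \<in> seqs n" and x: "x \<in> range z"
  shows "\<exists>w y. z = (w @ [x]) \<frown> y \<and> x \<notin> set w \<and> w \<in> words n \<and> y \<in> seqs n"
proof -
  define i where "i = (LEAST i. z i = x)"
  have i: "z i = x" "\<And>j. j < i \<Longrightarrow> z j \<noteq> x"
    using x LeastI[of "\<lambda>i. z i = x"] not_less_Least[of _ "\<lambda>i. z i = x"] unfolding i_def by blast+
  have "prefix i z @ [x] = prefix (Suc i) z" using i(1) by simp
  then have "z = (prefix i z @ [x]) \<frown> suffix (Suc i) z" by (metis prefix_suffix)
  moreover have "x \<notin> set (prefix i z)" using i(2) unfolding set_subsequence by force
  ultimately show ?thesis using prefix_words[OF z] suffix_seqs[OF z] by blast
qed

lemma first_marker_unique: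
  assumes eq: "(u @ [x]) \<frown> s = (v @ [x]) \<frown> t" and x: "x \<notin> set u" "x \<notin> set v"
  shows "u = v \<and> s = t"
proof -
  have *: "\<not> length u < length v" if "(u @ [x]) \<frown> s = (v @ [x]) \<frown> t" "x \<notin> set v" for u v s t
  proof
    assume l: "length u < length v"
    have "((u @ [x]) \<frown> s) (length u) = x" by simp
    moreover have "((v @ [x]) \<frown> t) (length u) = v ! length u" using l by (simp add: nth_append)
    ultimately show False using that l by (metis nth_mem)
  qed
  have "length u = length v" using *[OF eq x(2)] *[OF eq[symmetric] x(1)] by simp
  then show ?thesis using eq by simp
qed

lemma marker_map_free:
  assumes "marker_map n x f" "z \<in> seqs n" "x \<notin> range z" shows "x \<notin> range (f z)"
  using assms by (simp add: marker_map_def)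

lemma marker_map_block:
  assumes "marker_map n x f" "w \<in> words n" "x \<notin> set w"
  shows "\<exists>w'\<in>words n. x \<notin> set w' \<and> (\<forall>y\<in>seqs n. f ((w @ [x]) \<frown> y) = (w' @ [x]) \<frown> f y)"
  using assms unfolding marker_map_def by blast

lemma marker_map_conc:
  assumes f: "marker_map n x f" and x: "x < n" and v: "v \<in> words n"
  shows "\<exists>v'\<in>words n. \<forall>y\<in>seqs n. f ((v @ [x]) \<frown> y) = (v' @ [x]) \<frown> f y"
  using v
proof (induction "length v" arbitrary: v rule: less_induct)
  case less
  show ?case
  proof (cases "x \<in> set v")
    case False
    then show ?thesis using marker_map_block[OF f less.prems] by blast
  next
    case True
    then obtain v1 v2 where v: "v = v1 @ x # v2" "x \<notin> set v1" by (meson split_list_first)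
    then have w: "v1 \<in> words n" "v2 \<in> words n" using less.prems by auto
    obtain v1' where v1': "v1' \<in> words n" "\<And>y. y \<in> seqs n \<Longrightarrow> f ((v1 @ [x]) \<frown> y) = (v1' @ [x]) \<frown> f y"
      using marker_map_block[OF f w(1) v(2)] by blast
    obtain v2' where v2': "v2' \<in> words n" "\<And>y. y \<in> seqs n \<Longrightarrow> f ((v2 @ [x]) \<frown> y) = (v2' @ [x]) \<frown> f y"
      using less.hyps[of v2] v(1) w(2) by auto
    have eq: "f ((v @ [x]) \<frown> y) = ((v1' @ [x] @ v2') @ [x]) \<frown> f y" if y: "y \<in> seqs n" for y
    proof -
      have "(v2 @ [x]) \<frown> y \<in> seqs n" by (rule conc_seqs[OF y]) (use w(2) x in simp)
      then have "f ((v1 @ [x]) \<frown> ((v2 @ [x]) \<frown> y)) = (v1' @ [x]) \<frown> ((v2' @ [x]) \<frown> f y)"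
        using v1'(2) v2'(2) y by metis
      then show ?thesis using v(1) by simp
    qed
    have "v1' @ [x] @ v2' \<in> words n" using v1'(1) v2'(1) x by simp
    then show ?thesis
    proof (rule bexI[rotated])
      show "\<forall>y\<in>seqs n. f ((v @ [x]) \<frown> y) = ((v1' @ [x] @ v2') @ [x]) \<frown> f y"
        by (rule ballI) (rule eq)
    qed
  qed
qed

lemma marker_map_comp:
  assumes f: "marker_map n x f" "f ` seqs n \<subseteq> seqs n" and g: "marker_map n x g"
  shows "marker_map n x (g \<circ> f)"
  unfolding marker_map_def
proof (intro conjI ballI impI)
  fix w assume w: "w \<in> words n" "x \<notin> set w"
  obtain w' where w': "w' \<in> words n" "x \<notin> set w'" "\<And>y. y \<in> seqs n \<Longrightarrow> f ((w @ [x]) \<frown> y) = (w' @ [x]) \<frown> f y"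
    using marker_map_block[OF f(1) w] by blast
  obtain w'' where w'': "w'' \<in> words n" "x \<notin> set w''" "\<And>y. y \<in> seqs n \<Longrightarrow> g ((w' @ [x]) \<frown> y) = (w'' @ [x]) \<frown> g y"
    using marker_map_block[OF g w'(1,2)] by blast
  show "\<exists>w'\<in>words n. x \<notin> set w' \<and> (\<forall>y\<in>seqs n. (g \<circ> f) ((w @ [x]) \<frown> y) = (w' @ [x]) \<frown> (g \<circ> f) y)"
  proof (intro bexI[OF _ w''(1)] conjI ballI)
    fix y assume y: "y \<in> seqs n"
    then show "(g \<circ> f) ((w @ [x]) \<frown> y) = (w'' @ [x]) \<frown> (g \<circ> f) y"
      using w'(3)[OF y] w''(3)[of "f y"] f(2) by (simp add: image_subset_iff)
  qed (rule w''(2))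
next
  fix z assume z: "z \<in> seqs n" "x \<notin> range z"
  have "f z \<in> seqs n" using f(2) z(1) by blast
  then show "x \<notin> range ((g \<circ> f) z)"
    using marker_map_free[OF g _ marker_map_free[OF f(1) z]] by simp
qed

lemma marker_map_cong:
  assumes f: "marker_map n x f" and x: "x < n" and eq: "\<And>y. y \<in> seqs n \<Longrightarrow> f y = g y"
  shows "marker_map n x g"
  unfolding marker_map_def
proof (intro conjI ballI impI)
  fix w assume w: "w \<in> words n" "x \<notin> set w"
  obtain w' where w': "w' \<in> words n" "x \<notin> set w'" "\<And>y. y \<in> seqs n \<Longrightarrow> f ((w @ [x]) \<frown> y) = (w' @ [x]) \<frown> f y"
    using marker_map_block[OF f w] by blast
  have "(w @ [x]) \<frown> y \<in> seqs n" if "y \<in> seqs n" for y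
    by (rule conc_seqs[OF that]) (use w x in simp)
  then show "\<exists>w'\<in>words n. x \<notin> set w' \<and> (\<forall>y\<in>seqs n. g ((w @ [x]) \<frown> y) = (w' @ [x]) \<frown> g y)"
    using w' eq by (intro bexI[OF _ w'(1)]) simp
next
  fix z assume "z \<in> seqs n" "x \<notin> range z"
  then show "x \<notin> range (g z)" using marker_map_free[OF f] eq by metis
qed

text \<open>
  The preimage of \<open>v x y\<close> contains \<open>x\<close>, and by uniqueness of the first marker its first block is mapped
  to \<open>v\<close>. By injectivity this block does not depend on \<open>y\<close>, so one \<open>y\<close> suffices to find it.
\<close>
lemma marker_map_inverse:
  assumes f: "marker_map n x f" and x: "x < n"
    and gf: "\<And>s. s \<in> seqs n \<Longrightarrow> g (f s) = s" and fg: "\<And>s. s \<in> seqs n \<Longrightarrow> f (g s) = s"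
    and g: "g ` seqs n \<subseteq> seqs n"
  shows "marker_map n x g"
  unfolding marker_map_def
proof (intro conjI ballI impI)
  fix v assume v: "v \<in> words n" "x \<notin> set v"
  have y0: "(\<lambda>_. x) \<in> seqs n" using x by (rule const_seqs)
  let ?z = "g ((v @ [x]) \<frown> (\<lambda>_. x))"
  have vx: "(v @ [x]) \<frown> y \<in> seqs n" if "y \<in> seqs n" for y
    by (rule conc_seqs[OF that]) (use v x in simp)
  have z: "?z \<in> seqs n" "f ?z = (v @ [x]) \<frown> (\<lambda>_. x)" using g vx[OF y0] fg by auto
  have "x \<in> range ?z"
    using marker_map_free[OF f z(1)] z(2) by auto
  then obtain w y where w: "?z = (w @ [x]) \<frown> y" "x \<notin> set w" "w \<in> words n" "y \<in> seqs n"
    using split_at_first_marker[OF z(1)] by blast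
  obtain w' where w': "x \<notin> set w'" "\<And>y. y \<in> seqs n \<Longrightarrow> f ((w @ [x]) \<frown> y) = (w' @ [x]) \<frown> f y"
    using marker_map_block[OF f w(3,2)] by blast
  have u: "(w' @ [x]) \<frown> f y = (v @ [x]) \<frown> (\<lambda>_. x)" using w'(2)[OF w(4)] w(1) z(2) by simp
  have wv: "w' = v" using first_marker_unique[OF u w'(1) v(2)] by simp
  have eq: "g ((v @ [x]) \<frown> y) = (w @ [x]) \<frown> g y" if y: "y \<in> seqs n" for y
  proof -
    have gy: "g y \<in> seqs n" using g y by blast
    have "(w @ [x]) \<frown> g y \<in> seqs n" by (rule conc_seqs[OF gy]) (use w(3) x in simp)
    then have "g (f ((w @ [x]) \<frown> g y)) = (w @ [x]) \<frown> g y" by (rule gf)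
    then show ?thesis using w'(2)[OF gy] fg[OF y] wv by simp
  qed
  show "\<exists>w'\<in>words n. x \<notin> set w' \<and> (\<forall>y\<in>seqs n. g ((v @ [x]) \<frown> y) = (w' @ [x]) \<frown> g y)"
    by (intro bexI[OF _ w(3)] conjI ballI w(2)) (rule eq)
next
  fix z assume z: "z \<in> seqs n" "x \<notin> range z"
  show "x \<notin> range (g z)"
  proof
    have gz: "g z \<in> seqs n" using g z(1) by blast
    assume "x \<in> range (g z)"
    then obtain w y where w: "g z = (w @ [x]) \<frown> y" "x \<notin> set w" "w \<in> words n" "y \<in> seqs n"
      using split_at_first_marker[OF gz] by blast
    obtain w' where "f ((w @ [x]) \<frown> y) = (w' @ [x]) \<frown> f y"
      using marker_map_block[OF f w(3,2)] w(4) by blast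
    then have "z = (w' @ [x]) \<frown> f y" using fg[OF z(1)] w(1) by simp
    then have "z (length w') = x" by simp
    then show False using z(2) by blast
  qed
qed

text \<open>
  Markers of \<open>f z\<close> come from markers of \<open>z\<close> in the same order, so what follows a marker in \<open>f z\<close> is the
  image of what follows the corresponding marker in \<open>z\<close>. The induction removes one block at a time.
\<close>
lemma marker_map_after_marker:
  assumes f: "marker_map n x f"  and x: "x < n"
    and "z \<in> seqs n" "y \<in> seqs n" "f z = (w @ [x]) \<frown> y"
  shows "\<exists>z'\<in>seqs n. f z' = y"
  using assms(3,5)
proof (induction "length w" arbitrary: w z rule: less_induct)
  case less
  have "f z (length w) = x" using less.prems(2) by simp
  then have "x \<in> range z" using marker_map_free[OF f less.prems(1)] by (metis rangeI)
  then obtain v s where v: "z = (v @ [x]) \<frown> s" "x \<notin> set v" "v \<in> words n" "s \<in> seqs n"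
    using split_at_first_marker[OF less.prems(1)] by blast
  obtain v' where v': "x \<notin> set v'" "f ((v @ [x]) \<frown> s) = (v' @ [x]) \<frown> f s"
    using marker_map_block[OF f v(3,2)] v(4) by blast
  have eq: "(w @ [x]) \<frown> y = (v' @ [x]) \<frown> f s" using less.prems(2) v(1) v'(2) by simp
  show ?case
  proof (cases "x \<in> set w")
    case False
    then have "f s = y" using first_marker_unique[OF eq _ v'(1)] by simp
    then show ?thesis by (rule bexI[OF _ v(4)])
  next
    case True
    then obtain w1 w2 where w: "w = w1 @ x # w2" "x \<notin> set w1" by (meson split_list_first)
    have "(w1 @ [x]) \<frown> ((w2 @ [x]) \<frown> y) = (v' @ [x]) \<frown> f s" using eq w(1) by simp
    note u = this
    have "f s = (w2 @ [x]) \<frown> y"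
      using first_marker_unique[OF u w(2) v'(1)] by simp
    then show ?thesis using less.hyps[of w2 s] w(1) v(4) by simp
  qed
qed

context
  fixes n x :: nat and f :: "nat word \<Rightarrow> nat word"
  assumes n: "n \<ge> 2" and x: "x < n" and m: "marker_map n x f" and inj: "inj_on f (seqs n)"
begin

lemma local_action_after_marker:
  assumes "v \<in> words n" "w \<in> words n"
  shows "local_action n f (v @ [x] @ w) = local_action n f w"
proof -
  obtain v' where v': "\<And>y. y \<in> seqs n \<Longrightarrow> f ((v @ [x]) \<frown> y) = (v' @ [x]) \<frown> f y"
    using marker_map_conc[OF m x assms(1)] by blast
  have "v @ [x] \<in> words n" using assms(1) x by simp
  from local_action_cone[OF n inj this assms(2) v'] show ?thesis by simp
qed

text \<open>
  If all images of the cone of \<open>v\<close> began with \<open>l x\<close>, then \<open>l\<close> would be the image of the block \<open>v\<close> as well as of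
  the longer block \<open>v a\<close> for a letter \<open>a\<close> other than \<open>x\<close>, contradicting injectivity.
\<close>
lemma lcp_marker_free:
  assumes v: "v \<in> words n" "x \<notin> set v"
  shows "x \<notin> set (lcp (f ` cyl n v))"
proof
  let ?L = "lcp (f ` cyl n v)" and ?y = "\<lambda>_::nat. x"
  assume "x \<in> set ?L"
  then obtain l1 l2 where l: "?L = l1 @ x # l2" "x \<notin> set l1" by (meson split_list_first)
  define a where "a = (if x = 0 then 1 else 0::nat)"
  have a: "a < n" "a \<noteq> x" using n by (auto simp: a_def)
  have y: "?y \<in> seqs n" using x by (rule const_seqs)
  have block: "f ((v @ u @ [x]) \<frown> ?y) = (l1 @ [x]) \<frown> f ?y" if u: "u \<in> words n" "x \<notin> set u" for u
  proof -
    obtain v' where v': "x \<notin> set v'" "f (((v @ u) @ [x]) \<frown> ?y) = (v' @ [x]) \<frown> f ?y"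
      using marker_map_block[OF m, of "v @ u"] u v y by fastforce
    have ux: "(u @ [x]) \<frown> ?y \<in> seqs n" by (rule conc_seqs[OF y]) (use u x in simp)
    have "f (v \<frown> ((u @ [x]) \<frown> ?y)) = ?L \<frown> local_action n f v ((u @ [x]) \<frown> ?y)"
      by (rule local_action_conc[OF n inj v(1) ux])
    then have u: "(l1 @ [x]) \<frown> (l2 \<frown> local_action n f v ((u @ [x]) \<frown> ?y)) = (v' @ [x]) \<frown> f ?y"
      using v'(2) l(1) by simp
    have "l1 = v'" using first_marker_unique[OF u l(2) v'(1)] by simp
    then show ?thesis using v'(2) by simp
  qed
  have "f ((v @ [x]) \<frown> ?y) = f ((v @ [a] @ [x]) \<frown> ?y)"
    using block[of "[]"] block[of "[a]"] a by simp
  moreover have "(v @ [x]) \<frown> ?y \<in> seqs n" "(v @ [a] @ [x]) \<frown> ?y \<in> seqs n"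
    by (rule conc_seqs[OF y], use v x a in simp)+
  ultimately have "(v @ [x]) \<frown> ?y = (v @ [a] @ [x]) \<frown> ?y" using inj_onD[OF inj] by blast
  then have "((v @ [x]) \<frown> ?y) (length v) = ((v @ [a] @ [x]) \<frown> ?y) (length v)" by simp
  then show False using a(2) by (simp add: nth_append)
qed

end

section \<open>Marker homeomorphisms and their cores\<close>

lemma marker_homeo_sym: "marker_homeo n x f g \<Longrightarrow> marker_homeo n x g f"
  using sync_homeo_sym by (auto simp: marker_homeo_def)

lemma marker_homeoD:
  assumes "marker_homeo n x f g"
  shows "sync_homeo n f g" "sync_map n f" "marker_map n x f" "clopen_embedding n f" "inj_on f (seqs n)"
    "f ` seqs n = seqs n" "f \<in> extensional (seqs n)" "lcp (f ` seqs n) = lcp (seqs n)"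
proof -
  show h: "sync_homeo n f g" "sync_map n f" "marker_map n x f" "f \<in> extensional (seqs n)"
    using assms by (auto simp: marker_homeo_def sync_homeo_def)
  show e: "clopen_embedding n f" "inj_on f (seqs n)"
    using h(2) clopen_embedding_inj by (auto simp: sync_map_def)
  show s: "f ` seqs n = seqs n"
    using sync_homeo_seqs[OF h(1)] h(1) unfolding sync_homeo_def by (metis image_eqI image_subsetI subsetI subset_antisym)
  then show "lcp (f ` seqs n) = lcp (seqs n)" by simp
qed

text \<open>
  Surjectivity enters here: the image of \<open>f\<close> has no common prefix.
\<close>
lemma local_action_marker_end:
  assumes n: "n \<ge> 2" and x: "x < n" and f: "marker_homeo n x f g" and v: "v \<in> words n"
  shows "local_action n f (v @ [x]) = f"
proof -
  have "local_action n f (v @ [x] @ []) = local_action n f []"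
    by (rule local_action_after_marker[OF n x marker_homeoD(3,5)[OF f] v]) simp
  also have "\<dots> = f"
    using local_action_complete[of f n] marker_homeoD(8)[OF f] lcp_seqs[OF n] marker_homeoD(7)[OF f]
    by (simp add: extensional_restrict)
  finally show ?thesis by simp
qed

lemma marker_homeo_in_core:
  assumes n: "n \<ge> 2" and x: "x < n" and f: "marker_homeo n x f g"
  shows "f \<in> core_maps n f"
  unfolding core_maps_def
proof (intro CollectI allI)
  fix k
  have "replicate k x \<in> words n" using x by (simp add: replicate_in_lists)
  then show "\<exists>\<nu>\<in>words n. k \<le> length \<nu> \<and> f = local_action n f \<nu>"
    using local_action_marker_end[OF n x f, of "replicate k x"] x
    by (intro bexI[of _ "replicate k x @ [x]"]) simp_all
qed

text \<open>
  Reading \<open>x\<close> leads to \<open>f\<close> from every state of the core of \<open>f\<close>. If the core has \<open>f'\<close> as such a target, too, then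
  \<open>f' = f\<close>.
\<close>
lemma marker_homeo_core_unique:
  assumes n: "n \<ge> 2" and x: "x < n" and f: "marker_homeo n x f g" and f': "marker_homeo n x f' g'"
    and eq: "core_of n f = core_of n f'"
  shows "f = f'"
proof -
  have "core_maps n f = core_maps n f'" using arg_cong[OF eq, of states] by simp
  then have "f' \<in> core_maps n f" using marker_homeo_in_core[OF n x f'] by simp
  then obtain \<nu> where \<nu>: "\<nu> \<in> words n" "f' = local_action n f \<nu>" unfolding core_maps_def by blast
  have "f' = local_action n f' ([] @ [x])" using local_action_marker_end[OF n x f', of "[]"] by simp
  also have "\<dots> = local_action n f (\<nu> @ [x])"
    using \<nu> local_action_append[OF n marker_homeoD(5)[OF f] \<nu>(1), of "[x]"] x by simp
  also have "\<dots> = f" by (rule local_action_marker_end[OF n x f \<nu>(1)])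
  finally show ?thesis ..
qed

lemma core_of_steps:
  assumes n: "n \<ge> 2" and h: "sync_map n h"
  shows "is_transducer n (core_of n h)"
    and "q \<in> core_maps n h \<Longrightarrow> w \<in> words n \<Longrightarrow> trans_word (core_of n h) w q = local_action n q w"
    and "q \<in> core_maps n h \<Longrightarrow> w \<in> words n \<Longrightarrow> out_word (core_of n h) w q = lcp (q ` cyl n w)"
    and "q \<in> core_maps n h \<Longrightarrow> induced n (core_of n h) q = q"
    and "strongly_synchronizing n (core_of n h)"
proof -
  obtain k where k: "clopen_embedding n h" "map_synchronizing_at n h k" using h by (auto simp: sync_map_def)
  note fam = core_maps_family[OF n k]
  show "is_transducer n (core_of n h)" by (rule is_transducer_map_transducer[OF fam])
  show "q \<in> core_maps n h \<Longrightarrow> w \<in> words n \<Longrightarrow> trans_word (core_of n h) w q = local_action n q w"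
    by (rule map_transducer_trans[OF fam])
  show "q \<in> core_maps n h \<Longrightarrow> w \<in> words n \<Longrightarrow> out_word (core_of n h) w q = lcp (q ` cyl n w)"
    by (rule map_transducer_out[OF fam])
  show "q \<in> core_maps n h \<Longrightarrow> induced n (core_of n h) q = q"
    by (rule induced_map_transducer[OF fam])
  show "strongly_synchronizing n (core_of n h)"
    using is_SO_core[OF n k] by (simp add: is_SO_def)
qed

lemma trailing_singleton: "x \<notin> set s \<Longrightarrow> trailing x (s @ [x]) = [x]"
  by (cases s rule: rev_cases) (auto simp: trailing_def)

text \<open>
  By lemma \<open>local_action_after_marker\<close> every state is a local action of \<open>f\<close> at a word \<open>v\<close> without \<open>x\<close>. Its
  output at \<open>u\<close> completes the longest common prefix of the cone of \<open>v\<close> to that of the cone of \<open>v u\<close>, which is free of \<open>x\<close> unless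
  \<open>u\<close> contains \<open>x\<close>, and which is the rewritten block followed by \<open>x\<close> if \<open>u = x\<close>.
\<close>
lemma Ox_condition_core:
  assumes n: "n \<ge> 2" and x: "x < n" and f: "marker_homeo n x f g"
  shows "Ox_condition n x (core_of n f)"
    and "q \<in> core_maps n f \<Longrightarrow> next_state (core_of n f) x q = f"
    and "q \<in> core_maps n f \<Longrightarrow> \<exists>w\<in>words n. outp (core_of n f) x q = w @ [x] \<and> x \<notin> set w"
proof -
  let ?T = "core_of n f"
  note fD = marker_homeoD[OF f]
  note tr = core_of_steps[OF n fD(2)]
  have state: "\<exists>v\<in>words n. x \<notin> set v \<and> q = local_action n f v" if q: "q \<in> core_maps n f" for q
  proof -
    obtain \<nu> where \<nu>: "\<nu> \<in> words n" "q = local_action n f \<nu>" using q unfolding core_maps_def by blast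
    show ?thesis
    proof (cases "x \<in> set \<nu>")
      case True
      then obtain u v where uv: "\<nu> = u @ x # v" "x \<notin> set v" by (meson split_list_last)
      then have "u \<in> words n" "v \<in> words n" using \<nu>(1) by auto
      then have "local_action n f (u @ [x] @ v) = local_action n f v"
        using local_action_after_marker[OF n x fD(3,5)] by blast
      then show ?thesis using uv \<nu> \<open>v \<in> words n\<close> by auto
    qed (use \<nu> in blast)
  qed
  have next_f: "next_state ?T x q = f" if q: "q \<in> core_maps n f" for q
  proof -
    obtain v where v: "v \<in> words n" "q = local_action n f v" using state[OF q] by blast
    have "next_state ?T x q = local_action n f (v @ [x])"
      using tr(2)[OF q, of "[x]"] local_action_append[OF n fD(5) v(1), of "[x]"] v(2) x by simp
    then show ?thesis using local_action_marker_end[OF n x f v(1)] by simp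
  qed
  then show "q \<in> core_maps n f \<Longrightarrow> next_state ?T x q = f" .
  have out_free: "x \<notin> set (out_word ?T u q)" if q: "q \<in> core_maps n f" and u: "u \<in> words n" "x \<notin> set u" for q u
  proof -
    obtain v where v: "v \<in> words n" "x \<notin> set v" "q = local_action n f v" using state[OF q] by blast
    have "lcp (f ` cyl n (v @ u)) = lcp (f ` cyl n v) @ out_word ?T u q"
      using lcp_append[OF n fD(5) v(1) u(1)] tr(3)[OF q u(1)] v(3) by simp
    moreover have "x \<notin> set (lcp (f ` cyl n (v @ u)))"
      by (rule lcp_marker_free[OF n x fD(3,5)]) (use u v in auto)
    ultimately show ?thesis by simp
  qed
  have out_x: "\<exists>w\<in>words n. outp ?T x q = w @ [x] \<and> x \<notin> set w" if q: "q \<in> core_maps n f" for q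
  proof -
    obtain v where v: "v \<in> words n" "x \<notin> set v" "q = local_action n f v" using state[OF q] by blast
    obtain v' where v': "v' \<in> words n" "x \<notin> set v'" "\<And>y. y \<in> seqs n \<Longrightarrow> f ((v @ [x]) \<frown> y) = (v' @ [x]) \<frown> f y"
      using marker_map_block[OF fD(3) v(1,2)] by blast
    have vx: "v @ [x] \<in> words n" using v(1) x by simp
    have "lcp (f ` cyl n ((v @ [x]) @ [])) = (v' @ [x]) @ lcp (f ` cyl n [])"
      by (rule lcp_cone[OF n fD(5) vx _ v'(3)]) simp_all
    then have "lcp (f ` cyl n (v @ [x])) = v' @ [x]"
      using fD(8) lcp_seqs[OF n] by (simp add: cyl_Nil)
    moreover have "lcp (f ` cyl n (v @ [x])) = lcp (f ` cyl n v) @ outp ?T x q"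
      using lcp_append[OF n fD(5) v(1), of "[x]"] tr(3)[OF q, of "[x]"] v(3) x by simp
    ultimately have eq: "lcp (f ` cyl n v) @ outp ?T x q = v' @ [x]" by simp
    have fr: "x \<notin> set (lcp (f ` cyl n v))" by (rule lcp_marker_free[OF n x fD(3,5) v(1,2)])
    have "outp ?T x q \<noteq> []" using eq fr by (metis append_Nil2 in_set_conv_decomp)
    then obtain w b where w: "outp ?T x q = w @ [b]" by (metis rev_exhaust)
    then have "v' = lcp (f ` cyl n v) @ w" "b = x" using eq by (metis append_assoc append1_eq_conv)+
    then show ?thesis using w v' by auto
  qed
  then show "q \<in> core_maps n f \<Longrightarrow> \<exists>w\<in>words n. outp ?T x q = w @ [x] \<and> x \<notin> set w" .
  show "Ox_condition n x ?T"
    unfolding Ox_condition_def states_map_transducer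
  proof (intro conjI ballI impI)
    show "\<exists>q\<^sub>x\<in>core_maps n f. \<forall>q\<in>core_maps n f. next_state ?T x q = q\<^sub>x"
      using next_f marker_homeo_in_core[OF n x f] by blast
    fix u q assume u: "u \<in> words n" and q: "q \<in> core_maps n f" and xo: "x \<in> set (out_word ?T u q)"
    then have "x \<in> set u" using out_free by blast
    then obtain u1 u2 where u12: "u = u1 @ x # u2" "x \<notin> set u1" by (meson split_list_first)
    have u1: "u1 \<in> words n" using u u12(1) by simp
    have q': "trans_word ?T u1 q \<in> core_maps n f"
      using trans_word_states[OF tr(1) _ u1, of q] q by simp
    obtain w where w: "outp ?T x (trans_word ?T u1 q) = w @ [x]" "x \<notin> set w" using out_x[OF q'] by blast
    have f1: "x \<notin> set (out_word ?T u1 q)" by (rule out_free[OF q u1 u12(2)])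
    have "trailing x (out_word ?T (u1 @ [x]) q) = [x]"
      using trailing_singleton[of x "out_word ?T u1 q @ w"] w f1 by (simp add: out_word_append)
    then show "\<exists>u\<^sub>1 u\<^sub>2. u = u\<^sub>1 @ [x] @ u\<^sub>2 \<and> x \<notin> set u\<^sub>1 \<and> x \<notin> set (out_word ?T u\<^sub>1 q) \<and>
        trailing x (out_word ?T (u\<^sub>1 @ [x]) q) = [x]"
      using u12 f1 by (intro exI[of _ u1] exI[of _ u2]) simp
  qed (use out_x in blast)
qed

lemma Ox_state_marker_map:
  assumes n: "n \<ge> 2" and x: "x < n" and T: "is_transducer n T" and Ox: "Ox_condition n x T"
    and q: "q \<in> states T" "\<And>p. p \<in> states T \<Longrightarrow> next_state T x p = q"
  shows "marker_map n x (induced n T q)"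
proof -
  have free: "x \<notin> set (out_word T u p)" if "u \<in> words n" "p \<in> states T" "x \<notin> set u" for u p
    using Ox that unfolding Ox_condition_def by (metis in_set_conv_decomp append_Cons append_Nil)
  show ?thesis
    unfolding marker_map_def
  proof (intro conjI ballI impI)
    fix w assume w: "w \<in> words n" "x \<notin> set w"
    let ?p = "trans_word T w q"
    have p: "?p \<in> states T" by (rule trans_word_states[OF T q(1) w(1)])
    obtain v where v: "v \<in> words n" "outp T x ?p = v @ [x]" "x \<notin> set v"
      using Ox p unfolding Ox_condition_def by blast
    have wx: "w @ [x] \<in> words n" using w x by simp
    have tx: "trans_word T (w @ [x]) q = q" using q(2)[OF p] by simp
    have ox: "out_word T (w @ [x]) q = (out_word T w q @ v) @ [x]" using v(2) by (simp add: out_word_append)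
    have "induced n T q ((w @ [x]) \<frown> y) = ((out_word T w q @ v) @ [x]) \<frown> induced n T q y" if "y \<in> seqs n" for y
      using induced_conc_word[OF T q(1) wx that] unfolding tx ox .
    then show "\<exists>w'\<in>words n. x \<notin> set w' \<and>
        (\<forall>y\<in>seqs n. induced n T q ((w @ [x]) \<frown> y) = (w' @ [x]) \<frown> induced n T q y)"
      using out_word_words[OF T q(1) w(1)] v free[OF w(1) q(1) w(2)]
      by (intro bexI[of _ "out_word T w q @ v"]) simp_all
  next
    fix z assume z: "z \<in> seqs n" "x \<notin> range z"
    show "x \<notin> range (induced n T q z)"
    proof
      assume "x \<in> range (induced n T q z)"
      then obtain i where i: "induced n T q z i = x" by blast
      obtain k where k: "Suc i \<le> length (out_word T (prefix k z) q)"
        using out_word_unbounded[OF T q(1) z(1)] by blast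
      obtain t where "induced n T q z = out_word T (prefix k z) q \<frown> t"
        using induced_prefix[OF T q(1) z(1)] by blast
      then have "x \<in> set (out_word T (prefix k z) q)" using k i by auto
      moreover have "x \<notin> set (prefix k z)" using z(2) by auto
      ultimately show False using free[OF prefix_words[OF z(1)] q(1)] by blast
    qed
  qed
qed

text \<open>
  Let \<open>core_of n g0\<close> be the inverse of \<open>T\<close>. Then \<open>f \<circ> g0\<close> has a trivial core, so on some cone it only
  changes the prefix: \<open>f (g0 (\<nu> y)) = w y\<close>. Taking \<open>y\<close> behind a marker shows that \<open>f\<close> is surjective, by
  lemma \<open>marker_map_after_marker\<close>. The same identity relates the local actions of the inverse \<open>g\<close> of \<open>f\<close> to
  those of \<open>g0\<close>: as \<open>g\<close> starts afresh behind markers, its local action at \<open>\<kappa>\<close> is that at \<open>w x \<kappa>\<close>, and this is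
  the local action of \<open>g0\<close> at \<open>\<nu> x \<kappa>\<close>. So \<open>g\<close> is synchronizing because \<open>g0\<close> is.
\<close>
lemma Ox_member_marker_homeo:
  assumes n: "n \<ge> 2" and x: "x < n" and T: "T \<in> carrier (O_group n)" and Ox: "Ox_condition n x T"
  shows "\<exists>f g. marker_homeo n x f g \<and> T = core_of n f"
proof -
  have TS: "T \<in> carrier (SO n)" using T by (auto simp: O_group_def units_of_def Units_def)
  obtain U where U: "U \<in> carrier (SO n)" "U \<otimes>\<^bsub>SO n\<^esub> T = \<one>\<^bsub>SO n\<^esub>"
    using T by (auto simp: O_group_def units_of_def Units_def)
  have tr: "is_transducer n T" using TS by (simp add: SO_def is_SO_def)
  obtain f where f: "f \<in> states T" "\<And>p. p \<in> states T \<Longrightarrow> next_state T x p = f"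
    using Ox unfolding Ox_condition_def by blast
  note fS = SO_carrier_state[OF n TS f(1)]
  have mf: "marker_map n x f" using Ox_state_marker_map[OF n x tr Ox f] fS(3) by simp
  have ef: "clopen_embedding n f" using fS(1) by (simp add: sync_map_def)
  obtain g0 where g0: "U = core_of n g0" "sync_map n g0" using U(1) unfolding SO_carrier[OF n] by blast
  obtain l where l: "clopen_embedding n g0" "map_synchronizing_at n g0 l" using g0(2) by (auto simp: sync_map_def)
  have fg0: "sync_map n (f \<circ> g0)" by (rule core_product(1)[OF n g0(2) fS(1)])
  have eq: "core_of n (f \<circ> g0) = core_of n id"
    using mult_SO[OF n g0(2) fS(1)] U(2) g0(1) fS(4) one_SO[OF n] by simp
  have "core_maps n (f \<circ> g0) = {restrict id (seqs n)}"
    using arg_cong[OF eq, of states] unfolding states_map_transducer core_maps_id[OF n] .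
  then have "restrict id (seqs n) \<in> core_maps n (f \<circ> g0)" by simp
  then obtain \<nu> where \<nu>: "\<nu> \<in> words n" "restrict id (seqs n) = local_action n (f \<circ> g0) \<nu>"
    unfolding core_maps_def by blast
  let ?w = "lcp ((f \<circ> g0) ` cyl n \<nu>)"
  have e0: "clopen_embedding n (f \<circ> g0)" using fg0 by (simp add: sync_map_def)
  have w: "?w \<in> words n" by (rule lcp_words[OF n clopen_embedding_inj[OF e0] clopen_embedding_into[OF e0] \<nu>(1)])
  have cone: "f (g0 (\<nu> \<frown> y)) = ?w \<frown> y" if y: "y \<in> seqs n" for y
    using local_action_conc[OF n clopen_embedding_inj[OF e0] \<nu>(1) y] y unfolding \<nu>(2)[symmetric] by simp
  have surj: "\<exists>z\<in>seqs n. f z = y" if y: "y \<in> seqs n" for y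
  proof -
    have xy: "[x] \<frown> y \<in> seqs n" by (rule conc_seqs[OF y]) (use x in simp)
    have "g0 (\<nu> \<frown> ([x] \<frown> y)) \<in> seqs n" using clopen_embedding_into[OF l(1)] conc_seqs[OF xy \<nu>(1)] by blast
    moreover have "f (g0 (\<nu> \<frown> ([x] \<frown> y))) = (?w @ [x]) \<frown> y" using cone[OF xy] by simp
    ultimately show ?thesis by (intro marker_map_after_marker[OF mf x _ y])
  qed
  have im: "f ` seqs n = seqs n" using surj clopen_embedding_into[OF ef] by blast
  have "homeomorphic_map (cantor n) (cantor n) f"
    using ef im by (intro bijective_open_imp_homeomorphic_map) (auto simp: clopen_embedding_def topspace_cantor)
  then obtain g' where g': "homeomorphic_maps (cantor n) (cantor n) f g'"
    unfolding homeomorphic_map_maps by blast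
  define g where "g = restrict g' (seqs n)"
  have gf: "g (f s) = s" "f (g s) = s" if "s \<in> seqs n" for s
    using g' that clopen_embedding_into[OF ef] unfolding homeomorphic_maps_def topspace_cantor g_def by auto
  have eg: "clopen_embedding n g"
    by (rule clopen_embedding_cong[OF homeomorphic_clopen_embedding[OF g'[THEN homeomorphic_maps_sym[THEN iffD1]]]])
       (simp add: g_def)
  have mg: "marker_map n x g" by (rule marker_map_inverse[OF mf x gf clopen_embedding_into[OF eg]])
  note ig = clopen_embedding_inj[OF eg] and i0 = clopen_embedding_inj[OF l(1)]
  have g_cone: "g (?w \<frown> y) = lcp (g0 ` cyl n \<nu>) \<frown> local_action n g0 \<nu> y" if y: "y \<in> seqs n" for y
  proof -
    have "g (f (g0 (\<nu> \<frown> y))) = g0 (\<nu> \<frown> y)"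
      using gf(1) clopen_embedding_into[OF l(1)] conc_seqs[OF y \<nu>(1)] by blast
    then show ?thesis using cone[OF y] local_action_conc[OF n i0 \<nu>(1) y] by simp
  qed
  have g_local: "local_action n g \<kappa> = local_action n g0 (\<nu> @ [x] @ \<kappa>)" if \<kappa>: "\<kappa> \<in> words n" for \<kappa>
  proof -
    have x\<kappa>: "[x] @ \<kappa> \<in> words n" using \<kappa> x by simp
    have "local_action n g \<kappa> = local_action n g (?w @ [x] @ \<kappa>)"
      using local_action_after_marker[OF n x mg ig w \<kappa>] by simp
    also have "\<dots> = local_action n (local_action n g0 \<nu>) ([x] @ \<kappa>)"
      by (rule local_action_cone[OF n ig w x\<kappa> g_cone])
    also have "\<dots> = local_action n g0 (\<nu> @ [x] @ \<kappa>)"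
      using local_action_append[OF n i0 \<nu>(1) x\<kappa>] by simp
    finally show ?thesis .
  qed
  have "map_synchronizing_at n g l"
    unfolding map_synchronizing_at_def
  proof (intro ballI impI)
    fix u u' \<kappa> assume u: "u \<in> words n" "u' \<in> words n" and \<kappa>: "\<kappa> \<in> words n" "length \<kappa> = l"
    have "local_action n g (v @ \<kappa>) = local_action n g0 \<kappa>" if "v \<in> words n" for v
      using g_local[of "v @ \<kappa>"] map_synchronizing_local_action[OF n l(2), of "\<nu> @ [x] @ v" \<kappa>] that \<kappa> \<nu>(1) x
      by simp
    then show "local_action n g (u @ \<kappa>) = local_action n g (u' @ \<kappa>)" using u by simp
  qed
  then have "sync_homeo n f g"
    using fS(1) eg gf by (auto simp: sync_homeo_def sync_map_def)
  moreover have "g \<in> extensional (seqs n)" by (simp add: g_def)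
  ultimately have "marker_homeo n x f g" using mf mg fS(2) by (simp add: marker_homeo_def)
  then show ?thesis using fS(4) by blast
qed

lemma Ox_carrier:
  assumes n: "n \<ge> 2" and x: "x < n"
  shows "carrier (Ox_group n x) = {core_of n f | f g. marker_homeo n x f g}"
proof (intro equalityI subsetI)
  fix T assume "T \<in> carrier (Ox_group n x)"
  then show "T \<in> {core_of n f | f g. marker_homeo n x f g}"
    using Ox_member_marker_homeo[OF n x, of T] unfolding Ox_group_def by auto
next
  fix T assume "T \<in> {core_of n f | f g. marker_homeo n x f g}"
  then obtain f g where f: "T = core_of n f" "marker_homeo n x f g" by blast
  show "T \<in> carrier (Ox_group n x)"
    unfolding f(1) Ox_group_def
    using Ox_condition_core(1)[OF n x f(2)] core_in_O[OF n marker_homeoD(1)[OF f(2)]] by simp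
qed

lemma sync_map_cong:
  assumes n: "n \<ge> 2" and h: "sync_map n h" and eq: "\<And>y. y \<in> seqs n \<Longrightarrow> h y = g y"
  shows "sync_map n g"
proof -
  have "local_action n h \<nu> = local_action n g \<nu>" if "\<nu> \<in> words n" for \<nu>
    by (rule local_action_cong(1)[OF eq that])
  then show ?thesis
    using h clopen_embedding_cong[of n h g] eq unfolding sync_map_def map_synchronizing_at_def by auto
qed

lemma marker_homeo_restrict:
  assumes n: "n \<ge> 2" and x: "x < n" and h: "sync_homeo n h k" and m: "marker_map n x h" "marker_map n x k"
  shows "marker_homeo n x (restrict h (seqs n)) (restrict k (seqs n))"
proof -
  have "sync_map n (restrict h (seqs n))" "sync_map n (restrict k (seqs n))"
    using h sync_map_cong[OF n, of h "restrict h (seqs n)"] sync_map_cong[OF n, of k "restrict k (seqs n)"]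
    by (auto simp: sync_homeo_def)
  moreover have "marker_map n x (restrict h (seqs n))" "marker_map n x (restrict k (seqs n))"
    using marker_map_cong[OF m(1) x, of "restrict h (seqs n)"] marker_map_cong[OF m(2) x, of "restrict k (seqs n)"]
    by auto
  ultimately show ?thesis
    using h sync_homeo_seqs[OF h] by (simp add: marker_homeo_def sync_homeo_def)
qed

lemma marker_homeo_comp:
  assumes n: "n \<ge> 2" and x: "x < n" and f: "marker_homeo n x f g" and f': "marker_homeo n x f' g'"
  shows "marker_homeo n x (restrict (f' \<circ> f) (seqs n)) (restrict (g \<circ> g') (seqs n))"
proof (rule marker_homeo_restrict[OF n x])
  note fD = marker_homeoD[OF f] marker_homeoD[OF marker_homeo_sym[OF f]]
    and fD' = marker_homeoD[OF f'] marker_homeoD[OF marker_homeo_sym[OF f']]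
  show "sync_homeo n (f' \<circ> f) (g \<circ> g')" by (rule sync_homeo_comp[OF n fD(1) fD'(1)])
  show "marker_map n x (f' \<circ> f)" using fD fD' by (intro marker_map_comp) auto
  show "marker_map n x (g \<circ> g')" using fD fD' by (intro marker_map_comp) auto
qed

lemma marker_homeo_id:
  assumes n: "n \<ge> 2" and x: "x < n"
  shows "marker_homeo n x (restrict id (seqs n)) (restrict id (seqs n))"
  by (rule marker_homeo_restrict[OF n x sync_homeo_id[OF n]]) (auto simp: marker_map_def)

section \<open>Non-overlapping codes\<close>

text \<open>
  The last assumption forbids that a proper suffix of a codeword is a prefix of a codeword. For words of
  equal length this means that different occurrences of codewords in a sequence are disjoint.
\<close>
locale nonoverlapping_code =
  fixes n m L :: nat and c :: "nat \<Rightarrow> nat list"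
  assumes m: "m \<ge> 2" and L: "0 < L"
    and code_words: "a < n \<Longrightarrow> c a \<in> words m"
    and code_length: "a < n \<Longrightarrow> length (c a) = L"
    and code_inj: "inj_on c {..<n}"
    and code_overlap: "a < n \<Longrightarrow> b < n \<Longrightarrow> 0 < i \<Longrightarrow> i < L \<Longrightarrow> take (L - i) (c b) \<noteq> drop i (c a)"

text \<open>
  The codeword of \<open>a\<close> is \<open>0 0 1\<^sup>a\<^sup>+\<^sup>1 0 1\<^sup>n\<^sup>-\<^sup>a\<close>. It contains \<open>0 0\<close> at its beginning only and ends in \<open>1\<close>, so no
  proper suffix is the beginning of a codeword.
\<close>
lemma nonoverlapping_code_exists:
  assumes "m \<ge> 2"
  shows "nonoverlapping_code n m (n + 4) (\<lambda>a. map (\<lambda>j. if j < 2 \<or> j = a + 3 then 0 else 1) [0..<n + 4])"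
    (is "nonoverlapping_code n m ?L ?c")
proof
  have nth: "?c a ! j = (if j < 2 \<or> j = a + 3 then 0 else 1)" if "j < ?L" for a j
    using that by simp
  show "?c a \<in> words m" if "a < n" for a
    using assms by (auto simp: in_lists_conv_set)
  show "inj_on ?c {..<n}"
  proof (rule inj_onI)
    fix a b assume ab: "a \<in> {..<n}" "b \<in> {..<n}" "?c a = ?c b"
    have "a + 3 < ?L" using ab(1) by simp
    then show "a = b" using nth[of "a + 3" a] nth[of "a + 3" b] unfolding ab(3) by (auto split: if_splits)
  qed
  fix a b i assume ab: "a < n" "b < n" and i: "0 < i" "i < ?L"
  show "take (?L - i) (?c b) \<noteq> drop i (?c a)"
  proof
    assume eq: "take (?L - i) (?c b) = drop i (?c a)"
    have *: "?c b ! j = ?c a ! (i + j)" if "j < ?L - i" for j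
      using arg_cong[OF eq, where f = "\<lambda>l. l ! j"] that by simp
    show False
    proof (cases "i = ?L - 1")
      case True
      then show False using *[of 0] ab nth[of 0 b] nth[of i a] by (simp split: if_splits)
    next
      case False
      then have "?c a ! i = 0" "?c a ! Suc i = 0" "Suc i < ?L"
        using *[of 0] *[of 1] i nth[of 0 b] nth[of 1 b] by simp_all
      then show False using nth[of i a] nth[of "Suc i" a] i(1) by (simp split: if_splits)
    qed
  qed
qed (use assms in auto)

context nonoverlapping_code
begin

definition enc :: "nat list \<Rightarrow> nat list"
  where "enc w = concat (map c w)"

definition encw :: "nat word \<Rightarrow> nat word"
  where "encw z = (\<lambda>i. c (z (i div L)) ! (i mod L))"

abbreviation "codewords \<equiv> c ` {..<n}"

definition dec :: "nat list \<Rightarrow> nat"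
  where "dec = inv_into {..<n} c"

lemma dec_code: "a < n \<Longrightarrow> dec (c a) = a"
  using code_inj by (simp add: dec_def)

lemma enc_simps [simp]: "enc [] = []" "enc (a # w) = c a @ enc w" "enc (v @ w) = enc v @ enc w"
  by (simp_all add: enc_def)

lemma enc_words: "w \<in> words n \<Longrightarrow> enc w \<in> words m"
  by (induction w) (simp_all add: code_words)

lemma length_enc: "w \<in> words n \<Longrightarrow> length (enc w) = length w * L"
  by (induction w) (simp_all add: code_length)

lemma encw_Cons: "a < n \<Longrightarrow> encw ([a] \<frown> z) = c a \<frown> encw z"
proof
  fix i assume a: "a < n"
  show "encw ([a] \<frown> z) i = (c a \<frown> encw z) i"
  proof (cases "i < L")
    case True
    then show ?thesis using code_length[OF a] by (simp add: encw_def)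
  next
    case False
    then have "i div L = Suc ((i - L) div L)" "i mod L = (i - L) mod L"
      using L by (simp_all add: le_div_geq le_mod_geq)
    then show ?thesis using False code_length[OF a] by (simp add: encw_def)
  qed
qed

lemma encw_conc: "w \<in> words n \<Longrightarrow> encw (w \<frown> z) = enc w \<frown> encw z"
proof (induction w)
  case (Cons a w)
  then have "encw ([a] \<frown> (w \<frown> z)) = c a \<frown> (enc w \<frown> encw z)"
    using encw_Cons[of a "w \<frown> z"] by (simp del: conc_conc)
  then show ?case by simp
qed simp

lemma prefix_encw:
  assumes z: "z \<in> seqs n" shows "prefix (j * L) (encw z) = enc (prefix j z)"
proof -
  have "encw (prefix j z \<frown> suffix j z) = enc (prefix j z) \<frown> encw (suffix j z)"
    by (rule encw_conc[OF prefix_words[OF z]])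
  then show ?thesis using length_enc[OF prefix_words[OF z], of j] by (metis prefix_conc_length prefix_suffix subsequence_length diff_zero)
qed

lemma encw_seqs: assumes z: "z \<in> seqs n" shows "encw z \<in> seqs m"
  unfolding seqs_def
proof (intro CollectI allI)
  fix i
  have a: "z (i div L) < n" using z by (simp add: seqs_def)
  have "c (z (i div L)) ! (i mod L) \<in> set (c (z (i div L)))"
    using code_length[OF a] L by simp
  then show "encw z i < m"
    using code_words[OF a] unfolding encw_def by (auto simp: in_lists_conv_set)
qed

lemma encw_inj:
  assumes "y \<in> seqs n" "z \<in> seqs n" "encw y = encw z" shows "y = z"
proof
  fix j
  have yz: "y j < n" "z j < n" using assms by (simp_all add: seqs_def)
  have "c (y j) ! i = c (z j) ! i" if "i < L" for i
    using fun_cong[OF assms(3), of "j * L + i"] that by (simp add: encw_def)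
  then have "c (y j) = c (z j)" using code_length yz by (intro nth_equalityI) auto
  then show "y j = z j" using code_inj yz by (simp add: inj_on_def)
qed

text \<open>
  Cut off codewords from the beginning as long as possible.
\<close>
lemma parse:
  assumes s: "s \<in> seqs m"
  shows "(\<exists>z\<in>seqs n. s = encw z) \<or>
    (\<exists>v\<in>words n. \<exists>r\<in>seqs m. s = enc v \<frown> r \<and> prefix L r \<notin> codewords)"
proof (cases "\<forall>j. prefix L (suffix (j * L) s) \<in> codewords")
  case True
  define z where "z j = dec (prefix L (suffix (j * L) s))" for j
  have z: "z j < n \<and> c (z j) = prefix L (suffix (j * L) s)" for j
  proof -
    obtain a where "a < n" "prefix L (suffix (j * L) s) = c a" using True by blast
    then show ?thesis by (simp add: z_def dec_code)
  qed
  have "s = encw z"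
  proof
    fix i
    have "c (z (i div L)) ! (i mod L) = s (i div L * L + i mod L)"
      using z L by simp
    then show "s i = encw z i" by (simp add: encw_def)
  qed
  moreover have "z \<in> seqs n" using z by (simp add: seqs_def)
  ultimately show ?thesis by blast
next
  case False
  define j where "j = (LEAST j. prefix L (suffix (j * L) s) \<notin> codewords)"
  have j: "prefix L (suffix (j * L) s) \<notin> codewords" "\<And>i. i < j \<Longrightarrow> prefix L (suffix (i * L) s) \<in> codewords"
    using False LeastI_ex[of "\<lambda>j. prefix L (suffix (j * L) s) \<notin> codewords"]
      not_less_Least[of _ "\<lambda>j. prefix L (suffix (j * L) s) \<notin> codewords"] unfolding j_def by blast+
  have "\<exists>v\<in>words n. s = enc v \<frown> suffix (i * L) s" if "i \<le> j" for i
    using that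
  proof (induction i)
    case 0
    then show ?case by (intro bexI[of _ "[]"]) simp_all
  next
    case (Suc i)
    have "i \<le> j" using Suc.prems by simp
    from Suc.IH[OF this] obtain v where v: "v \<in> words n" "s = enc v \<frown> suffix (i * L) s" by blast
    obtain a where a: "a < n" "prefix L (suffix (i * L) s) = c a" using j(2)[of i] Suc.prems by auto
    have "suffix (i * L) s = prefix L (suffix (i * L) s) \<frown> suffix L (suffix (i * L) s)"
      by (rule prefix_suffix)
    also have "\<dots> = c a \<frown> suffix (Suc i * L) s" unfolding a(2) by (simp add: add.commute)
    finally have e: "suffix (i * L) s = c a \<frown> suffix (Suc i * L) s" .
    have "s = enc (v @ [a]) \<frown> suffix (Suc i * L) s"
      using v(2) unfolding e by (simp only: enc_simps append_Nil2 conc_conc)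
    moreover have "v @ [a] \<in> words n" using v(1) a(1) by simp
    ultimately show ?case by (rule bexI)
  qed
  from this[OF order_refl] obtain v where "v \<in> words n" "s = enc v \<frown> suffix (j * L) s" by blast
  then show ?thesis using j(1) suffix_seqs[OF s] by blast
qed

lemma parse_finite:
  assumes "\<rho> \<in> words m" "(k + 1) * L \<le> length \<rho>"
  shows "(\<exists>v\<in>words n. \<exists>r. length v = k \<and> \<rho> = enc v @ r) \<or>
    (\<exists>v\<in>words n. \<exists>r. \<rho> = enc v @ r \<and> L \<le> length r \<and> take L r \<notin> codewords)"
  using assms
proof (induction k arbitrary: \<rho>)
  case 0
  then show ?case by (intro disjI1 bexI[of _ "[]"]) auto
next
  case (Suc k)
  show ?case
  proof (cases "take L \<rho> \<in> codewords")
    case False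
    then show ?thesis using Suc.prems by (intro disjI2 bexI[of _ "[]"]) auto
  next
    case True
    then obtain a where a: "a < n" "take L \<rho> = c a" by blast
    then have \<rho>: "\<rho> = c a @ drop L \<rho>" by (metis append_take_drop_id)
    have d: "drop L \<rho> \<in> words m" using Suc.prems(1) \<rho> by (metis append_in_lists_conv)
    have "(k + 1) * L \<le> length (drop L \<rho>)" using Suc.prems(2) by simp
    from Suc.IH[OF d this] show ?thesis
    proof (elim disjE bexE exE conjE)
      fix v r assume "v \<in> words n" "length v = k" "drop L \<rho> = enc v @ r"
      then have "a # v \<in> words n" "length (a # v) = Suc k" "\<rho> = enc (a # v) @ r" using a(1) \<rho> by simp_all
      then show ?thesis by blast
    next
      fix v r assume "v \<in> words n" "drop L \<rho> = enc v @ r" "L \<le> length r" "take L r \<notin> codewords"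
      moreover from this have "a # v \<in> words n" "\<rho> = enc (a # v) @ r" using a(1) \<rho> by simp_all
      ultimately show ?thesis by blast
    qed
  qed
qed

section \<open>Lifting a transducer along a code\<close>

text \<open>
  The lift of \<open>T\<close> has a mode and a buffer. In mode \<open>None\<close> it is outside of runs; in mode \<open>Some q\<close> it is inside of a run, and \<open>T\<close>
  is in state \<open>q\<close>. The buffer holds back fewer than \<open>L\<close> letters, until it is known whether a codeword
  begins at the first of them. If a codeword for \<open>a\<close> is found, it is consumed as a whole: \<open>emit\<close> and
  \<open>enter\<close> give the output and the new state of \<open>T\<close>. The first codeword of a run is copied and puts \<open>T\<close> into the state
  \<open>q\<^sub>0\<close>. If no codeword begins there, then only the first letter is released, and a run that ends here is first
  completed by \<open>flush\<close>: by the output that \<open>T\<close> would give at the marker \<open>x\<close>, without its last letter \<open>x\<close>.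
\<close>
definition enter :: "'q transducer \<Rightarrow> 'q \<Rightarrow> 'q option \<Rightarrow> nat \<Rightarrow> 'q"
  where "enter T q\<^sub>0 \<mu> a = (case \<mu> of None \<Rightarrow> q\<^sub>0 | Some q \<Rightarrow> next_state T a q)"

definition emit :: "'q transducer \<Rightarrow> 'q option \<Rightarrow> nat \<Rightarrow> nat list"
  where "emit T \<mu> a = (case \<mu> of None \<Rightarrow> c a | Some q \<Rightarrow> enc (outp T a q))"

definition flush :: "nat \<Rightarrow> 'q transducer \<Rightarrow> 'q option \<Rightarrow> nat list"
  where "flush x T \<mu> = (case \<mu> of None \<Rightarrow> [] | Some q \<Rightarrow> enc (butlast (outp T x q)))"

definition lift :: "nat \<Rightarrow> 'q transducer \<Rightarrow> 'q \<Rightarrow> ('q option \<times> nat list) transducer"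
  where "lift x T q\<^sub>0 =
    \<lparr>states = insert None (Some ` states T) \<times> {b \<in> words m. length b < L},
     next_state = (\<lambda>a (\<mu>, b).
       if length (b @ [a]) < L then (\<mu>, b @ [a])
       else if b @ [a] \<in> codewords then (Some (enter T q\<^sub>0 \<mu> (dec (b @ [a]))), [])
       else (None, tl (b @ [a]))),
     outp = (\<lambda>a (\<mu>, b).
       if length (b @ [a]) < L then []
       else if b @ [a] \<in> codewords then emit T \<mu> (dec (b @ [a]))
       else flush x T \<mu> @ [hd (b @ [a])])\<rparr>"

context
  fixes x :: nat and T :: "'q transducer" and q\<^sub>0 :: 'q
  assumes x: "x < n" and T: "is_transducer n T" and q\<^sub>0: "q\<^sub>0 \<in> states T"
begin

abbreviation (input) "modes \<equiv> insert None (Some ` states T)"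
abbreviation (input) "M \<equiv> lift x T q\<^sub>0"

lemma lift_states: "states M = modes \<times> {b \<in> words m. length b < L}"
  by (simp add: lift_def)

lemma lift_short:
  assumes "length u < L"
  shows "trans_word M u (\<mu>, []) = (\<mu>, u)" "out_word M u (\<mu>, []) = []"
proof -
  have "trans_word M u (\<mu>, []) = (\<mu>, u) \<and> out_word M u (\<mu>, []) = []"
    using assms by (induction u rule: rev_induct) (simp_all add: out_word_append lift_def)
  then show "trans_word M u (\<mu>, []) = (\<mu>, u)" "out_word M u (\<mu>, []) = []" by auto
qed

lemma lift_block:
  assumes "length u = L"
  shows "trans_word M u (\<mu>, []) =
      (if u \<in> codewords then (Some (enter T q\<^sub>0 \<mu> (dec u)), []) else (None, tl u))"
    "out_word M u (\<mu>, []) = (if u \<in> codewords then emit T \<mu> (dec u) else flush x T \<mu> @ [hd u])"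
proof -
  obtain v a where u: "u = v @ [a]" using assms L by (metis length_greater_0_conv rev_exhaust)
  then have v: "length v < L" "Suc (length v) = L" using assms by auto
  show "trans_word M u (\<mu>, []) =
      (if u \<in> codewords then (Some (enter T q\<^sub>0 \<mu> (dec u)), []) else (None, tl u))"
    "out_word M u (\<mu>, []) = (if u \<in> codewords then emit T \<mu> (dec u) else flush x T \<mu> @ [hd u])"
    unfolding u using lift_short[OF v(1), of \<mu>] v(2) by (simp_all add: out_word_append lift_def)
qed

lemma lift_code:
  assumes "a < n"
  shows "trans_word M (c a) (\<mu>, []) = (Some (enter T q\<^sub>0 \<mu> a), [])" "out_word M (c a) (\<mu>, []) = emit T \<mu> a"
  using lift_block[OF code_length[OF assms]] assms by (simp_all add: dec_code)

lemma lift_enc: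
  assumes "v \<in> words n"
  shows "trans_word M (enc v) (Some q, []) = (Some (trans_word T v q), [])"
    "out_word M (enc v) (Some q, []) = enc (out_word T v q)"
proof -
  have "trans_word M (enc v) (Some q, []) = (Some (trans_word T v q), []) \<and>
      out_word M (enc v) (Some q, []) = enc (out_word T v q)"
    using assms by (induction v arbitrary: q) (simp_all add: out_word_append lift_code enter_def emit_def)
  then show "trans_word M (enc v) (Some q, []) = (Some (trans_word T v q), [])"
    "out_word M (enc v) (Some q, []) = enc (out_word T v q)" by auto
qed

lemma enter_state: "\<mu> \<in> modes \<Longrightarrow> a < n \<Longrightarrow> enter T q\<^sub>0 \<mu> a \<in> states T"
  using T q\<^sub>0 by (auto simp: enter_def is_transducer_def)

text \<open>
  Breaks release a letter at once. An infinite run is the code of some \<open>z\<close>, and \<open>T\<close> has infinite output at \<open>z\<close>.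
\<close>
lemma lift_nonempty_output:
  assumes \<mu>: "\<mu> \<in> modes" and s: "s \<in> seqs m"
  shows "\<exists>k. out_word M (prefix k s) (\<mu>, []) \<noteq> []"
  using parse[OF s]
proof (elim disjE bexE conjE)
  fix z assume z: "z \<in> seqs n" and sz: "s = encw z"
  show ?thesis
  proof (cases \<mu>)
    case None
    have a: "z 0 < n" using z by (simp add: seqs_def)
    have "prefix (1 * L) s = enc (prefix 1 z)" using prefix_encw[OF z, of 1] sz by simp
    then have "out_word M (prefix L s) (\<mu>, []) = c (z 0)"
      using lift_code(2)[OF a] None by (simp add: emit_def)
    then show ?thesis using code_length[OF a] L by (intro exI[of _ L]) auto
  next
    case (Some q)
    then have q: "q \<in> states T" using \<mu> by auto
    obtain k where k: "1 \<le> length (out_word T (prefix k z) q)" using out_word_unbounded[OF T q z] by blast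
    have "out_word M (prefix (k * L) s) (\<mu>, []) = enc (out_word T (prefix k z) q)"
      using prefix_encw[OF z, of k] sz lift_enc(2)[OF prefix_words[OF z]] Some by simp
    then show ?thesis
      using k length_enc[OF out_word_words[OF T q prefix_words[OF z]], of k] L
      by (intro exI[of _ "k * L"]) auto
  qed
next
  fix v r assume v: "v \<in> words n" and r: "r \<in> seqs m" "prefix L r \<notin> codewords" and s: "s = enc v \<frown> r"
  have *: "out_word M (prefix L r) (\<nu>, []) \<noteq> []" for \<nu>
    using lift_block(2)[of "prefix L r" \<nu>] r(2) by simp
  obtain \<nu> where \<nu>: "trans_word M (enc v) (\<mu>, []) = (\<nu>, [])"
  proof (cases v)
    case (Cons a w)
    then show ?thesis using lift_code(1)[of a \<mu>] lift_enc(1)[of w] v that by simp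
  qed (use that in simp)
  have "prefix (length (enc v) + L) s = enc v @ prefix L r" using s by simp
  then have "out_word M (prefix (length (enc v) + L) s) (\<mu>, []) \<noteq> []"
    using *[of \<nu>] \<nu> by (simp add: out_word_append)
  then show ?thesis by blast
qed

lemma lift_next_state:
  assumes "a < m" "p \<in> states M" shows "next_state M a p \<in> states M"
proof -
  obtain \<mu> b where pb: "p = (\<mu>, b)" "\<mu> \<in> modes" "b \<in> words m" "length b < L"
    using assms(2) unfolding lift_states by auto
  have ba: "b @ [a] \<in> words m" using pb(3) assms(1) by simp
  have d: "dec (b @ [a]) < n" if "b @ [a] \<in> codewords" using that by (auto simp: dec_code)
  have tl: "tl (b @ [a]) \<in> words m" using ba by (cases b) auto
  show ?thesis using enter_state[OF pb(2) d] tl ba pb L unfolding lift_states by (auto simp: lift_def)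
qed

lemma is_transducer_lift: "is_transducer m M"
  unfolding is_transducer_def
proof (intro conjI allI impI ballI)
  show "states M \<noteq> {}" using L unfolding lift_states by auto
  show "countable (states M)" using T unfolding lift_states by (simp add: is_transducer_def)
next
  fix a p assume a: "a < m" and p: "p \<in> states M"
  then obtain \<mu> b where pb: "p = (\<mu>, b)" "\<mu> \<in> modes" "b \<in> words m" "length b < L"
    unfolding lift_states by auto
  have ba: "b @ [a] \<in> words m" using pb(3) a by simp
  have d: "dec (b @ [a]) < n" if "b @ [a] \<in> codewords" using that by (auto simp: dec_code)
  show "next_state M a p \<in> states M" by (rule lift_next_state[OF a p])
  have e: "emit T \<mu> e \<in> words m" if "e < n" for e
    using pb(2) that T code_words[OF that] enc_words by (auto simp: emit_def is_transducer_def)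
  have "butlast w \<in> words n" if "w \<in> words n" for w
    using that by (auto simp: in_lists_conv_set dest: in_set_butlastD)
  then have f: "flush x T \<mu> \<in> words m"
    using pb(2) T x enc_words by (auto simp: flush_def is_transducer_def)
  have "hd (b @ [a]) < m" using ba by (cases b) auto
  then show "outp M a p \<in> words m"
    using e[OF d] f pb(1) by (simp add: lift_def)
next
  fix p s l assume p: "p \<in> states M" and s: "s \<in> seqs m"
  have cls: "trans_word M w p \<in> states M" if "w \<in> words m" "p \<in> states M" for w p
    using that by (induction w arbitrary: p) (auto simp: lift_next_state)
  have one: "\<exists>k. out_word M (prefix k s) p \<noteq> []" if p: "p \<in> states M" and s: "s \<in> seqs m" for p s
  proof -
    obtain \<mu> b where pb: "p = (\<mu>, b)" "\<mu> \<in> modes" "b \<in> words m" "length b < L"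
      using p unfolding lift_states by auto
    obtain k where k: "out_word M (prefix k (b \<frown> s)) (\<mu>, []) \<noteq> []"
      using lift_nonempty_output[OF pb(2) conc_seqs[OF s pb(3)]] by blast
    obtain t where "out_word M (prefix (length b + k) (b \<frown> s)) (\<mu>, []) =
        out_word M (prefix k (b \<frown> s)) (\<mu>, []) @ t"
      using out_word_prefix[of k "length b + k" M "b \<frown> s" "(\<mu>, [])"] by auto
    then have "out_word M (b @ prefix k s) (\<mu>, []) \<noteq> []" using k by simp
    then show ?thesis using lift_short[OF pb(4), of \<mu>] pb(1) by (auto simp: out_word_append)
  qed
  show "\<exists>k. l \<le> length (out_word M (prefix k s) p)"
    using p s
  proof (induction l arbitrary: p s)
    case (Suc l)
    obtain k where k: "out_word M (prefix k s) p \<noteq> []" using one[OF Suc.prems] by blast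
    obtain k' where k': "l \<le> length (out_word M (prefix k' (suffix k s)) (trans_word M (prefix k s) p))"
      using Suc.IH[OF cls[OF prefix_words[OF Suc.prems(2)] Suc.prems(1)] suffix_seqs[OF Suc.prems(2)]] by blast
    have "prefix (k + k') s = prefix k s @ prefix k' (suffix k s)"
      using subsequence_append[where i = k and j = k' and w = s] by simp
    then have "Suc l \<le> length (out_word M (prefix (k + k') s) p)"
      using k k' by (cases "out_word M (prefix k s) p") (auto simp: out_word_append simp del: subsequence_shift)
    then show ?case by blast
  qed simp
qed

abbreviation (input) "V \<mu> \<equiv> induced m M (\<mu>, [])"

lemma mode_state: "\<mu> \<in> modes \<Longrightarrow> (\<mu>, []) \<in> states M"
  using L unfolding lift_states by auto

lemma lift_induced_code:
  assumes "\<mu> \<in> modes" "a < n" "s \<in> seqs m"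
  shows "V \<mu> (c a \<frown> s) = emit T \<mu> a \<frown> V (Some (enter T q\<^sub>0 \<mu> a)) s"
  using induced_conc_word[OF is_transducer_lift mode_state[OF assms(1)] code_words[OF assms(2)] assms(3)]
    lift_code[OF assms(2)] by simp

lemma lift_induced_enc:
  assumes "q \<in> states T" "v \<in> words n" "s \<in> seqs m"
  shows "V (Some q) (enc v \<frown> s) = enc (out_word T v q) \<frown> V (Some (trans_word T v q)) s"
  using induced_conc_word[OF is_transducer_lift mode_state enc_words[OF assms(2)] assms(3), of "Some q"]
    assms(1) lift_enc[OF assms(2)] by simp

lemma lift_induced_break:
  assumes \<mu>: "\<mu> \<in> modes" and s: "s \<in> seqs m" "prefix L s \<notin> codewords"
  shows "V \<mu> s = (flush x T \<mu> @ [s 0]) \<frown> V None (suffix 1 s)"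
proof -
  have p: "prefix L s \<in> words m" by (rule prefix_words[OF s(1)])
  obtain a v where av: "prefix L s = a # v" using L by (cases "prefix L s") auto
  have "a = prefix L s ! 0" unfolding av by simp
  then have hd: "a = s 0" using L by simp
  have "L = Suc (length v)" using arg_cong[OF av, of length] by simp
  then have v: "v \<in> words m" "length v < L" using p unfolding av by auto
  have sf: "suffix L s \<in> seqs m" by (rule suffix_seqs[OF s(1)])
  have "(a # v) \<frown> suffix L s = s" unfolding av[symmetric] by (rule prefix_suffix[symmetric])
  moreover have "suffix 1 ((a # v) \<frown> suffix L s) = v \<frown> suffix L s" by simp
  ultimately have s1: "suffix 1 s = v \<frown> suffix L s" by simp
  have "length (prefix L s) = L" by simp
  note lb = lift_block[OF this, of \<mu>]
  have "V \<mu> (prefix L s \<frown> suffix L s) = out_word M (prefix L s) (\<mu>, []) \<frown>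
      induced m M (trans_word M (prefix L s) (\<mu>, [])) (suffix L s)"
    by (rule induced_conc_word[OF is_transducer_lift mode_state[OF \<mu>] p sf])
  also have "\<dots> = (flush x T \<mu> @ [s 0]) \<frown> induced m M (None, v) (suffix L s)"
    unfolding lb if_not_P[OF s(2)] by (simp add: av hd)
  also have "induced m M (None, v) (suffix L s) = V None (suffix 1 s)"
    using induced_conc_word[OF is_transducer_lift mode_state[of None] v(1) sf] lift_short[OF v(2), of None]
    unfolding s1 by simp
  finally show ?thesis unfolding prefix_suffix[symmetric] .
qed

lemma lift_induced_encw:
  assumes q: "q \<in> states T" and z: "z \<in> seqs n"
  shows "V (Some q) (encw z) = encw (induced n T q z)"
proof (rule induced_eqI[OF is_transducer_lift mode_state encw_seqs[OF z]])
  fix k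
  obtain t where t: "induced n T q z = out_word T (prefix k z) q \<frown> t"
    using induced_prefix[OF T q z] by blast
  have "out_word M (prefix (k * L) (encw z)) (Some q, []) = enc (out_word T (prefix k z) q)"
    using prefix_encw[OF z] lift_enc(2)[OF prefix_words[OF z]] by simp
  moreover have "k \<le> k * L" using L by simp
  ultimately obtain u where "enc (out_word T (prefix k z) q) = out_word M (prefix k (encw z)) (Some q, []) @ u"
    using out_word_prefix[of k "k * L" M "encw z" "(Some q, [])"] by auto
  then show "\<exists>t. encw (induced n T q z) = out_word M (prefix k (encw z)) (Some q, []) \<frown> t"
    unfolding t encw_conc[OF out_word_words[OF T q prefix_words[OF z]]] by (metis conc_conc)
qed (use q in simp)

text \<open>
  If no codeword occurs across position \<open>j\<close>, then the lift never consumes a codeword across \<open>j\<close>, so that after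
  reading \<open>s\<close> it is where it would be if it had started at \<open>j\<close> with an empty buffer, in some mode.
\<close>
lemma lift_boundary:
  assumes "j + L \<le> length s" "\<And>i. i < j \<Longrightarrow> j < i + L \<Longrightarrow> take L (drop i s) \<notin> codewords"
    and "\<mu> \<in> modes" "s \<in> words m"
  shows "\<exists>\<mu>'\<in>modes. trans_word M s (\<mu>, []) = trans_word M (drop j s) (\<mu>', [])"
  using assms
proof (induction "length s" arbitrary: s j \<mu> rule: less_induct)
  case less
  show ?case
  proof (cases "j = 0")
    case True
    then show ?thesis using less.prems(3) by auto
  next
    case False
    have sp: "s = take L s @ drop L s" by simp
    have len: "length (take L s) = L" using less.prems(1) by simp
    show ?thesis
    proof (cases "take L s \<in> codewords")
      case True
      then obtain a where a: "a < n" "take L s = c a" by blast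
      have jL: "L \<le> j" using less.prems(2)[of 0] True False by force
      have "trans_word M s (\<mu>, []) = trans_word M (drop L s) (Some (enter T q\<^sub>0 \<mu> a), [])"
        using lift_code(1)[OF a(1), of \<mu>] a(2) sp by (metis trans_word_simps(3))
      moreover have "\<exists>\<mu>'\<in>modes. trans_word M (drop L s) (Some (enter T q\<^sub>0 \<mu> a), []) =
          trans_word M (drop (j - L) (drop L s)) (\<mu>', [])"
      proof (rule less.hyps)
        show "length (drop L s) < length s" using L less.prems(1) by simp
        show "j - L + L \<le> length (drop L s)" using jL less.prems(1) by simp
        show "take L (drop i (drop L s)) \<notin> codewords" if "i < j - L" "j - L < i + L" for i
          using less.prems(2)[of "i + L"] that by (simp add: add.commute)
        show "Some (enter T q\<^sub>0 \<mu> a) \<in> modes" using enter_state[OF less.prems(3) a(1)] by simp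
        show "drop L s \<in> words m" using less.prems(4) sp by (metis append_in_lists_conv)
      qed
      ultimately show ?thesis using jL by simp
    next
      case no: False
      have ne: "s \<noteq> []" using less.prems(1) L by auto
      have "trans_word M s (\<mu>, []) = trans_word M (drop L s) (None, tl (take L s))"
        using lift_block(1)[OF len, of \<mu>] no sp by (metis trans_word_simps(3))
      also have "\<dots> = trans_word M (tl (take L s) @ drop L s) (None, [])"
        using lift_short(1)[of "tl (take L s)" None] len L by simp
      also have "tl (take L s) @ drop L s = drop 1 s"
        using sp len L by (metis drop_Suc drop_0 One_nat_def tl_append2 length_greater_0_conv)
      finally have "trans_word M s (\<mu>, []) = trans_word M (drop 1 s) (None, [])" .
      moreover have "\<exists>\<mu>'\<in>modes. trans_word M (drop 1 s) (None, []) =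
          trans_word M (drop (j - 1) (drop 1 s)) (\<mu>', [])"
      proof (rule less.hyps)
        show "length (drop 1 s) < length s" using ne by simp
        show "j - 1 + L \<le> length (drop 1 s)" using False less.prems(1) by simp
        show "take L (drop i (drop 1 s)) \<notin> codewords" if "i < j - 1" "j - 1 < i + L" for i
          using less.prems(2)[of "i + 1"] that by simp
        show "drop 1 s \<in> words m" using less.prems(4) ne by (cases s) auto
      qed simp
      ultimately show ?thesis using False by simp
    qed
  qed
qed

text \<open>
  Either no codeword occurs across position \<open>L\<close>, or the end of such a codeword serves, as codewords do not overlap.
\<close>
lemma boundary_exists:
  assumes "3 * L \<le> length \<nu>"
  shows "\<exists>j\<ge>L. j \<le> 2 * L \<and> (\<forall>i. i < j \<longrightarrow> j < i + L \<longrightarrow> take L (drop i \<nu>) \<notin> codewords)"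
proof (cases "\<exists>i. 0 < i \<and> i < L \<and> take L (drop i \<nu>) \<in> codewords")
  case False
  then show ?thesis by (intro exI[of _ L]) auto
next
  case True
  then obtain i a where i: "0 < i" "i < L" "a < n" "take L (drop i \<nu>) = c a" by auto
  have "take L (drop i' \<nu>) \<notin> codewords" if i': "i' < i + L" "i + L < i' + L" for i'
  proof
    assume "take L (drop i' \<nu>) \<in> codewords"
    then obtain b where b: "b < n" "take L (drop i' \<nu>) = c b" by auto
    let ?d = "i' - i"
    have d: "0 < ?d" "?d < L" using i' by auto
    have "take (L - ?d) (c b) = take (L - ?d) (drop i' \<nu>)"
      unfolding b(2)[symmetric] by simp
    also have "\<dots> = drop ?d (c a)"
      unfolding i(4)[symmetric] drop_take drop_drop using i' by simp
    finally show False using code_overlap[OF i(3) b(1) d] by simp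
  qed
  then show ?thesis using i by (intro exI[of _ "i + L"]) auto
qed

text \<open>
  A long word \<open>\<nu>\<close> contains a position across which no codeword occurs, whatever precedes \<open>\<nu>\<close>; from there on
  only the mode is unknown. If a break follows soon, the mode becomes \<open>None\<close>. Otherwise \<open>k + 1\<close> codewords follow:
  the first one brings every mode into a mode \<open>Some q\<close>, and the next \<open>k\<close> synchronize \<open>T\<close>.
\<close>
lemma strongly_synchronizing_lift:
  assumes "strongly_synchronizing n T"
  shows "strongly_synchronizing m M"
proof -
  obtain k where k: "synchronizing_at n T k" using assms by (auto simp: strongly_synchronizing_def)
  let ?K = "2 * L + (k + 2) * L"
  have settle: "trans_word M \<rho> (\<mu>, []) = trans_word M \<rho> (\<mu>', [])"
    if \<rho>: "\<rho> \<in> words m" "(k + 2) * L \<le> length \<rho>" and \<mu>: "\<mu> \<in> modes" "\<mu>' \<in> modes" for \<rho> \<mu> \<mu>'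
  proof -
    have "(Suc k + 1) * L \<le> length \<rho>" using \<rho>(2) by simp
    from parse_finite[OF \<rho>(1) this] show ?thesis
    proof (elim disjE bexE exE conjE)
      fix v r assume v: "v \<in> words n" "length v = Suc k" and r: "\<rho> = enc v @ r"
      then obtain a w where aw: "v = a # w" "a < n" "w \<in> words n" "length w = k" by (cases v) auto
      have "trans_word M (enc v) (\<kappa>, []) = (Some (trans_word T w (enter T q\<^sub>0 \<kappa> a)), [])" for \<kappa>
        using aw lift_code(1)[OF aw(2)] lift_enc(1)[OF aw(3)] by simp
      moreover have "trans_word T w (enter T q\<^sub>0 \<mu> a) = trans_word T w (enter T q\<^sub>0 \<mu>' a)"
        using k aw enter_state[OF \<mu>(1) aw(2)] enter_state[OF \<mu>(2) aw(2)] unfolding synchronizing_at_def by blast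
      ultimately show ?thesis using r by simp
    next
      fix v r assume v: "v \<in> words n" and r: "\<rho> = enc v @ r" "L \<le> length r" "take L r \<notin> codewords"
      have "\<exists>\<kappa>'. trans_word M (enc v) (\<kappa>, []) = (\<kappa>', [])" for \<kappa>
      proof (cases v)
        case (Cons a w)
        then show ?thesis using lift_code(1)[of a \<kappa>] lift_enc(1)[of w] v by simp
      qed simp
      moreover have "trans_word M r (\<kappa>, []) = trans_word M (drop L r) (None, tl (take L r))" for \<kappa>
        using lift_block(1)[of "take L r" \<kappa>] r(2,3) trans_word_simps(3)[of M "take L r" "drop L r"] by simp
      ultimately have "trans_word M \<rho> (\<kappa>, []) = trans_word M (drop L r) (None, tl (take L r))" for \<kappa>
        using r(1) by (metis trans_word_simps(3))
      then show ?thesis by simp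
    qed
  qed
  have "synchronizing_at m M ?K"
    unfolding synchronizing_at_def
  proof (intro ballI impI)
    fix \<nu> p p' assume \<nu>: "\<nu> \<in> words m" "length \<nu> = ?K" and p: "p \<in> states M" "p' \<in> states M"
    have "3 * L \<le> length \<nu>" using \<nu>(2) by simp
    then obtain j where j: "L \<le> j" "j \<le> 2 * L"
      "\<And>i. i < j \<Longrightarrow> j < i + L \<Longrightarrow> take L (drop i \<nu>) \<notin> codewords"
      using boundary_exists by blast
    have reach: "\<exists>\<mu>'\<in>modes. trans_word M \<nu> p = trans_word M (drop j \<nu>) (\<mu>', [])" if p: "p \<in> states M" for p
    proof -
      obtain \<mu> b where pb: "p = (\<mu>, b)" "\<mu> \<in> modes" "b \<in> words m" "length b < L"
        using p unfolding lift_states by auto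
      have "trans_word M \<nu> p = trans_word M (b @ \<nu>) (\<mu>, [])"
        using lift_short(1)[OF pb(4), of \<mu>] pb(1) by simp
      moreover have "\<exists>\<mu>'\<in>modes. trans_word M (b @ \<nu>) (\<mu>, []) =
          trans_word M (drop (length b + j) (b @ \<nu>)) (\<mu>', [])"
      proof (rule lift_boundary[OF _ _ pb(2)])
        show "length b + j + L \<le> length (b @ \<nu>)" using j(2) \<nu>(2) by simp
        show "b @ \<nu> \<in> words m" using pb(3) \<nu>(1) by simp
        fix i assume i: "i < length b + j" "length b + j < i + L"
        then have "length b \<le> i" using j(1) by simp
        then show "take L (drop i (b @ \<nu>)) \<notin> codewords"
          using j(3)[of "i - length b"] i by simp
      qed
      ultimately show ?thesis by simp
    qed
    have "drop j \<nu> \<in> words m" using \<nu>(1) by (metis append_in_lists_conv append_take_drop_id)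
    moreover have "(k + 2) * L \<le> length (drop j \<nu>)" using \<nu>(2) j(2) by simp
    ultimately show "trans_word M \<nu> p = trans_word M \<nu> p'"
      using reach[OF p(1)] reach[OF p(2)] settle by metis
  qed
  then show ?thesis unfolding strongly_synchronizing_def by blast
qed

end

end

section \<open>The action of a marker map on finite words\<close>

text \<open>
  The word \<open>v'\<close> with \<open>f (v x y) = v' x f y\<close>; here \<open>v\<close> may contain \<open>x\<close>.
\<close>
definition block :: "nat \<Rightarrow> nat \<Rightarrow> (nat word \<Rightarrow> nat word) \<Rightarrow> nat list \<Rightarrow> nat list"
  where "block n x f v = butlast (lcp (f ` cyl n (v @ [x])))"

lemma
  assumes n: "n \<ge> 2" and x: "x < n" and f: "marker_homeo n x f g" and v: "v \<in> words n"
  shows block_split: "block n x f v = out_word (core_of n f) v f @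
      butlast (outp (core_of n f) x (trans_word (core_of n f) v f))"
    and block_words: "block n x f v \<in> words n"
    and block_conc: "y \<in> seqs n \<Longrightarrow> f ((v @ [x]) \<frown> y) = (block n x f v @ [x]) \<frown> f y"
proof -
  let ?T = "core_of n f"
  note tr = core_of_steps[OF n marker_homeoD(2)[OF f]]
  note fc = marker_homeo_in_core[OF n x f]
  have vx: "v @ [x] \<in> words n" using v x by simp
  let ?q = "trans_word ?T v f"
  have q: "?q \<in> core_maps n f" using trans_word_states[OF tr(1) _ v, of f] fc by simp
  obtain w where w: "w \<in> words n" "outp ?T x ?q = w @ [x]" using Ox_condition_core(3)[OF n x f q] by blast
  have o: "out_word ?T (v @ [x]) f = (out_word ?T v f @ w) @ [x]" using w(2) by (simp add: out_word_append)
  then have b: "block n x f v = out_word ?T v f @ w"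
    unfolding block_def tr(3)[OF fc vx, symmetric] by (simp only: butlast_snoc)
  have b': "out_word ?T (v @ [x]) f = block n x f v @ [x]" unfolding b o ..
  show "block n x f v = out_word ?T v f @ butlast (outp ?T x ?q)" unfolding b w(2) by simp
  show "block n x f v \<in> words n" using b w(1) out_word_words[OF tr(1) _ v, of f] fc by simp
  assume y: "y \<in> seqs n"
  have "trans_word ?T (v @ [x]) f = f" using Ox_condition_core(2)[OF n x f q] by simp
  then show "f ((v @ [x]) \<frown> y) = (block n x f v @ [x]) \<frown> f y"
    using induced_conc_word[OF tr(1) _ vx y, of f] fc tr(4)[OF fc] b' by simp
qed

lemma blockI:
  assumes n: "n \<ge> 2" and x: "x < n" and f: "marker_homeo n x f g" and v: "v \<in> words n"
    and eq: "\<And>y. y \<in> seqs n \<Longrightarrow> f ((v @ [x]) \<frown> y) = (w @ [x]) \<frown> f y"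
  shows "block n x f v = w"
proof -
  have vx: "v @ [x] \<in> words n" using v x by simp
  have "lcp (f ` cyl n ((v @ [x]) @ [])) = (w @ [x]) @ lcp (f ` cyl n [])"
    by (rule lcp_cone[OF n marker_homeoD(5)[OF f] vx _ eq]) simp_all
  then show ?thesis using marker_homeoD(8)[OF f] lcp_seqs[OF n] by (simp add: block_def cyl_Nil)
qed

lemma block_comp:
  assumes n: "n \<ge> 2" and x: "x < n" and f: "marker_homeo n x f g" and f': "marker_homeo n x f' g'"
    and v: "v \<in> words n"
  shows "block n x (restrict (f' \<circ> f) (seqs n)) v = block n x f' (block n x f v)"
proof (rule blockI[OF n x marker_homeo_comp[OF n x f f'] v])
  fix y assume y: "y \<in> seqs n"
  have "(v @ [x]) \<frown> y \<in> seqs n" by (rule conc_seqs[OF y]) (use v x in simp)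
  moreover have "f y \<in> seqs n" using marker_homeoD(6)[OF f] y by blast
  ultimately show "restrict (f' \<circ> f) (seqs n) ((v @ [x]) \<frown> y) =
      (block n x f' (block n x f v) @ [x]) \<frown> restrict (f' \<circ> f) (seqs n) y"
    using block_conc[OF n x f v y] block_conc[OF n x f' block_words[OF n x f v]] y by simp
qed

lemma block_id:
  assumes n: "n \<ge> 2" and x: "x < n" and v: "v \<in> words n"
  shows "block n x (restrict id (seqs n)) v = v"
proof (rule blockI[OF n x marker_homeo_id[OF n x] v])
  fix y assume y: "y \<in> seqs n"
  have "(v @ [x]) \<frown> y \<in> seqs n" by (rule conc_seqs[OF y]) (use v x in simp)
  then show "restrict id (seqs n) ((v @ [x]) \<frown> y) = (v @ [x]) \<frown> restrict id (seqs n) y"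
    using y by simp
qed

lemma prefix_conc_nonempty:
  assumes "prefix N s = prefix N t" "w \<noteq> []"
  shows "prefix (Suc N) (w \<frown> s) = prefix (Suc N) (w \<frown> t)"
proof -
  obtain a v where w: "w = a # v" using assms(2) by (cases w) auto
  have *: "prefix (Suc N) (w \<frown> s) = a # prefix N (v \<frown> s)" for s
    using prefix_conc_snd[of "[a]" "Suc N" "v \<frown> s"] w by simp
  show ?thesis unfolding * using prefix_conc_eq[OF assms(1)] by simp
qed

lemma seq_split_first: "s = [s 0] \<frown> suffix 1 s"
  using prefix_suffix[of s 1] by simp

context nonoverlapping_code
begin

section \<open>Recoding sequences by a marker map\<close>

text \<open>
  The equations that characterize recoding by \<open>F\<close> outside of runs (\<open>P\<close>) and directly after a codeword (\<open>Q\<close>),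
  where \<open>b\<close> gives the effect of \<open>F\<close> on finite runs. Composites and the identity are identified
  through these equations, without reference to transducers.
\<close>
definition recoding :: "(nat word \<Rightarrow> nat word) \<Rightarrow> (nat list \<Rightarrow> nat list) \<Rightarrow>
    (nat word \<Rightarrow> nat word) \<Rightarrow> (nat word \<Rightarrow> nat word) \<Rightarrow> bool"
  where "recoding F b P Q \<longleftrightarrow>
    (\<forall>a<n. \<forall>s\<in>seqs m. P (c a \<frown> s) = c a \<frown> Q s) \<and>
    (\<forall>s\<in>seqs m. prefix L s \<notin> codewords \<longrightarrow> P s = [s 0] \<frown> P (suffix 1 s)) \<and>
    (\<forall>z\<in>seqs n. Q (encw z) = encw (F z)) \<and>
    (\<forall>v\<in>words n. \<forall>r\<in>seqs m. prefix L r \<notin> codewords \<longrightarrow> Q (enc v \<frown> r) = enc (b v) \<frown> P r)"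

lemma recodingD:
  assumes "recoding F b P Q"
  shows "a < n \<Longrightarrow> s \<in> seqs m \<Longrightarrow> P (c a \<frown> s) = c a \<frown> Q s"
    "s \<in> seqs m \<Longrightarrow> prefix L s \<notin> codewords \<Longrightarrow> P s = [s 0] \<frown> P (suffix 1 s)"
    "z \<in> seqs n \<Longrightarrow> Q (encw z) = encw (F z)"
    "v \<in> words n \<Longrightarrow> r \<in> seqs m \<Longrightarrow> prefix L r \<notin> codewords \<Longrightarrow> Q (enc v \<frown> r) = enc (b v) \<frown> P r"
  using assms by (auto simp: recoding_def)

lemma codeword_cases:
  assumes s: "s \<in> seqs m"
  obtains (code) a s' where "a < n" "s' \<in> seqs m" "s = c a \<frown> s'"
  | (break) "prefix L s \<notin> codewords"
proof (cases "prefix L s \<in> codewords")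
  case True
  then obtain a where a: "a < n" "prefix L s = c a" by auto
  have "s = c a \<frown> suffix L s" unfolding a(2)[symmetric] by (rule prefix_suffix)
  then show ?thesis using code[OF a(1) suffix_seqs[OF s]] by blast
qed (rule break)

text \<open>
  Every equation for \<open>P\<close> produces at least one letter before \<open>P\<close> or \<open>Q\<close> is applied again, so the first \<open>N\<close> letters are determined
  by induction on \<open>N\<close>.
\<close>
lemma recoding_unique:
  assumes PQ: "recoding F b P Q" and PQ': "recoding F b P' Q'" and s: "s \<in> seqs m"
  shows "P s = P' s" "Q s = Q' s"
proof -
  have Q: "\<forall>s\<in>seqs m. prefix N (Q s) = prefix N (Q' s)"
    if P: "\<forall>s\<in>seqs m. prefix N (P s) = prefix N (P' s)" for N
  proof
    fix s assume "s \<in> seqs m"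
    from parse[OF this] show "prefix N (Q s) = prefix N (Q' s)"
    proof (elim disjE bexE conjE)
      fix z assume "z \<in> seqs n" "s = encw z"
      then show ?thesis using recodingD(3)[OF PQ] recodingD(3)[OF PQ'] by simp
    next
      fix v r assume v: "v \<in> words n" "r \<in> seqs m" "prefix L r \<notin> codewords" "s = enc v \<frown> r"
      then have "Q s = enc (b v) \<frown> P r" "Q' s = enc (b v) \<frown> P' r"
        using recodingD(4)[OF PQ] recodingD(4)[OF PQ'] by simp_all
      then show ?thesis using prefix_conc_eq P v(2) by metis
    qed
  qed
  have P: "\<forall>s\<in>seqs m. prefix N (P s) = prefix N (P' s)" for N
  proof (induction N)
    case (Suc N)
    show ?case
    proof
      fix s assume s: "s \<in> seqs m"
      then show "prefix (Suc N) (P s) = prefix (Suc N) (P' s)"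
      proof (cases rule: codeword_cases)
        case (code a s')
        have "c a \<noteq> []" using code_length[OF code(1)] L by auto
        moreover have "prefix N (Q s') = prefix N (Q' s')" using Q[OF Suc.IH] code(2) by blast
        ultimately have "prefix (Suc N) (c a \<frown> Q s') = prefix (Suc N) (c a \<frown> Q' s')"
          using prefix_conc_nonempty by blast
        then show ?thesis
          unfolding code(3) recodingD(1)[OF PQ code(1,2)] recodingD(1)[OF PQ' code(1,2)] .
      next
        case break
        have "prefix N (P (suffix 1 s)) = prefix N (P' (suffix 1 s))" using Suc.IH suffix_seqs[OF s] by blast
        then have "prefix (Suc N) ([s 0] \<frown> P (suffix 1 s)) = prefix (Suc N) ([s 0] \<frown> P' (suffix 1 s))"
          by (rule prefix_conc_nonempty) simp
        then show ?thesis unfolding recodingD(2)[OF PQ s break] recodingD(2)[OF PQ' s break] .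
      qed
    qed
  qed simp
  show "P s = P' s" "Q s = Q' s" using P Q[OF P] s by (auto intro: seq_eqI)
qed

text \<open>
  A sequence is unchanged up to the end of its first codeword, in particular in its first \<open>L\<close> letters. So
  recoding does not create or destroy a codeword at the beginning of a sequence, which is what makes
  it compatible with composition.
\<close>
lemma recoding_prefix:
  assumes PQ: "recoding F b P Q" and s: "s \<in> seqs m"
  shows "prefix L (P s) = prefix L s"
proof -
  have "prefix l (P s) = prefix l s" if "l \<le> L" for l
    using that s
  proof (induction l arbitrary: s)
    case (Suc l)
    note ss = Suc.prems(2)
    then show ?case
    proof (cases rule: codeword_cases)
      case (code a s')
      then show ?thesis using recodingD(1)[OF PQ code(1,2)] code_length[OF code(1)] Suc.prems(1) by simp
    next
      case break
      have "prefix l (P (suffix 1 s)) = prefix l (suffix 1 s)" using Suc.IH Suc.prems(1) suffix_seqs[OF ss] by simp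
      then have "prefix (Suc l) ([s 0] \<frown> P (suffix 1 s)) = prefix (Suc l) ([s 0] \<frown> suffix 1 s)"
        by (rule prefix_conc_nonempty) simp
      then show ?thesis
        unfolding recodingD(2)[OF PQ ss break] seq_split_first[of s, symmetric] .
    qed
  qed simp
  then show ?thesis by simp
qed

lemma recoding_comp:
  assumes PQ: "recoding F b P Q" and PQ': "recoding F' b' P' Q'"
    and into: "\<And>z. z \<in> seqs n \<Longrightarrow> F z \<in> seqs n" "\<And>v. v \<in> words n \<Longrightarrow> b v \<in> words n"
      "\<And>s. s \<in> seqs m \<Longrightarrow> P s \<in> seqs m" "\<And>s. s \<in> seqs m \<Longrightarrow> Q s \<in> seqs m"
  shows "recoding (F' \<circ> F) (b' \<circ> b) (P' \<circ> P) (Q' \<circ> Q)"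
  unfolding recoding_def
proof (intro conjI allI ballI impI)
  fix a s assume "a < n" "s \<in> seqs m"
  then show "(P' \<circ> P) (c a \<frown> s) = c a \<frown> (Q' \<circ> Q) s"
    using recodingD(1)[OF PQ] recodingD(1)[OF PQ'] into(4) by simp
next
  fix s assume s: "s \<in> seqs m" "prefix L s \<notin> codewords"
  have p: "prefix L (P s) \<notin> codewords" using recoding_prefix[OF PQ s(1)] s(2) by simp
  have e: "P s = [s 0] \<frown> P (suffix 1 s)" by (rule recodingD(2)[OF PQ s])
  then have "P s 0 = s 0" "suffix 1 (P s) = P (suffix 1 s)"
    by (metis conc_fst length_Cons list.size(3) nth_Cons_0 zero_less_Suc)
       (metis e One_nat_def length_Cons list.size(3) suffix_conc_length)
  then show "(P' \<circ> P) s = [s 0] \<frown> (P' \<circ> P) (suffix 1 s)"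
    using recodingD(2)[OF PQ' into(3)[OF s(1)] p] by simp
next
  fix z assume "z \<in> seqs n"
  then show "(Q' \<circ> Q) (encw z) = encw ((F' \<circ> F) z)"
    using recodingD(3)[OF PQ] recodingD(3)[OF PQ'] into(1) by simp
next
  fix v r assume v: "v \<in> words n" and r: "r \<in> seqs m" "prefix L r \<notin> codewords"
  have "prefix L (P r) \<notin> codewords" using recoding_prefix[OF PQ r(1)] r(2) by simp
  then show "(Q' \<circ> Q) (enc v \<frown> r) = enc ((b' \<circ> b) v) \<frown> (P' \<circ> P) r"
    using recodingD(4)[OF PQ v r] recodingD(4)[OF PQ' into(2)[OF v] into(3)[OF r(1)]] by simp
qed

lemma recoding_id: "recoding id id id id"
  unfolding recoding_def id_apply by (intro conjI allI ballI impI refl seq_split_first)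

lemma recoding_cong:
  assumes "recoding F b P Q" "\<And>z. z \<in> seqs n \<Longrightarrow> F z = F' z" "\<And>v. v \<in> words n \<Longrightarrow> b v = b' v"
  shows "recoding F' b' P Q"
  using assms by (simp add: recoding_def)

text \<open>
  Both maps come from the lift of the core of \<open>f\<close>, started outside of a run and directly after the first
  codeword of a run, where \<open>f\<close> itself is the state that the marker leads to.
\<close>
definition recode :: "nat \<Rightarrow> (nat word \<Rightarrow> nat word) \<Rightarrow> nat word \<Rightarrow> nat word"
  where "recode x f = induced m (lift x (core_of n f) f) (None, [])"

definition recode_run :: "nat \<Rightarrow> (nat word \<Rightarrow> nat word) \<Rightarrow> nat word \<Rightarrow> nat word"
  where "recode_run x f = induced m (lift x (core_of n f) f) (Some f, [])"

context
  fixes x :: nat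
  assumes n: "n \<ge> 2" and x: "x < n"
begin

context
  fixes f g assumes f: "marker_homeo n x f g"
begin

lemma lift_premises:
  shows "x < n" "is_transducer n (core_of n f)" "f \<in> states (core_of n f)"
  using x core_of_steps(1)[OF n marker_homeoD(2)[OF f]] marker_homeo_in_core[OF n x f] by auto

lemma recode_into:
  assumes "s \<in> seqs m" shows "recode x f s \<in> seqs m" "recode_run x f s \<in> seqs m"
  unfolding recode_def recode_run_def
  by (rule induced_seqs[OF is_transducer_lift[OF lift_premises] mode_state[OF lift_premises] assms];
      use lift_premises in simp)+

lemma recoding_recode: "recoding f (block n x f) (recode x f) (recode_run x f)"
proof -
  let ?T = "core_of n f"
  note code = lift_induced_code[OF lift_premises] and enc = lift_induced_enc[OF lift_premises]
    and break = lift_induced_break[OF lift_premises] and encw = lift_induced_encw[OF lift_premises]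
  note tr = core_of_steps[OF n marker_homeoD(2)[OF f]]
  note fT = lift_premises(3)
  show ?thesis
    unfolding recoding_def recode_def recode_run_def
  proof (intro conjI allI ballI impI)
    fix a s assume "a < n" "s \<in> seqs m"
    then show "induced m (lift x ?T f) (None, []) (c a \<frown> s) = c a \<frown> induced m (lift x ?T f) (Some f, []) s"
      using code[of None a s] by (simp add: emit_def enter_def)
  next
    fix s assume "s \<in> seqs m" "prefix L s \<notin> codewords"
    then show "induced m (lift x ?T f) (None, []) s = [s 0] \<frown> induced m (lift x ?T f) (None, []) (suffix 1 s)"
      using break[of None s] by (simp add: flush_def)
  next
    fix z assume "z \<in> seqs n"
    then show "induced m (lift x ?T f) (Some f, []) (encw z) = encw (f z)"
      using encw[OF fT] tr(4) fT by simp
  next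
    fix v r assume v: "v \<in> words n" and r: "r \<in> seqs m" "prefix L r \<notin> codewords"
    let ?q = "trans_word ?T v f"
    have q: "Some ?q \<in> insert None (Some ` states ?T)"
      using trans_word_states[OF tr(1) fT v] by simp
    have "induced m (lift x ?T f) (Some f, []) (enc v \<frown> r) =
        enc (out_word ?T v f) \<frown> induced m (lift x ?T f) (Some ?q, []) r"
      by (rule enc[OF fT v r(1)])
    also have "induced m (lift x ?T f) (Some ?q, []) r =
        (enc (butlast (outp ?T x ?q)) @ [r 0]) \<frown> induced m (lift x ?T f) (None, []) (suffix 1 r)"
      using break[OF q r] by (simp add: flush_def)
    also have "\<dots> = enc (butlast (outp ?T x ?q)) \<frown> induced m (lift x ?T f) (None, []) r"
      using break[of None r] r by (simp add: flush_def)
    finally show "induced m (lift x ?T f) (Some f, []) (enc v \<frown> r) =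
        enc (block n x f v) \<frown> induced m (lift x ?T f) (None, []) r"
      unfolding block_split[OF n x f v] by simp
  qed
qed

end

lemma recode_comp:
  assumes f: "marker_homeo n x f g" and f': "marker_homeo n x f' g'" and s: "s \<in> seqs m"
  shows "recode x f' (recode x f s) = recode x (restrict (f' \<circ> f) (seqs n)) s"
    "recode_run x f' (recode_run x f s) = recode_run x (restrict (f' \<circ> f) (seqs n)) s"
proof -
  let ?h = "restrict (f' \<circ> f) (seqs n)"
  have "recoding (f' \<circ> f) (block n x f' \<circ> block n x f) (recode x f' \<circ> recode x f) (recode_run x f' \<circ> recode_run x f)"
  proof (rule recoding_comp[OF recoding_recode[OF f] recoding_recode[OF f']])
    show "z \<in> seqs n \<Longrightarrow> f z \<in> seqs n" for z using marker_homeoD(6)[OF f] by blast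
  qed (rule block_words[OF n x f] recode_into[OF f]; assumption)+
  then have "recoding ?h (block n x ?h) (recode x f' \<circ> recode x f) (recode_run x f' \<circ> recode_run x f)"
    by (rule recoding_cong) (simp_all add: block_comp[OF n x f f'])
  from recoding_unique[OF this recoding_recode[OF marker_homeo_comp[OF n x f f']] s]
  show "recode x f' (recode x f s) = recode x ?h s" "recode_run x f' (recode_run x f s) = recode_run x ?h s"
    by simp_all
qed

lemma recode_id:
  assumes s: "s \<in> seqs m"
  shows "recode x (restrict id (seqs n)) s = s" "recode_run x (restrict id (seqs n)) s = s"
proof -
  have "recoding (restrict id (seqs n)) (block n x (restrict id (seqs n))) id id"
    by (rule recoding_cong[OF recoding_id]) (simp_all add: block_id[OF n x])
  from recoding_unique[OF this recoding_recode[OF marker_homeo_id[OF n x]] s]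
  show "recode x (restrict id (seqs n)) s = s" "recode_run x (restrict id (seqs n)) s = s" by simp_all
qed

lemma recode_inverse:
  assumes f: "marker_homeo n x f g" and s: "s \<in> seqs m"
  shows "recode x g (recode x f s) = s" "recode_run x g (recode_run x f s) = s"
proof -
  have "restrict (g \<circ> f) (seqs n) = restrict id (seqs n)"
    using marker_homeoD(1)[OF f] by (auto simp: sync_homeo_def fun_eq_iff restrict_def)
  then show "recode x g (recode x f s) = s" "recode_run x g (recode_run x f s) = s"
    using recode_comp[OF f marker_homeo_sym[OF f] s] recode_id[OF s] by simp_all
qed

lemma recode_clopen_embedding:
  assumes f: "marker_homeo n x f g"
  shows "clopen_embedding m (recode x f)"
proof (rule homeomorphic_clopen_embedding)
  note g = marker_homeo_sym[OF f]
  have "continuous_map (cantor m) (cantor m) (recode x f)" if f: "marker_homeo n x f g" for f g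
    unfolding recode_def
    by (rule continuous_induced[OF is_transducer_lift[OF lift_premises[OF f]] mode_state[OF lift_premises[OF f]]]) simp
  then show "homeomorphic_maps (cantor m) (cantor m) (recode x f) (recode x g)"
    using f g recode_inverse(1)[OF f] recode_inverse(1)[OF g]
    unfolding homeomorphic_maps_def topspace_cantor by blast
qed

lemma recode_sync_map:
  assumes f: "marker_homeo n x f g"
  shows "sync_map m (recode x f)"
proof -
  let ?M = "lift x (core_of n f) f"
  note M = is_transducer_lift[OF lift_premises[OF f]]
  have st: "(None, []) \<in> states ?M" by (rule mode_state[OF lift_premises[OF f]]) simp
  note e = recode_clopen_embedding[OF f]
  obtain k where k: "synchronizing_at m ?M k"
    using strongly_synchronizing_lift[OF lift_premises[OF f] core_of_steps(5)[OF n marker_homeoD(2)[OF f]]]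
    by (auto simp: strongly_synchronizing_def)
  have la: "local_action m (recode x f) w = local_action m (induced m ?M (trans_word ?M w (None, []))) []"
    if "w \<in> words m" for w
    using local_action_induced[OF m M st _ that] clopen_embedding_inj[OF e] unfolding recode_def by blast
  have "map_synchronizing_at m (recode x f) k"
    unfolding map_synchronizing_at_def
  proof (intro ballI impI)
    fix u u' w assume uw: "u \<in> words m" "u' \<in> words m" "w \<in> words m" "length w = k"
    have "trans_word ?M w (trans_word ?M u (None, [])) = trans_word ?M w (trans_word ?M u' (None, []))"
      using k uw trans_word_states[OF M st] unfolding synchronizing_at_def by blast
    then show "local_action m (recode x f) (u @ w) = local_action m (recode x f) (u' @ w)"
      using la[of "u @ w"] la[of "u' @ w"] uw by simp
  qed
  then show ?thesis using e by (auto simp: sync_map_def)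
qed

lemma recode_sync_homeo:
  assumes f: "marker_homeo n x f g" shows "sync_homeo m (recode x f) (recode x g)"
  using recode_sync_map[OF f] recode_sync_map[OF marker_homeo_sym[OF f]]
    recode_inverse(1)[OF f] recode_inverse(1)[OF marker_homeo_sym[OF f]]
  by (simp add: sync_homeo_def)

text \<open>
  The codeword of \<open>x\<close> leads to the state \<open>f\<close> inside of a run, and repetitions of it stay there.
  As \<open>recode_run x f\<close> is surjective, it is its own local action at the empty word.
\<close>
lemma recode_local_action:
  assumes f: "marker_homeo n x f g"
  shows "local_action m (recode x f) (enc (replicate (Suc j) x)) = recode_run x f"
proof -
  let ?T = "core_of n f" and ?w = "enc (replicate (Suc j) x)"
  note R = recoding_recode[OF f]
  have rep: "replicate l x \<in> words n" for l using x by (simp add: replicate_in_lists)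
  have w: "?w \<in> words m" by (rule enc_words[OF rep])
  have "trans_word ?T (replicate l x) f = f" for l
    using Ox_condition_core(2)[OF n x f marker_homeo_in_core[OF n x f]] by (induction l) simp_all
  then have run: "recode_run x f (enc (replicate j x) \<frown> y) = enc (out_word ?T (replicate j x) f) \<frown> recode_run x f y"
    if "y \<in> seqs m" for y
    using lift_induced_enc[OF lift_premises[OF f] lift_premises(3)[OF f] rep that] unfolding recode_run_def by simp
  have cone: "recode x f (?w \<frown> y) = (c x @ enc (out_word ?T (replicate j x) f)) \<frown> recode_run x f y"
    if y: "y \<in> seqs m" for y
  proof -
    have "recode x f (c x \<frown> (enc (replicate j x) \<frown> y)) = c x \<frown> recode_run x f (enc (replicate j x) \<frown> y)"
      by (rule recodingD(1)[OF R x conc_seqs[OF y enc_words[OF rep]]])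
    then show ?thesis using run[OF y] by simp
  qed
  have "local_action m (recode x f) (?w @ []) = local_action m (recode_run x f) []"
    by (rule local_action_cone[OF m clopen_embedding_inj[OF recode_clopen_embedding[OF f]] w _ cone]) simp_all
  moreover have "recode_run x f ` seqs m = seqs m"
    using recode_into(2)[OF f] recode_into(2)[OF marker_homeo_sym[OF f]]
      recode_inverse(2)[OF marker_homeo_sym[OF f]] by (metis image_eqI image_subsetI subsetI subset_antisym)
  ultimately have "local_action m (recode x f) ?w = restrict (recode_run x f) (seqs m)"
    using local_action_complete[of "recode_run x f" m] lcp_seqs[OF m] by simp
  also have "\<dots> = recode_run x f"
    by (auto simp: recode_run_def induced_ext fun_eq_iff)
  finally show ?thesis .
qed

text \<open>
  By synchronization a high power of the codeword of \<open>x\<close> leads from any state of the core of \<open>recode x f\<close> to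
  \<open>recode_run x f\<close>. If the cores agree, it leads from one and the same state to \<open>recode_run x f\<close> and to
  \<open>recode_run x f'\<close>; and \<open>recode_run x f\<close> determines \<open>f\<close> by its values at encoded sequences.
\<close>
lemma recode_core_inj:
  assumes f: "marker_homeo n x f g" and f': "marker_homeo n x f' g'"
    and eq: "core_of m (recode x f) = core_of m (recode x f')"
  shows "f = f'"
proof -
  obtain k k' where k: "clopen_embedding m (recode x f)" "map_synchronizing_at m (recode x f) k"
    and k': "clopen_embedding m (recode x f')" "map_synchronizing_at m (recode x f') k'"
    using recode_sync_map[OF f] recode_sync_map[OF f'] unfolding sync_map_def by blast
  have cm: "core_maps m (recode x f) = core_maps m (recode x f')"
    using arg_cong[OF eq, of states] by simp
  let ?w = "\<lambda>j. enc (replicate (Suc j) x)"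
  have rep: "replicate l x \<in> words n" for l using x by (simp add: replicate_in_lists)
  have w: "?w j \<in> words m" for j by (rule enc_words[OF rep])
  have len: "j \<le> length (?w j)" for j using length_enc[OF rep, of "Suc j"] L by (simp add: le_Suc_eq trans_le_add2)
  have "recode_run x f \<in> core_maps m (recode x f)"
    unfolding core_maps_def
    using w len recode_local_action[OF f] by (intro CollectI allI) metis
  then have *: "recode_run x f \<in> core_maps m (recode x f')" unfolding cm .
  let ?j = "k + k'"
  have le: "k \<le> length (?w ?j)" "k' \<le> length (?w ?j)" using len[of ?j] by linarith+
  have "local_action m (recode_run x f) (?w ?j) = recode_run x f"
    using core_maps_sync[OF m k _ w le(1)] * cm recode_local_action[OF f] by simp
  moreover have "local_action m (recode_run x f) (?w ?j) = recode_run x f'"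
    using core_maps_sync[OF m k' * w le(2)] recode_local_action[OF f'] by simp
  ultimately have run: "recode_run x f = recode_run x f'" by simp
  have "f z = f' z" if z: "z \<in> seqs n" for z
  proof -
    have "encw (f z) = encw (f' z)"
      using recodingD(3)[OF recoding_recode[OF f] z] recodingD(3)[OF recoding_recode[OF f'] z] run by simp
    then show ?thesis using encw_inj marker_homeoD(6)[OF f] marker_homeoD(6)[OF f'] z by blast
  qed
  then show ?thesis
    by (intro extensionalityI[OF marker_homeoD(7)[OF f] marker_homeoD(7)[OF f']])
qed

end

end

section \<open>The embedding\<close>

theorem theorem5p4:
  fixes m n x :: nat
  assumes "m \<ge> 2" and "n \<ge> 2" and "x \<in> {..<n}"
  shows "\<exists>H. subgroup H (O1_group m) \<and> Ox_group n x \<cong> (O1_group m)\<lparr>carrier := H\<rparr>"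
proof -
  have m: "m \<ge> 2" and n: "n \<ge> 2" and x: "x < n" using assms by auto
  interpret nonoverlapping_code n m "n + 4" "\<lambda>a. map (\<lambda>j. if j < 2 \<or> j = a + 3 then 0 else 1) [0..<n + 4]"
    by (rule nonoverlapping_code_exists[OF m])
  define R where "R = recode x"
  define A where "A = {core_of n f | f g. marker_homeo n x f g}"
  define H where "H = {core_of m (R f) | f g. marker_homeo n x f g}"
  define marker where "marker T = (SOME f. \<exists>g. marker_homeo n x f g \<and> T = core_of n f)" for T
  define \<theta> where "\<theta> T = core_of m (R (marker T))" for T
  have marker: "marker (core_of n f) = f" if f: "marker_homeo n x f g" for f g
    unfolding marker_def
  proof (rule some_equality)
    show "\<exists>g. marker_homeo n x f g \<and> core_of n f = core_of n f" using f by blast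
    show "f' = f" if "\<exists>g. marker_homeo n x f' g \<and> core_of n f = core_of n f'" for f'
      using that marker_homeo_core_unique[OF n x _ f] by metis
  qed
  have comp: "core_of m (R f' \<circ> R f) = core_of m (R (restrict (f' \<circ> f) (seqs n)))"
    if "marker_homeo n x f g" "marker_homeo n x f' g'" for f g f' g'
    using core_maps_cong[of m "R f' \<circ> R f" "R (restrict (f' \<circ> f) (seqs n))"] recode_comp(1)[OF n x that]
    by (simp add: R_def)
  have "subgroup H (O_group m)"
  proof (rule group.subgroupI[OF group_O[OF m]])
    show "H \<subseteq> carrier (O_group m)"
      unfolding H_def R_def using core_in_O[OF m recode_sync_homeo[OF n x]] by blast
    show "H \<noteq> {}" unfolding H_def using marker_homeo_id[OF n x] by blast
    fix a assume "a \<in> H"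
    then obtain f g where a: "a = core_of m (R f)" "marker_homeo n x f g" unfolding H_def by blast
    have "inv\<^bsub>O_group m\<^esub> a = core_of m (R g)"
      unfolding a(1) R_def by (rule inv_O[OF m recode_sync_homeo[OF n x a(2)]])
    then show "inv\<^bsub>O_group m\<^esub> a \<in> H" unfolding H_def using marker_homeo_sym[OF a(2)] by blast
    fix b assume "b \<in> H"
    then obtain f' g' where b: "b = core_of m (R f')" "marker_homeo n x f' g'" unfolding H_def by blast
    have "a \<otimes>\<^bsub>O_group m\<^esub> b = core_of m (R f' \<circ> R f)"
      unfolding a(1) b(1) R_def by (rule mult_O[OF m recode_sync_map[OF n x a(2)] recode_sync_map[OF n x b(2)]])
    then show "a \<otimes>\<^bsub>O_group m\<^esub> b \<in> H"
      unfolding H_def comp[OF a(2) b(2)] using marker_homeo_comp[OF n x a(2) b(2)] by blast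
  qed
  moreover have "H \<subseteq> carrier (O1_group m)"
    unfolding O1_carrier[OF m] H_def R_def using recode_sync_homeo[OF n x] by blast
  ultimately have "subgroup H (O1_group m)"
    using group.subgroup_incl[OF group_O[OF m] _ subgroup_O1[OF m]] by (subst O1_eq)
  moreover have "\<theta> \<in> iso (Ox_group n x) ((O1_group m)\<lparr>carrier := H\<rparr>)"
  proof (rule isoI)
    have A: "carrier (Ox_group n x) = A" unfolding A_def by (rule Ox_carrier[OF n x])
    have \<theta>: "\<theta> (core_of n f) = core_of m (R f)" if "marker_homeo n x f g" for f g
      unfolding \<theta>_def marker[OF that] ..
    show "\<theta> \<in> hom (Ox_group n x) ((O1_group m)\<lparr>carrier := H\<rparr>)"
    proof (rule homI)
      fix S assume "S \<in> carrier (Ox_group n x)"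
      then obtain f g where f: "S = core_of n f" "marker_homeo n x f g" unfolding A A_def by blast
      show "\<theta> S \<in> carrier ((O1_group m)\<lparr>carrier := H\<rparr>)"
        unfolding f(1) \<theta>[OF f(2)] H_def using f(2) by auto
      fix S' assume "S' \<in> carrier (Ox_group n x)"
      then obtain f' g' where f': "S' = core_of n f'" "marker_homeo n x f' g'" unfolding A A_def by blast
      have "core_of n f \<otimes>\<^bsub>O_group n\<^esub> core_of n f' = core_of n (f' \<circ> f)"
        by (rule mult_O[OF n marker_homeoD(2)[OF f(2)] marker_homeoD(2)[OF f'(2)]])
      also have "\<dots> = core_of n (restrict (f' \<circ> f) (seqs n))"
        using core_maps_cong[of n "f' \<circ> f" "restrict (f' \<circ> f) (seqs n)"] by simp
      finally have "\<theta> (S \<otimes>\<^bsub>O_group n\<^esub> S') = core_of m (R (restrict (f' \<circ> f) (seqs n)))"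
        unfolding f(1) f'(1) using \<theta>[OF marker_homeo_comp[OF n x f(2) f'(2)]] by simp
      also have "\<dots> = core_of m (R f) \<otimes>\<^bsub>O_group m\<^esub> core_of m (R f')"
        unfolding comp[OF f(2) f'(2), symmetric] unfolding R_def
        by (rule mult_O[OF m recode_sync_map[OF n x f(2)] recode_sync_map[OF n x f'(2)], symmetric])
      finally show "\<theta> (S \<otimes>\<^bsub>Ox_group n x\<^esub> S') = \<theta> S \<otimes>\<^bsub>(O1_group m)\<lparr>carrier := H\<rparr>\<^esub> \<theta> S'"
        unfolding f(1) f'(1) \<theta>[OF f(2)] \<theta>[OF f'(2)] by (simp add: Ox_group_def O1_group_def)
    qed
    show "bij_betw \<theta> (carrier (Ox_group n x)) (carrier ((O1_group m)\<lparr>carrier := H\<rparr>))"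
      unfolding A bij_betw_def
    proof
      show "inj_on \<theta> A"
      proof (rule inj_onI)
        fix S S' assume S: "S \<in> A" "S' \<in> A" "\<theta> S = \<theta> S'"
        obtain f g where f: "S = core_of n f" "marker_homeo n x f g" using S(1) unfolding A_def by blast
        obtain f' g' where f': "S' = core_of n f'" "marker_homeo n x f' g'" using S(2) unfolding A_def by blast
        have "core_of m (R f) = core_of m (R f')"
          using S(3) unfolding f(1) f'(1) \<theta>[OF f(2)] \<theta>[OF f'(2)] .
        then have "f = f'" unfolding R_def by (rule recode_core_inj[OF n x f(2) f'(2)])
        then show "S = S'" using f(1) f'(1) by simp
      qed
      show "\<theta> ` A = carrier ((O1_group m)\<lparr>carrier := H\<rparr>)"
      proof (intro equalityI subsetI)
        fix U assume "U \<in> \<theta> ` A"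
        then obtain f g where f: "U = \<theta> (core_of n f)" "marker_homeo n x f g" unfolding A_def by blast
        show "U \<in> carrier ((O1_group m)\<lparr>carrier := H\<rparr>)" unfolding f(1) \<theta>[OF f(2)] H_def using f(2) by auto
      next
        fix U assume "U \<in> carrier ((O1_group m)\<lparr>carrier := H\<rparr>)"
        then obtain f g where f: "U = core_of m (R f)" "marker_homeo n x f g" unfolding H_def by auto
        show "U \<in> \<theta> ` A"
        proof (rule image_eqI)
          show "U = \<theta> (core_of n f)" unfolding f(1) \<theta>[OF f(2)] ..
          show "core_of n f \<in> A" unfolding A_def using f(2) by blast
        qed
      qed
    qed
  qed
  then have "Ox_group n x \<cong> (O1_group m)\<lparr>carrier := H\<rparr>" by (rule is_isoI)
  ultimately show ?thesis by blast
qed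

end
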